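(* Assume $G_1,\dots,G_m$ satisfy (H1)–(H6). Then the set of points $\boldsymbol x\in V$ at which the Jacobian matrix $(\partial R_i/\partial X_j)_{1\le i\le m,1\le j\le r}(\boldsymbol x)$ has rank less than $m$ has codimension at least $2$ in $V$. In particular, the singular locus of $V$ has codimension at least $2$ in $V$.
   Context: Setup. Let $q$ be a prime power, $\mathbb F_q$ the field with $q$ elements, $\overline{\mathbb F}_q$ an algebraic closure. Let $m<r$ be positive integers and fix $k$ with $0\le k\le r-1$. Let $A_{r-1},\dots,A_0$ be indeterminates and let $\mathbb F_q[\boldsymbol A_k]$ denote the polynomial ring over $\mathbb F_q$ in the $r-1$ variables $A_j$, $j\neq k$. Identify a monic polynomial $f_{\boldsymbol a}=T^r+a_{r-1}T^{r-1}+\dots+a_0\in\overline{\mathbb F}_q[T]$ with $\boldsymbol a=(a_{r-1},\dots,a_0)\in\overline{\mathbb F}_q^{\,r}$. Let $G_1,\dots,G_m\in\mathbb F_q[\boldsymbol A_k]$ (viewed as functions on $\overline{\mathbb F}_q^{\,r}$ not depending on the coordinate $a_k$), let $W:=\{\boldsymbol a\in\overline{\mathbb F}_q^{\,r}:G_1(\boldsymbol a)=\dots=G_m(\boldsymbol a)=0\}$. Define the weight $\mathrm{wt}(A_j):=r-j$, extended additively to monomials; $\mathrm{wt}(G)$ is the maximal weight of a monomial of $G$ and $G^{\mathrm{wt}}$ is the sum of the terms of $G$ of weight $\mathrm{wt}(G)$. For $\mathcal B\subset\overline{\mathbb F}_q^{\,r}$, the discriminant locus is $\mathcal D(\mathcal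 B):=\{\boldsymbol a\in\mathcal B:\mathrm{Disc}(f_{\boldsymbol a})=0\}$, where $\mathrm{Disc}(f)=\mathrm{Res}(f,f')$, and the first subdiscriminant locus is $\mathcal S_1(\mathcal B):=\{\boldsymbol a\in\mathcal D(\mathcal B):\mathrm{Subdisc}(f_{\boldsymbol a})=0\}$, where $\mathrm{Subdisc}(f)$ is the first subresultant of $f$ and $f'$. Hypotheses: (H1) $G_1,\dots,G_m$ form a regular sequence in $\mathbb F_q[\boldsymbol A_k]$. (H2) The Jacobian matrix $(\partial G_i/\partial A_j)_{1\le i\le m,\ j\ne k}$ has rank $m$ at every point of $W$. (H3) $G_1^{\mathrm{wt}},\dots,G_m^{\mathrm{wt}}$ satisfy (H1) and (H2) (with $W$ replaced by $V(G_1^{\mathrm{wt}},\dots,G_m^{\mathrm{wt}})$). (H4) $\mathcal D(W)$ has codimension at least one in $W$. (H5) The set $\{\boldsymbol a\in\mathcal D(W):a_0=0\}\cup\mathcal S_1(W)$ has codimension at least one in $\mathcal D(W)$. (H6) $\mathcal D(V(G_1^{\mathrm{wt}},\dots,G_m^{\mathrm{wt}}))$ has codimension at least one in $V(G_1^{\mathrm{wt}},\dots,G_m^{\mathrm{wt}})\subset\overline{\mathbb F}_q^{\,r}$. Symmetric lift. Let $X_1,\dots,X_r$ be indeterminates and $\Pi_1,\dots,\Pi_r$ the elementary symmetric polynomials in them. $R_i\in\mathbb F_q[X_1,\dots,X_r]$ ($1\le i\le m$) is obtained from $G_i$ by substituting $A_j\mapsto(-1)^{r-j}\Pi_{r-j}(X_1,\dots,X_r)$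 for every $j\ne k$; $V:=\{R_1=\dots=R_m=0\}\subset\overline{\mathbb F}_q^{\,r}$. *)

theory Defs
  imports "HOL-Library.Poly_Mapping" "HOL-Library.Extended_Nat" "HOL-Computational_Algebra.Polynomial"
    "Subresultants.Subresultant" "Jordan_Normal_Form.DL_Rank"
begin

type_synonym 'a mpoly = "(nat \<Rightarrow>\<^sub>0 nat) \<Rightarrow>\<^sub>0 'a"

definition mconst :: "'a::comm_ring_1 \<Rightarrow> 'a mpoly" where
  "mconst c = Poly_Mapping.single 0 c"

definition mmonom :: "(nat \<Rightarrow>\<^sub>0 nat) \<Rightarrow> 'a::comm_ring_1 mpoly" where
  "mmonom t = Poly_Mapping.single t 1"

definition mvar :: "nat \<Rightarrow> 'a::comm_ring_1 mpoly" where
  "mvar i = mmonom (Poly_Mapping.single i 1)"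

definition mvars :: "'a::comm_ring_1 mpoly \<Rightarrow> nat set" where
  "mvars p = (\<Union>t\<in>Poly_Mapping.keys p. Poly_Mapping.keys t)"

definition meval_hom :: "('a::comm_ring_1 \<Rightarrow> 'b::comm_ring_1) \<Rightarrow> (nat \<Rightarrow> 'b) \<Rightarrow> 'a mpoly \<Rightarrow> 'b" where
  "meval_hom h s p = (\<Sum>t\<in>Poly_Mapping.keys p. h (Poly_Mapping.lookup p t) * (\<Prod>i\<in>Poly_Mapping.keys t. s i ^ Poly_Mapping.lookup t i))"

definition meval :: "(nat \<Rightarrow> 'a::comm_ring_1) \<Rightarrow> 'a mpoly \<Rightarrow> 'a" where
  "meval x p = meval_hom id x p"

definition msubst :: "(nat \<Rightarrow> 'a::comm_ring_1 mpoly) \<Rightarrow> 'a mpoly \<Rightarrow> 'a mpoly" where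
  "msubst s p = meval_hom mconst s p"

definition mpderiv :: "nat \<Rightarrow> 'a::comm_ring_1 mpoly \<Rightarrow> 'a mpoly" where
  "mpderiv i p = (\<Sum>t\<in>Poly_Mapping.keys p.
      mconst (of_nat (Poly_Mapping.lookup t i) * Poly_Mapping.lookup p t) * mmonom (t - Poly_Mapping.single i 1))"

text \<open>Elementary symmetric polynomial \<open>\<Pi>_s\<close> in the r variables \<open>X_1,\<dots>,X_r\<close>
  (variable i-1 standing for \<open>X_i\<close>).\<close>
definition esym :: "nat \<Rightarrow> nat \<Rightarrow> 'a::comm_ring_1 mpoly" where
  "esym r s = (\<Sum>S\<in>{S. S \<subseteq> {..<r} \<and> card S = s}. \<Prod>i\<in>S. mvar i)"

text \<open>Variable j stands for \<open>A_j\<close> (0 \<le> j < r), with weight r - j.\<close>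
definition mono_wt :: "nat \<Rightarrow> (nat \<Rightarrow>\<^sub>0 nat) \<Rightarrow> nat" where
  "mono_wt r t = (\<Sum>j\<in>Poly_Mapping.keys t. (r - j) * Poly_Mapping.lookup t j)"

definition poly_wt :: "nat \<Rightarrow> 'a::comm_ring_1 mpoly \<Rightarrow> nat" where
  "poly_wt r p = Max (insert 0 (mono_wt r ` Poly_Mapping.keys p))"

definition wt_part :: "nat \<Rightarrow> 'a::comm_ring_1 mpoly \<Rightarrow> 'a mpoly" where
  "wt_part r p = (\<Sum>t\<in>{t\<in>Poly_Mapping.keys p. mono_wt r t = poly_wt r p}. mconst (Poly_Mapping.lookup p t) * mmonom t)"

definition in_Fq :: "nat \<Rightarrow> 'a::field \<Rightarrow> bool" where
  "in_Fq q c \<longleftrightarrow> c ^ q = c"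

definition ring_Ak :: "nat \<Rightarrow> nat \<Rightarrow> nat \<Rightarrow> 'a::field mpoly set" where
  "ring_Ak q r k = {p. (\<forall>t\<in>Poly_Mapping.keys p. in_Fq q (Poly_Mapping.lookup p t)) \<and> mvars p \<subseteq> {..<r} - {k}}"

definition ideal_in :: "'b::comm_ring_1 set \<Rightarrow> (nat \<Rightarrow> 'b) \<Rightarrow> nat \<Rightarrow> 'b set" where
  "ideal_in R g i = {\<Sum>j<i. c j * g j | c. \<forall>j<i. c j \<in> R}"

definition regular_seq_in :: "'b::comm_ring_1 set \<Rightarrow> (nat \<Rightarrow> 'b) \<Rightarrow> nat \<Rightarrow> bool" where
  "regular_seq_in R g m \<longleftrightarrow>
     (\<forall>i<m. g i \<in> R) \<and> 1 \<notin> ideal_in R g m \<and>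
     (\<forall>i<m. \<forall>h\<in>R. g i * h \<in> ideal_in R g i \<longrightarrow> h \<in> ideal_in R g i)"

text \<open>Points of \<open>\<bar>F_q^r\<close>: functions vanishing outside \<open>{..<r}\<close>.\<close>
definition aff :: "nat \<Rightarrow> (nat \<Rightarrow> 'a::field) set" where
  "aff r = {x. \<forall>i\<ge>r. x i = 0}"

definition zero_set :: "nat \<Rightarrow> 'a::field mpoly set \<Rightarrow> (nat \<Rightarrow> 'a) set" where
  "zero_set r F = {x\<in>aff r. \<forall>f\<in>F. meval x f = 0}"

definition zclosed :: "nat \<Rightarrow> (nat \<Rightarrow> 'a::field) set \<Rightarrow> bool" where
  "zclosed r Z \<longleftrightarrow> (\<exists>F. (\<forall>f\<in>F. mvars f \<subseteq> {..<r}) \<and> Z = zero_set r F)"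

definition zclosure :: "nat \<Rightarrow> (nat \<Rightarrow> 'a::field) set \<Rightarrow> (nat \<Rightarrow> 'a) set" where
  "zclosure r S = \<Inter>{Z. zclosed r Z \<and> S \<subseteq> Z}"

definition zirreducible :: "nat \<Rightarrow> (nat \<Rightarrow> 'a::field) set \<Rightarrow> bool" where
  "zirreducible r Z \<longleftrightarrow> zclosed r Z \<and> Z \<noteq> {} \<and>
     (\<forall>Z1 Z2. zclosed r Z1 \<and> zclosed r Z2 \<and> Z = Z1 \<union> Z2 \<longrightarrow> Z = Z1 \<or> Z = Z2)"

definition adim :: "nat \<Rightarrow> (nat \<Rightarrow> 'a::field) set \<Rightarrow> enat" where
  "adim r S = Sup {enat n | n. \<exists>C. (\<forall>i\<le>n. zirreducible r (C i) \<and> C i \<subseteq> zclosure r S)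
                                    \<and> (\<forall>i<n. C i \<subset> C (Suc i))}"

text \<open>S has codimension at least c in B (empty S has dimension -1, so it always qualifies).\<close>
definition codim_ge :: "nat \<Rightarrow> nat \<Rightarrow> (nat \<Rightarrow> 'a::field) set \<Rightarrow> (nat \<Rightarrow> 'a) set \<Rightarrow> bool" where
  "codim_ge r c S B \<longleftrightarrow> S \<subseteq> B \<and> (S = {} \<or> adim r S + enat c \<le> adim r B)"

definition vanishing_ideal :: "nat \<Rightarrow> (nat \<Rightarrow> 'a::field) set \<Rightarrow> 'a mpoly set" where
  "vanishing_ideal r V = {f. mvars f \<subseteq> {..<r} \<and> (\<forall>x\<in>V. meval x f = 0)}"

definition tangent_space :: "nat \<Rightarrow> (nat \<Rightarrow> 'a::field) set \<Rightarrow> (nat \<Rightarrow> 'a) \<Rightarrow> (nat \<Rightarrow> 'a) set" where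
  "tangent_space r V x = {v\<in>aff r. \<forall>f\<in>vanishing_ideal r V. (\<Sum>j<r. meval x (mpderiv j f) * v j) = 0}"

definition local_dim :: "nat \<Rightarrow> (nat \<Rightarrow> 'a::field) set \<Rightarrow> (nat \<Rightarrow> 'a) \<Rightarrow> enat" where
  "local_dim r V x = Sup {adim r C | C. zirreducible r C \<and> C \<subseteq> V \<and> x \<in> C}"

definition sing_locus :: "nat \<Rightarrow> (nat \<Rightarrow> 'a::field) set \<Rightarrow> (nat \<Rightarrow> 'a) set" where
  "sing_locus r V = {x\<in>V. adim r (tangent_space r V x) > local_dim r V x}"

definition fpoly :: "nat \<Rightarrow> (nat \<Rightarrow> 'a::comm_ring_1) \<Rightarrow> 'a poly" where
  "fpoly r a = monom 1 r + (\<Sum>j<r. monom (a j) j)"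

definition Disc :: "'a::field poly \<Rightarrow> 'a" where
  "Disc f = resultant f (pderiv f)"

definition Subdisc :: "'a::field poly \<Rightarrow> 'a" where
  "Subdisc f = coeff (subresultant 1 f (pderiv f)) 1"

definition disc_locus :: "nat \<Rightarrow> (nat \<Rightarrow> 'a::field) set \<Rightarrow> (nat \<Rightarrow> 'a) set" where
  "disc_locus r B = {a\<in>B. Disc (fpoly r a) = 0}"

definition subdisc_locus :: "nat \<Rightarrow> (nat \<Rightarrow> 'a::field) set \<Rightarrow> (nat \<Rightarrow> 'a) set" where
  "subdisc_locus r B = {a\<in>disc_locus r B. Subdisc (fpoly r a) = 0}"

text \<open>Jacobian with respect to the variables \<open>A_j, j \<noteq> k\<close> (columns in increasing order of j).\<close>
definition jac_Ak :: "nat \<Rightarrow> nat \<Rightarrow> nat \<Rightarrow> (nat \<Rightarrow> 'a::field mpoly) \<Rightarrow> (nat \<Rightarrow> 'a) \<Rightarrow> 'a mat" where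
  "jac_Ak r k m G a = mat m (r - 1)
     (\<lambda>(i, j). meval a (mpderiv (if j < k then j else Suc j) (G i)))"

definition jac :: "nat \<Rightarrow> nat \<Rightarrow> (nat \<Rightarrow> 'a::field mpoly) \<Rightarrow> (nat \<Rightarrow> 'a) \<Rightarrow> 'a mat" where
  "jac r m R x = mat m r (\<lambda>(i, j). meval x (mpderiv j (R i)))"

abbreviation mrank :: "nat \<Rightarrow> 'a::field mat \<Rightarrow> nat" where
  "mrank m A \<equiv> vec_space.rank m A"

definition H1H2 :: "nat \<Rightarrow> nat \<Rightarrow> nat \<Rightarrow> nat \<Rightarrow> (nat \<Rightarrow> 'a::field mpoly) \<Rightarrow> bool" where
  "H1H2 q r k m G \<longleftrightarrow> regular_seq_in (ring_Ak q r k) G m \<and>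
     (\<forall>a\<in>zero_set r (G ` {..<m}). mrank m (jac_Ak r k m G a) = m)"

text \<open>\<open>R_i\<close>: substitute \<open>A_j \<mapsto> (-1)^(r-j) \<Pi>_{r-j}(X_1..X_r)\<close> (A_k does not occur in G_i).\<close>
definition sym_lift :: "nat \<Rightarrow> 'a::field mpoly \<Rightarrow> 'a mpoly" where
  "sym_lift r G = msubst (\<lambda>j. mconst ((-1) ^ (r - j)) * esym r (r - j)) G"

end

(*
  Idea. Let Phi send x to the coefficients of the product of the T - x_i, so that V is the preimage of W under Phi.

  At a point x of V whose coordinates are distinct, or where exactly two of them coincide and their common value is
  nonzero, the image of the differential of Phi is the space of all polynomials of degree < r, respectively of those
  vanishing at the double root; in both cases it projects onto the coordinates different from k. By (H2) the Jacobian of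
  the R_i then has rank m. Hence the rank drops only over the locus of (H5), which has codimension 2 in W by (H4).

  Phi is a finite map whose fibres are the orbits of the symmetric group, so it is closed (norms over orbits are
  polynomials in the elementary symmetric functions), strict inclusions of irreducible sets stay strict under it, and
  irreducible sets can be lifted (a minimal closed set with given image is irreducible; it exists by Zorn's lemma as
  fibres are finite). So codimensions in V can be computed in W.

  For the singular locus one needs that V has local dimension at least r - m everywhere. By (H3) at the origin, the
  leading form of G_i contains a variable A_j linearly, and for reasons of weight all other monomials of G_i involve only
  variables of smaller weight. So W is the graph of a polynomial map, irreducible of dimension r - m, and permutations
  move a lift of W through every point of V.
*)

theory Submission
  imports Defs "HOL-Combinatorics.Cycles"
begin

section \<open>Evaluation of polynomials and closed sets\<close>

text \<open>Dimension is the supremum of the lengths of chains of irreducible closed sets, so every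
  estimate is a transformation of chains. Comparing V with W only moves chains through
  \<open>root_map\<close>; the one absolute upper bound required is r - m for the kernel of a
  surjective Jacobian. It rests on the bound r for chains in affine r-space, obtained by counting: a
  chain of length n > r yields n algebraically independent functions, and these have more monomials
  than fit into polynomials in r variables of the degrees in question.

  At a double root \<rho>, the k-th coefficient is the only freedom left once the others are
  prescribed; adding a multiple of T^k makes the polynomial vanish at \<rho> provided \<rho>^k is
  nonzero. This is where a_0 enters: if it is nonzero, so are all roots.

  In positive characteristic f' may drop in degree or vanish. The vanishing of \<open>Disc\<close>
  and \<open>Subdisc\<close> is therefore read off from explicit null vectors of the subresultant
  matrix (powers of a common root, divided differences at two roots), which covers these cases
  too.\<close>

definition mono_eval :: "(nat \<Rightarrow> 'b::comm_ring_1) \<Rightarrow> (nat \<Rightarrow>\<^sub>0 nat) \<Rightarrow> 'b" where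
  "mono_eval s t = (\<Prod>i\<in>Poly_Mapping.keys t. s i ^ Poly_Mapping.lookup t i)"

lemma mono_eval_superset:
  assumes "finite A" "Poly_Mapping.keys t \<subseteq> A"
  shows "mono_eval s t = (\<Prod>i\<in>A. s i ^ Poly_Mapping.lookup t i)"
  unfolding mono_eval_def
  by (rule prod.mono_neutral_left) (use assms in \<open>auto simp: in_keys_iff\<close>)

lemma mono_eval_zero [simp]: "mono_eval s 0 = 1"
  by (simp add: mono_eval_def)

lemma mono_eval_single [simp]: "mono_eval s (Poly_Mapping.single i n) = s i ^ n"
  by (cases "n = 0") (simp_all add: mono_eval_def)

lemma mono_eval_add: "mono_eval s (t + u) = mono_eval s t * mono_eval s u"
proof -
  let ?A = "Poly_Mapping.keys t \<union> Poly_Mapping.keys u"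
  have "mono_eval s (t + u) = (\<Prod>i\<in>?A. s i ^ Poly_Mapping.lookup (t + u) i)"
    by (rule mono_eval_superset) (auto dest: set_mp[OF Poly_Mapping.keys_add])
  moreover have "mono_eval s t = (\<Prod>i\<in>?A. s i ^ Poly_Mapping.lookup t i)"
    "mono_eval s u = (\<Prod>i\<in>?A. s i ^ Poly_Mapping.lookup u i)"
    by (rule mono_eval_superset; auto)+
  ultimately show ?thesis
    by (simp add: lookup_add power_add prod.distrib)
qed

lemma poly_mapping_sum_single: "p = (\<Sum>t\<in>Poly_Mapping.keys p. Poly_Mapping.single t (Poly_Mapping.lookup p t))"
proof (rule poly_mapping_eqI)
  fix k
  show "Poly_Mapping.lookup p k =
    Poly_Mapping.lookup (\<Sum>t\<in>Poly_Mapping.keys p. Poly_Mapping.single t (Poly_Mapping.lookup p t)) k"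
    by (cases "k \<in> Poly_Mapping.keys p")
      (auto simp: lookup_sum lookup_single when_def in_keys_iff sum.delta)
qed

section \<open>Evaluation along a coefficient homomorphism (identity, or constants into one-variable
  polynomials)\<close>

context comm_ring_hom
begin

lemma meval_hom_superset:
  assumes "finite A" "Poly_Mapping.keys p \<subseteq> A"
  shows "meval_hom hom s p = (\<Sum>t\<in>A. hom (Poly_Mapping.lookup p t) * mono_eval s t)"
  unfolding meval_hom_def mono_eval_def[symmetric]
  by (rule sum.mono_neutral_left) (use assms in \<open>auto simp: in_keys_iff\<close>)

lemma meval_hom_zero: "meval_hom hom s 0 = 0"
  by (simp add: meval_hom_def)

lemma meval_hom_single: "meval_hom hom s (Poly_Mapping.single t c) = hom c * mono_eval s t"
  by (cases "c = 0") (simp_all add: meval_hom_def mono_eval_def)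

lemma meval_hom_add: "meval_hom hom s (p + q) = meval_hom hom s p + meval_hom hom s q"
proof -
  let ?A = "Poly_Mapping.keys p \<union> Poly_Mapping.keys q"
  have "meval_hom hom s (p + q) = (\<Sum>t\<in>?A. hom (Poly_Mapping.lookup (p + q) t) * mono_eval s t)"
    by (rule meval_hom_superset) (auto dest: set_mp[OF Poly_Mapping.keys_add])
  moreover have "meval_hom hom s p = (\<Sum>t\<in>?A. hom (Poly_Mapping.lookup p t) * mono_eval s t)"
    "meval_hom hom s q = (\<Sum>t\<in>?A. hom (Poly_Mapping.lookup q t) * mono_eval s t)"
    by (rule meval_hom_superset; auto)+
  ultimately show ?thesis
    by (simp add: lookup_add hom_add distrib_right sum.distrib)
qed

lemma meval_hom_sum: "meval_hom hom s (\<Sum>i\<in>A. f i) = (\<Sum>i\<in>A. meval_hom hom s (f i))"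
  by (induction A rule: infinite_finite_induct) (simp_all add: meval_hom_add meval_hom_zero)

lemma meval_hom_mult: "meval_hom hom s (p * q) = meval_hom hom s p * meval_hom hom s q"
proof -
  have eq: "p * q = (\<Sum>t\<in>Poly_Mapping.keys p. \<Sum>u\<in>Poly_Mapping.keys q.
      Poly_Mapping.single (t + u) (Poly_Mapping.lookup p t * Poly_Mapping.lookup q u))"
    by (subst poly_mapping_sum_single[of p], subst poly_mapping_sum_single[of q])
      (simp add: sum_product mult_single)
  show ?thesis
    unfolding eq meval_hom_sum meval_hom_single mono_eval_add hom_mult
    by (simp add: meval_hom_def mono_eval_def[symmetric] sum_product mult_ac)
qed

lemma meval_hom_mconst [simp]: "meval_hom hom s (mconst c) = hom c"
  by (simp add: mconst_def meval_hom_single)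

lemma meval_hom_mvar [simp]: "meval_hom hom s (mvar i) = s i"
  by (simp add: mvar_def mmonom_def meval_hom_single)

lemma meval_hom_one: "meval_hom hom s 1 = 1"
  using meval_hom_mconst[of s 1] by (simp add: mconst_def)

lemma meval_hom_prod: "meval_hom hom s (\<Prod>i\<in>A. f i) = (\<Prod>i\<in>A. meval_hom hom s (f i))"
  by (induction A rule: infinite_finite_induct) (simp_all add: meval_hom_mult meval_hom_one)

lemma meval_hom_power: "meval_hom hom s (f ^ n) = meval_hom hom s f ^ n"
  by (induction n) (simp_all add: meval_hom_mult meval_hom_one)

lemma meval_hom_msubst:
  "meval_hom hom s (msubst \<sigma> p) = meval_hom hom (\<lambda>j. meval_hom hom s (\<sigma> j)) p"
  unfolding msubst_def
  by (simp add: meval_hom_def[of mconst] meval_hom_sum meval_hom_mult meval_hom_prod meval_hom_power)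
    (simp add: meval_hom_def)

end

lemma comm_ring_hom_id: "comm_ring_hom (id :: 'a::comm_ring_1 \<Rightarrow> 'a)"
  by standard auto

lemma comm_ring_hom_const_poly: "comm_ring_hom (\<lambda>c::'a::comm_ring_1. [:c:])"
  by standard (auto simp: one_pCons)

lemmas meval_zero [simp] = comm_ring_hom.meval_hom_zero[OF comm_ring_hom_id, folded meval_def]
  and meval_add [simp] = comm_ring_hom.meval_hom_add[OF comm_ring_hom_id, folded meval_def]
  and meval_mult [simp] = comm_ring_hom.meval_hom_mult[OF comm_ring_hom_id, folded meval_def]
  and meval_sum [simp] = comm_ring_hom.meval_hom_sum[OF comm_ring_hom_id, folded meval_def]
  and meval_prod [simp] = comm_ring_hom.meval_hom_prod[OF comm_ring_hom_id, folded meval_def]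
  and meval_mconst [simp] = comm_ring_hom.meval_hom_mconst[OF comm_ring_hom_id, folded meval_def, unfolded id_apply]
  and meval_mvar [simp] = comm_ring_hom.meval_hom_mvar[OF comm_ring_hom_id, folded meval_def]
  and meval_msubst = comm_ring_hom.meval_hom_msubst[OF comm_ring_hom_id, folded meval_def]
  and meval_single = comm_ring_hom.meval_hom_single[OF comm_ring_hom_id, folded meval_def, unfolded id_apply]
  and meval_superset = comm_ring_hom.meval_hom_superset[OF comm_ring_hom_id, folded meval_def, unfolded id_apply]

lemma meval_eq: "meval x p = (\<Sum>t\<in>Poly_Mapping.keys p. Poly_Mapping.lookup p t * mono_eval x t)"
  by (simp add: meval_def meval_hom_def mono_eval_def)

lemma mono_eval_cong:
  "(\<And>i. i \<in> Poly_Mapping.keys t \<Longrightarrow> x i = y i) \<Longrightarrow> mono_eval x t = mono_eval y t"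
  unfolding mono_eval_def by (rule prod.cong) auto

lemma meval_cong:
  assumes "\<And>i. i \<in> mvars p \<Longrightarrow> x i = y i"
  shows "meval x p = meval y p"
  unfolding meval_eq
  by (intro sum.cong refl arg_cong2[of _ _ _ _ times] mono_eval_cong) (use assms in \<open>auto simp: mvars_def\<close>)

lemma mvars_zero [simp]: "mvars 0 = {}"
  by (simp add: mvars_def)

lemma mvars_mconst [simp]: "mvars (mconst c) = {}"
  by (simp add: mvars_def mconst_def)

lemma mvars_mvar: "mvars (mvar i) \<subseteq> {i}"
  by (auto simp: mvars_def mvar_def mmonom_def)

lemma mvars_add: "mvars (p + q) \<subseteq> mvars p \<union> mvars q"
  using Poly_Mapping.keys_add[of p q] by (auto simp: mvars_def)

lemma mvars_mult: "mvars (p * q) \<subseteq> mvars p \<union> mvars q"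
proof
  fix i assume "i \<in> mvars (p * q)"
  then obtain t where t: "t \<in> Poly_Mapping.keys (p * q)" "i \<in> Poly_Mapping.keys t"
    by (auto simp: mvars_def)
  then obtain a b where "t = a + b" "a \<in> Poly_Mapping.keys p" "b \<in> Poly_Mapping.keys q"
    using keys_mult[of p q] by auto
  then show "i \<in> mvars p \<union> mvars q"
    using t(2) Poly_Mapping.keys_add[of a b] by (auto simp: mvars_def)
qed

lemma mvars_sum: "mvars (\<Sum>i\<in>A. f i) \<subseteq> (\<Union>i\<in>A. mvars (f i))"
proof (induction A rule: infinite_finite_induct)
  case (insert a A)
  then show ?case using mvars_add[of "f a" "\<Sum>i\<in>A. f i"] by auto
qed auto

lemma mvars_one [simp]: "mvars 1 = {}"
  using mvars_mconst[of 1] by (simp add: mconst_def)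

lemma mvars_prod: "mvars (\<Prod>i\<in>A. f i) \<subseteq> (\<Union>i\<in>A. mvars (f i))"
proof (induction A rule: infinite_finite_induct)
  case (insert a A)
  then show ?case using mvars_mult[of "f a" "\<Prod>i\<in>A. f i"] by auto
qed auto

lemma mvars_power: "mvars (p ^ n) \<subseteq> mvars p"
  using mvars_prod[of "\<lambda>_. p" "{..<n}"] by (auto split: if_splits)

lemma mvars_msubst: "mvars (msubst \<sigma> p) \<subseteq> (\<Union>j\<in>mvars p. mvars (\<sigma> j))"
proof -
  have "mvars (msubst \<sigma> p) \<subseteq> (\<Union>t\<in>Poly_Mapping.keys p. mvars (mconst (Poly_Mapping.lookup p t) *
    (\<Prod>i\<in>Poly_Mapping.keys t. \<sigma> i ^ Poly_Mapping.lookup t i)))"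
    unfolding msubst_def meval_hom_def by (rule mvars_sum)
  also have "\<dots> \<subseteq> (\<Union>t\<in>Poly_Mapping.keys p. \<Union>i\<in>Poly_Mapping.keys t. mvars (\<sigma> i ^ Poly_Mapping.lookup t i))"
    by (intro UN_mono subset_refl order.trans[OF mvars_mult]) (use mvars_prod in auto)
  also have "\<dots> \<subseteq> (\<Union>t\<in>Poly_Mapping.keys p. \<Union>i\<in>Poly_Mapping.keys t. mvars (\<sigma> i))"
    by (intro UN_mono subset_refl mvars_power)
  finally show ?thesis by (auto simp: mvars_def)
qed

text \<open>Closed sets only see values, so functions replace formal polynomials. The product clause
  multiplies by a single variable, which keeps inductions short; general products are
  derived.\<close>

inductive pfun :: "((nat \<Rightarrow> 'a::field) \<Rightarrow> 'a) \<Rightarrow> bool" where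
  pfun_const: "pfun (\<lambda>x. c)"
| pfun_add: "pfun f \<Longrightarrow> pfun g \<Longrightarrow> pfun (\<lambda>x. f x + g x)"
| pfun_var_mult: "pfun f \<Longrightarrow> pfun (\<lambda>x. x i * f x)"

lemma pfun_cmult: "pfun f \<Longrightarrow> pfun (\<lambda>x. c * f x)"
proof (induction rule: pfun.induct)
  case (pfun_add f g)
  then show ?case by (simp add: distrib_left pfun.pfun_add)
next
  case (pfun_var_mult f i)
  then show ?case using pfun.pfun_var_mult[of "\<lambda>x. c * f x" i] by (simp add: mult.left_commute)
qed (auto intro: pfun.intros)

lemma pfun_mult: "pfun f \<Longrightarrow> pfun g \<Longrightarrow> pfun (\<lambda>x. f x * g x)"
proof (induction rule: pfun.induct)
  case (pfun_add f1 f2)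
  then show ?case by (simp add: distrib_right pfun.pfun_add)
next
  case (pfun_var_mult f i)
  then show ?case using pfun.pfun_var_mult[of "\<lambda>x. f x * g x" i] by (simp add: mult.assoc)
qed (auto intro: pfun_cmult)

lemma pfun_var: "pfun (\<lambda>x. x i)"
  using pfun_var_mult[OF pfun_const[of 1], of i] by simp

lemma pfun_uminus: "pfun f \<Longrightarrow> pfun (\<lambda>x. - f x)"
  using pfun_cmult[of f "-1"] by simp

lemma pfun_diff: "pfun f \<Longrightarrow> pfun g \<Longrightarrow> pfun (\<lambda>x. f x - g x)"
  using pfun_add[OF _ pfun_uminus, of f g] by simp

lemma pfun_sum: "(\<And>i. i \<in> A \<Longrightarrow> pfun (f i)) \<Longrightarrow> pfun (\<lambda>x. \<Sum>i\<in>A. f i x)"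
  by (induction A rule: infinite_finite_induct) (auto intro: pfun_const pfun_add)

lemma pfun_prod: "(\<And>i. i \<in> A \<Longrightarrow> pfun (f i)) \<Longrightarrow> pfun (\<lambda>x. \<Prod>i\<in>A. f i x)"
  by (induction A rule: infinite_finite_induct) (auto intro: pfun_const pfun_mult)

lemma pfun_power: "pfun f \<Longrightarrow> pfun (\<lambda>x. f x ^ n)"
  by (induction n) (auto intro: pfun_const pfun_mult)

lemmas pfun_intros = pfun_const pfun_var pfun_add pfun_mult pfun_uminus pfun_diff pfun_sum pfun_prod pfun_power

lemma pfun_compose:
  assumes "pfun f" "\<And>i. pfun (\<lambda>x. \<phi> x i)"
  shows "pfun (\<lambda>x. f (\<phi> x))"
  using assms(1) by induction (auto intro: pfun_intros assms(2))

lemma pfun_meval: "pfun (\<lambda>x. meval x p)"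
  unfolding meval_eq mono_eval_def by (intro pfun_intros)

text \<open>Coordinates from r on vanish on \<open>aff r\<close>, so variables outside the range may
  be replaced by 0.\<close>

lemma pfun_imp_meval:
  assumes "pfun f"
  shows "\<exists>p. mvars p \<subseteq> {..<r} \<and> (\<forall>x\<in>aff r. meval x p = f x)"
  using assms
proof induction
  case (pfun_const c)
  show ?case by (intro exI[of _ "mconst c"]) auto
next
  case (pfun_add f g)
  then obtain p q where "mvars p \<subseteq> {..<r} \<and> (\<forall>x\<in>aff r. meval x p = f x)"
    "mvars q \<subseteq> {..<r} \<and> (\<forall>x\<in>aff r. meval x q = g x)" by blast
  then show ?case by (intro exI[of _ "p + q"]) (use mvars_add[of p q] in auto)
next
  case (pfun_var_mult f i)
  then obtain p where p: "mvars p \<subseteq> {..<r} \<and> (\<forall>x\<in>aff r. meval x p = f x)" by blast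
  show ?case
  proof (cases "i < r")
    case True
    then show ?thesis
      by (intro exI[of _ "mvar i * p"]) (use mvars_mult[of "mvar i" p] mvars_mvar[of i] p in auto)
  next
    case False
    then show ?thesis by (intro exI[of _ 0]) (auto simp: aff_def)
  qed
qed

section \<open>The Zariski topology on affine space\<close>

lemma zclosed_iff:
  "zclosed r Z \<longleftrightarrow> (\<exists>F. (\<forall>f\<in>F. pfun f) \<and> Z = {x\<in>aff r. \<forall>f\<in>F. f x = 0})"
proof
  assume "zclosed r Z"
  then obtain F where "Z = zero_set r F" by (auto simp: zclosed_def)
  then show "\<exists>F. (\<forall>f\<in>F. pfun f) \<and> Z = {x\<in>aff r. \<forall>f\<in>F. f x = 0}"
    by (intro exI[of _ "(\<lambda>p x. meval x p) ` F"]) (auto simp: zero_set_def pfun_meval)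
next
  assume "\<exists>F. (\<forall>f\<in>F. pfun f) \<and> Z = {x\<in>aff r. \<forall>f\<in>F. f x = 0}"
  then obtain F where F: "\<forall>f\<in>F. pfun f" "Z = {x\<in>aff r. \<forall>f\<in>F. f x = 0}" by blast
  then have "\<forall>f\<in>F. \<exists>p. mvars p \<subseteq> {..<r} \<and> (\<forall>x\<in>aff r. meval x p = f x)"
    using pfun_imp_meval by blast
  from bchoice[OF this] obtain P
    where P: "\<forall>f\<in>F. mvars (P f) \<subseteq> {..<r} \<and> (\<forall>x\<in>aff r. meval x (P f) = f x)" by blast
  then show "zclosed r Z"
    unfolding zclosed_def
    by (intro exI[of _ "P ` F"]) (auto simp: zero_set_def F(2))
qed

lemma zclosed_zero_set: "zclosed r (zero_set r F)"
  unfolding zclosed_iff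
  by (intro exI[of _ "(\<lambda>p x. meval x p) ` F"]) (auto simp: zero_set_def pfun_meval)

lemma zclosed_subset_aff: "zclosed r Z \<Longrightarrow> Z \<subseteq> aff r"
  by (auto simp: zclosed_iff)

lemma zclosed_zero_locus: "(\<And>f. f \<in> F \<Longrightarrow> pfun f) \<Longrightarrow> zclosed r {x\<in>aff r. \<forall>f\<in>F. f x = 0}"
  by (auto simp: zclosed_iff)

lemma zclosed_aff: "zclosed r (aff r)"
  using zclosed_zero_locus[of "{}" r] by simp

lemma zclosed_empty: "zclosed r {}"
  using zclosed_zero_locus[of "{\<lambda>x. 1}" r] by (simp add: pfun_const)

lemma zclosed_separate:
  assumes "zclosed r Z" "x \<in> aff r" "x \<notin> Z"
  obtains f where "pfun f" "\<And>z. z \<in> Z \<Longrightarrow> f z = 0" "f x \<noteq> 0"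
  using assms by (auto simp: zclosed_iff)

text \<open>The equations are all polynomial functions vanishing on the intersection. The factor
  \<open>aff r\<close> covers the empty family.\<close>

lemma zclosed_Inter:
  assumes "\<And>Z. Z \<in> \<Z> \<Longrightarrow> zclosed r Z"
  shows "zclosed r (aff r \<inter> \<Inter>\<Z>)"
proof -
  let ?F = "{f. pfun f \<and> (\<forall>x\<in>aff r \<inter> \<Inter>\<Z>. f x = 0)}"
  have "aff r \<inter> \<Inter>\<Z> = {x\<in>aff r. \<forall>f\<in>?F. f x = 0}"
  proof (intro equalityI subsetI)
    fix x assume x: "x \<in> {x\<in>aff r. \<forall>f\<in>?F. f x = 0}"
    have "x \<in> Z" if Z: "Z \<in> \<Z>" for Z
    proof (rule ccontr)
      assume "x \<notin> Z"
      then obtain f where "pfun f" "\<And>z. z \<in> Z \<Longrightarrow> f z = 0" "f x \<noteq> 0"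
        using zclosed_separate[OF assms[OF Z]] x by blast
      then show False using x Z by auto
    qed
    then show "x \<in> aff r \<inter> \<Inter>\<Z>" using x by auto
  qed auto
  then show ?thesis using zclosed_zero_locus[of ?F r] by auto
qed

lemma zclosed_Int: "zclosed r A \<Longrightarrow> zclosed r B \<Longrightarrow> zclosed r (A \<inter> B)"
  using zclosed_Inter[of "{A, B}" r] zclosed_subset_aff[of r A] by (auto simp: Int_absorb1 Int_assoc[symmetric])

lemma zclosed_Un:
  assumes "zclosed r A" "zclosed r B"
  shows "zclosed r (A \<union> B)"
proof -
  obtain F G where F: "\<forall>f\<in>F. pfun f" "A = {x\<in>aff r. \<forall>f\<in>F. f x = 0}"
    and G: "\<forall>f\<in>G. pfun f" "B = {x\<in>aff r. \<forall>f\<in>G. f x = 0}"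
    using assms by (auto simp: zclosed_iff)
  let ?H = "{\<lambda>x. f x * g x | f g. f \<in> F \<and> g \<in> G}"
  have "A \<union> B = {x\<in>aff r. \<forall>h\<in>?H. h x = 0}"
    unfolding F(2) G(2) by auto fastforce
  moreover have "pfun h" if "h \<in> ?H" for h
    using that F(1) G(1) by (auto intro: pfun_mult)
  ultimately show ?thesis using zclosed_zero_locus[of ?H r] by auto
qed

lemma zclosed_UN_finite: "finite I \<Longrightarrow> (\<And>i. i \<in> I \<Longrightarrow> zclosed r (A i)) \<Longrightarrow> zclosed r (\<Union>i\<in>I. A i)"
  by (induction I rule: finite_induct) (auto intro: zclosed_Un zclosed_empty)

lemma zclosed_vimage:
  assumes "zclosed r Z" "\<And>i. pfun (\<lambda>x. \<phi> x i)" "\<And>x. x \<in> aff r \<Longrightarrow> \<phi> x \<in> aff r"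
  shows "zclosed r {x\<in>aff r. \<phi> x \<in> Z}"
proof -
  obtain F where F: "\<forall>f\<in>F. pfun f" "Z = {x\<in>aff r. \<forall>f\<in>F. f x = 0}"
    using assms by (auto simp: zclosed_iff)
  have "{x\<in>aff r. \<phi> x \<in> Z} = {x\<in>aff r. \<forall>h\<in>(\<lambda>f x. f (\<phi> x)) ` F. h x = 0}"
    using assms(3) by (auto simp: F(2))
  also have "zclosed r \<dots>"
    by (rule zclosed_zero_locus) (use F(1) assms(2) in \<open>auto intro: pfun_compose\<close>)
  finally show ?thesis .
qed

lemma zclosure_closed: "zclosed r Z \<Longrightarrow> zclosure r Z = Z"
  by (auto simp: zclosure_def)

lemma zclosure_least: "S \<subseteq> Z \<Longrightarrow> zclosed r Z \<Longrightarrow> zclosure r S \<subseteq> Z"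
  by (auto simp: zclosure_def)

lemma subset_zclosure: "S \<subseteq> zclosure r S"
  by (auto simp: zclosure_def)

lemma zclosed_zclosure: "S \<subseteq> aff r \<Longrightarrow> zclosed r (zclosure r S)"
proof -
  assume "S \<subseteq> aff r"
  then have "zclosure r S = aff r \<inter> \<Inter>{Z. zclosed r Z \<and> S \<subseteq> Z}"
    using zclosed_aff by (auto simp: zclosure_def)
  then show ?thesis using zclosed_Inter[of "{Z. zclosed r Z \<and> S \<subseteq> Z}" r] by auto
qed

section \<open>Irreducible sets and polynomial identities\<close>

lemma zirreducible_UN:
  assumes "finite I" "zirreducible r C" "\<And>i. i \<in> I \<Longrightarrow> zclosed r (A i)" "C \<subseteq> (\<Union>i\<in>I. A i)"
  shows "\<exists>i\<in>I. C \<subseteq> A i"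
  using assms(1,3,4)
proof (induction I rule: finite_induct)
  case empty
  then show ?case using assms(2) by (auto simp: zirreducible_def)
next
  case (insert i I)
  let ?B = "\<Union>j\<in>I. A j"
  have "zclosed r ?B" using insert by (intro zclosed_UN_finite) auto
  moreover have "zclosed r C" using assms(2) by (simp add: zirreducible_def)
  ultimately have cl: "zclosed r (C \<inter> A i)" "zclosed r (C \<inter> ?B)"
    using insert.prems by (auto intro: zclosed_Int)
  have "C = C \<inter> A i \<union> C \<inter> ?B" using insert.prems by auto
  then have "C = C \<inter> A i \<or> C = C \<inter> ?B"
    using assms(2) cl unfolding zirreducible_def by blast
  then show ?case
  proof
    assume "C = C \<inter> ?B"
    then show ?thesis using insert.IH insert.prems by blast
  qed auto
qed

lemma zirreducible_prod_zero:
  assumes "zirreducible r C" "pfun f" "pfun g" "\<And>x. x \<in> C \<Longrightarrow> f x * g x = 0"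
  shows "(\<forall>x\<in>C. f x = 0) \<or> (\<forall>x\<in>C. g x = 0)"
proof -
  let ?Z = "\<lambda>b. {x\<in>aff r. \<forall>h\<in>{if b then f else g}. h x = 0}"
  have cl: "zclosed r C" using assms(1) by (simp add: zirreducible_def)
  have "\<exists>b\<in>UNIV. C \<subseteq> ?Z b"
  proof (rule zirreducible_UN[OF _ assms(1)])
    show "zclosed r (?Z b)" for b
      by (rule zclosed_zero_locus) (use assms in auto)
    show "C \<subseteq> (\<Union>b\<in>UNIV. ?Z b)"
      using assms(4) zclosed_subset_aff[OF cl] by (auto simp: UNIV_bool)
  qed auto
  then show ?thesis by (auto split: if_splits)
qed

text \<open>Over a finite field, the product of all T - a, plus 1, has no root.\<close>

lemma infinite_UNIV_alg_closed: "infinite (UNIV :: 'a::alg_closed_field set)"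
proof
  assume fin: "finite (UNIV :: 'a set)"
  define P where "P = (\<Prod>a\<in>UNIV. [:-a, 1::'a:])"
  have deg: "degree P = card (UNIV :: 'a set)"
    unfolding P_def by (subst degree_prod_sum_eq) auto
  then have "degree P > 0" using fin by (simp add: finite_UNIV_card_ge_0)
  moreover have "degree (P + 1) = degree P"
    using calculation by (simp add: degree_add_eq_left)
  ultimately obtain z where "poly (P + 1) z = 0"
    using alg_closed_imp_poly_has_root[of "P + 1"] by auto
  moreover have "poly P z = 0"
    unfolding P_def poly_prod using fin by (auto intro!: prod_zero bexI[of _ z])
  ultimately show False by simp
qed

lemma pfun_line:
  assumes "pfun f"
  shows "\<exists>P. \<forall>t. f (\<lambda>i. a i + t * b i) = poly P t"
  using assms
proof induction
  case (pfun_const c)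
  show ?case by (intro exI[of _ "[:c:]"]) auto
next
  case (pfun_add f g)
  then obtain P Q where "\<forall>t. f (\<lambda>i. a i + t * b i) = poly P t" "\<forall>t. g (\<lambda>i. a i + t * b i) = poly Q t" by blast
  then show ?case by (intro exI[of _ "P + Q"]) auto
next
  case (pfun_var_mult f i)
  then obtain P where "\<forall>t. f (\<lambda>i. a i + t * b i) = poly P t" by blast
  then show ?case by (intro exI[of _ "[:a i, b i:] * P"]) (auto simp: algebra_simps)
qed

text \<open>On the line joining a point with f nonzero to one with g nonzero, both become nonzero
  polynomials in one variable whose product has infinitely many roots.\<close>

lemma pfun_prod_zero:
  fixes f g :: "(nat \<Rightarrow> 'a::alg_closed_field) \<Rightarrow> 'a"
  assumes "pfun f" "pfun g" "\<And>x. f x * g x = 0"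
  shows "(\<forall>x. f x = 0) \<or> (\<forall>x. g x = 0)"
proof (rule ccontr)
  assume "\<not> ?thesis"
  then obtain a b where ab: "f a \<noteq> 0" "g b \<noteq> 0" by auto
  obtain P Q where P: "\<forall>t. f (\<lambda>i. a i + t * (b i - a i)) = poly P t"
    and Q: "\<forall>t. g (\<lambda>i. a i + t * (b i - a i)) = poly Q t"
    using pfun_line[OF assms(1), of a "\<lambda>i. b i - a i"] pfun_line[OF assms(2), of a "\<lambda>i. b i - a i"] by blast
  have "poly (P * Q) t = 0" for t using assms(3) P Q by (metis poly_mult)
  then have "P * Q = 0"
    using poly_roots_finite[of "P * Q"] infinite_UNIV_alg_closed[where 'a='a] by auto
  moreover have "poly P 0 \<noteq> 0" "poly Q 1 \<noteq> 0"
    using P[rule_format, of 0] Q[rule_format, of 1] ab by auto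
  ultimately show False by auto
qed

text \<open>Equations of two closed pieces pull back to functions with product zero on the parameter
  space. This is how linear spaces and graphs are recognised as irreducible.\<close>

lemma zirreducible_range:
  fixes \<phi> :: "(nat \<Rightarrow> 'a::alg_closed_field) \<Rightarrow> nat \<Rightarrow> 'a"
  assumes "\<And>i. pfun (\<lambda>x. \<phi> x i)" "zclosed r (range \<phi>)"
  shows "zirreducible r (range \<phi>)"
  unfolding zirreducible_def
proof (intro conjI allI impI assms(2))
  show "range \<phi> \<noteq> {}" by auto
  fix Z1 Z2 assume Z: "zclosed r Z1 \<and> zclosed r Z2 \<and> range \<phi> = Z1 \<union> Z2"
  show "range \<phi> = Z1 \<or> range \<phi> = Z2"
  proof (rule ccontr)
    assume "\<not> ?thesis"
    then obtain x y where "\<phi> x \<notin> Z1" "\<phi> y \<notin> Z2" using Z by blast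
    moreover have "\<phi> x \<in> aff r" "\<phi> y \<in> aff r"
      using zclosed_subset_aff[OF assms(2)] by auto
    moreover from Z have "zclosed r Z1" "zclosed r Z2" by simp_all
    ultimately obtain f g where f: "pfun f" "\<And>z. z \<in> Z1 \<Longrightarrow> f z = 0" "f (\<phi> x) \<noteq> 0"
      and g: "pfun g" "\<And>z. z \<in> Z2 \<Longrightarrow> g z = 0" "g (\<phi> y) \<noteq> 0"
      by (metis zclosed_separate)
    have "f (\<phi> z) * g (\<phi> z) = 0" for z
      using Z f(2) g(2) by (metis UnE mult_eq_0_iff rangeI)
    then have "(\<forall>z. f (\<phi> z) = 0) \<or> (\<forall>z. g (\<phi> z) = 0)"
      by (intro pfun_prod_zero) (auto intro: pfun_compose f g assms(1))
    then show False using f(3) g(3) by auto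
  qed
qed

section \<open>The map from roots to coefficients\<close>

definition roots_poly :: "nat \<Rightarrow> (nat \<Rightarrow> 'a::field) \<Rightarrow> 'a poly" where
  "roots_poly r x = (\<Prod>i<r. [:- x i, 1:])"

text \<open>Coordinates from r on are kept, so that \<open>root_map r\<close> symmetrises only the
  first r variables; the induction for symmetric functions passes from one such stage to the
  next.\<close>

definition root_map :: "nat \<Rightarrow> (nat \<Rightarrow> 'a::field) \<Rightarrow> nat \<Rightarrow> 'a" where
  "root_map r x j = (if j < r then coeff (roots_poly r x) j else x j)"

lemma roots_poly_0 [simp]: "roots_poly 0 x = 1"
  by (simp add: roots_poly_def)

lemma roots_poly_Suc: "roots_poly (Suc r) x = [:- x r, 1:] * roots_poly r x"
  by (simp add: roots_poly_def mult.commute)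

lemma coeff_roots_poly_Suc:
  "coeff (roots_poly (Suc r) x) (Suc j) = coeff (roots_poly r x) j - x r * coeff (roots_poly r x) (Suc j)"
  by (simp add: roots_poly_Suc)

lemma degree_roots_poly [simp]: "degree (roots_poly r x) = r"
  unfolding roots_poly_def by (subst degree_prod_sum_eq) auto

lemma coeff_roots_poly_top [simp]: "coeff (roots_poly r x) r = 1"
proof -
  have "lead_coeff (roots_poly r x) = 1"
    unfolding roots_poly_def by (simp add: lead_coeff_prod)
  then show ?thesis by simp
qed

lemma roots_poly_nonzero [simp]: "roots_poly r x \<noteq> 0"
  using coeff_roots_poly_top[of r x] by (metis coeff_0 zero_neq_one)

lemma poly_roots_poly: "poly (roots_poly r x) t = (\<Prod>i<r. t - x i)"
  by (simp add: roots_poly_def poly_prod)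

lemma pfun_coeff_roots_poly: "pfun (\<lambda>x. coeff (roots_poly r x) j)"
proof (induction r arbitrary: j)
  case 0
  then show ?case by (simp add: pfun_const)
next
  case (Suc r)
  show ?case
  proof (cases j)
    case 0
    have eq: "coeff (roots_poly (Suc r) x) 0 = - (x r * coeff (roots_poly r x) 0)" for x :: "nat \<Rightarrow> 'a"
      by (simp add: roots_poly_Suc)
    show ?thesis unfolding 0 eq by (rule pfun_uminus[OF pfun_mult[OF pfun_var Suc.IH]])
  next
    case (Suc i)
    then show ?thesis by (simp add: coeff_roots_poly_Suc pfun_intros Suc.IH)
  qed
qed

lemma pfun_root_map: "pfun (\<lambda>x. root_map r x j)"
  by (cases "j < r") (simp_all add: root_map_def pfun_coeff_roots_poly pfun_var)

lemma coeff_fpoly: "coeff (fpoly r a) j = (if j < r then a j else if j = r then 1 else 0)"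
  by (auto simp: fpoly_def coeff_sum sum.delta)

lemma fpoly_root_map: "fpoly r (root_map r x) = roots_poly r x"
  by (rule poly_eqI) (auto simp: coeff_fpoly root_map_def coeff_eq_0)

lemma degree_fpoly [simp]: "degree (fpoly r (a :: nat \<Rightarrow> 'a::field)) = r"
  by (rule antisym[OF degree_le le_degree]) (auto simp: coeff_fpoly)

lemma root_map_aff: "x \<in> aff r \<Longrightarrow> root_map r x \<in> aff r"
  by (auto simp: aff_def root_map_def)

lemma root_map_surj:
  fixes a :: "nat \<Rightarrow> 'a::alg_closed_field"
  assumes "a \<in> aff r"
  shows "\<exists>x\<in>aff r. root_map r x = a"
proof -
  have lc: "lead_coeff (fpoly r a) = 1" by (simp add: coeff_fpoly)
  then have "fpoly r a \<noteq> 0" by (metis leading_coeff_0_iff zero_neq_one)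
  then obtain A where A: "size A = r" "fpoly r a = (\<Prod>x\<in>#A. [:-x, 1:])"
    using alg_closed_imp_factorization[of "fpoly r a"] lc by auto
  obtain xs where xs: "mset xs = A" using ex_mset by blast
  have len: "length xs = r" using A(1) xs by (metis size_mset)
  define x where "x i = (if i < r then xs ! i else 0)" for i
  have "fpoly r a = prod_list (map (\<lambda>x. [:-x, 1:]) xs)"
    unfolding A(2) xs[symmetric] by (simp flip: prod_mset_prod_list)
  also have "\<dots> = roots_poly r x"
    by (simp add: prod.list_conv_set_nth len roots_poly_def x_def atLeast0LessThan)
  finally have eq: "fpoly r a = roots_poly r x" .
  have "root_map r x = a"
    using assms by (auto simp: root_map_def fun_eq_iff eq[symmetric] coeff_fpoly aff_def x_def)
  moreover have "x \<in> aff r" by (auto simp: aff_def x_def)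
  ultimately show ?thesis by blast
qed

lemma root_map_permute:
  assumes "\<pi> permutes {..<r}"
  shows "root_map r (x \<circ> \<pi>) = root_map r x"
proof -
  have "roots_poly r (x \<circ> \<pi>) = roots_poly r x"
    unfolding roots_poly_def using prod.permute[OF assms, of "\<lambda>i. [:- x i, 1:]"] by (simp add: o_def)
  then show ?thesis
    using assms by (auto simp: root_map_def fun_eq_iff permutes_not_in)
qed

lemma aff_permute: "x \<in> aff r \<Longrightarrow> \<pi> permutes {..<r} \<Longrightarrow> x \<circ> \<pi> \<in> aff r"
  by (auto simp: aff_def permutes_not_in)

text \<open>Equal polynomials have the same multiset of roots, and two indexings of one multiset
  differ by a permutation; the remaining coordinates agree because \<open>root_map\<close> retains
  them.\<close>

lemma root_map_eq_imp_permute: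
  assumes "root_map r x = root_map r y"
  obtains \<pi> where "\<pi> permutes {..<r}" "x = y \<circ> \<pi>"
proof -
  have *: "proots (roots_poly r z) = image_mset z (mset_set {..<r})" for z :: "nat \<Rightarrow> 'a"
    by (induction r) (simp_all add: roots_poly_Suc proots_mult lessThan_Suc del: mult_pCons_left pCons_one)
  have "roots_poly r x = roots_poly r y"
    using assms by (metis fpoly_root_map)
  then have "image_mset x (mset_set {..<r}) = image_mset y (mset_set {..<r})"
    by (metis *)
  then obtain \<pi> where \<pi>: "\<pi> permutes {..<r}" "\<forall>i\<in>{..<r}. x i = y (\<pi> i)"
    using image_mset_eq_implies_permutes[of "{..<r}" x y] by blast
  have "x i = y (\<pi> i)" for i
  proof (cases "i < r")
    case False
    then have "x i = root_map r x i" "y i = root_map r y i" by (auto simp: root_map_def)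
    then show ?thesis using assms False \<pi>(1) by (simp add: permutes_not_in)
  qed (use \<pi>(2) in auto)
  then show ?thesis using that \<pi>(1) by (auto simp: fun_eq_iff)
qed

lemma finite_root_map_fibre: "finite {x. root_map r x = root_map r y}"
proof (rule finite_subset)
  show "{x. root_map r x = root_map r y} \<subseteq> (\<lambda>\<pi>. y \<circ> \<pi>) ` {\<pi>. \<pi> permutes {..<r}}"
    by (auto elim: root_map_eq_imp_permute)
  show "finite ((\<lambda>\<pi>. y \<circ> \<pi>) ` {\<pi>. \<pi> permutes {..<r}})"
    by (intro finite_imageI finite_permutations) auto
qed

lemma exists_injective_vector: "\<exists>x :: nat \<Rightarrow> 'a::alg_closed_field. inj x"
  using infinite_countable_subset[OF infinite_UNIV_alg_closed[where 'a='a]] by blast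

text \<open>By induction a symmetric polynomial in \<open>x\<^sub>0, \<dots>, x\<^sub>r\<close> is a polynomial in \<open>x\<^sub>r\<close> and the elementary
  symmetric functions of all variables; reducing modulo the monic equation of \<open>x\<^sub>r\<close> brings its degree in \<open>x\<^sub>r\<close>
  down to \<open>r\<close>, and the resulting relation has the \<open>r + 1\<close> solutions \<open>x\<^sub>0, \<dots>, x\<^sub>r\<close>, hence is constant.\<close>

lemma symmetric_pfun:
  fixes F :: "(nat \<Rightarrow> 'a::alg_closed_field) \<Rightarrow> 'a"
  assumes "pfun F" "\<And>\<pi> x. \<pi> permutes {..<r} \<Longrightarrow> F (x \<circ> \<pi>) = F x"
  shows "\<exists>G. pfun G \<and> (\<forall>x. F x = G (root_map r x))"
  using assms
proof (induction r arbitrary: F)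
  case 0
  have "root_map 0 x = x" for x :: "nat \<Rightarrow> 'a" by (auto simp: root_map_def)
  then show ?case using 0 by auto
next
  case (Suc r)
  have "F (x \<circ> \<pi>) = F x" if "\<pi> permutes {..<r}" for \<pi> x
    by (rule Suc.prems(2)[OF permutes_subset[OF that]]) auto
  from Suc.IH[OF Suc.prems(1) this] obtain G where G: "pfun G" "\<And>x. F x = G (root_map r x)"
    by blast
  let ?\<Phi> = "root_map (Suc r) :: (nat \<Rightarrow> 'a) \<Rightarrow> _"
  \<comment> \<open>\<open>M f\<close>: f lies in the module spanned by 1, x_r, ..., x_r^r over the
    polynomials in the elementary symmetric functions of all r + 1 variables.\<close>
  define M where "M f \<longleftrightarrow> (\<exists>c. (\<forall>j. pfun (c j)) \<and> (\<forall>x. f x = (\<Sum>j\<le>r. c j (?\<Phi> x) * x r ^ j)))"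
    for f :: "(nat \<Rightarrow> 'a) \<Rightarrow> 'a"
  have M_const: "M (\<lambda>x. c)" for c
    unfolding M_def
    by (intro exI[of _ "\<lambda>j _. if j = 0 then c else 0"])
      (auto simp: pfun_const if_distrib[of "\<lambda>u. u * _"] sum.delta cong: if_cong)
  have M_add: "M (\<lambda>x. f x + g x)" if fg: "M f" "M g" for f g
  proof -
    from fg obtain c d where "\<forall>j. pfun (c j)" "\<forall>x. f x = (\<Sum>j\<le>r. c j (?\<Phi> x) * x r ^ j)"
      "\<forall>j. pfun (d j)" "\<forall>x. g x = (\<Sum>j\<le>r. d j (?\<Phi> x) * x r ^ j)" by (auto simp: M_def)
    then show ?thesis unfolding M_def
      by (intro exI[of _ "\<lambda>j a. c j a + d j a"]) (auto simp: pfun_add distrib_right sum.distrib)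
  qed
  have M_mult: "M (\<lambda>x. h (?\<Phi> x) * f x)" if hf: "pfun h" "M f" for h f
  proof -
    from hf obtain c where "\<forall>j. pfun (c j)" "\<forall>x. f x = (\<Sum>j\<le>r. c j (?\<Phi> x) * x r ^ j)"
      by (auto simp: M_def)
    then show ?thesis unfolding M_def
      by (intro exI[of _ "\<lambda>j a. h a * c j a"]) (auto simp: pfun_mult hf sum_distrib_left mult.assoc)
  qed
  have M_last: "M (\<lambda>x. x r * f x)" if f: "M f" for f
  proof -
    from f obtain c where c: "\<forall>j. pfun (c j)" "\<forall>x. f x = (\<Sum>j\<le>r. c j (?\<Phi> x) * x r ^ j)"
      by (auto simp: M_def)
    define d where "d j a = (if j = 0 then 0 else c (j - 1) a) - c r a * a j" for j and a :: "nat \<Rightarrow> 'a"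
    have "x r * f x = (\<Sum>j\<le>r. d j (?\<Phi> x) * x r ^ j)" for x
    proof -
      have "0 = poly (roots_poly (Suc r) x) (x r)"
        by (simp add: poly_roots_poly)
      also have "\<dots> = (\<Sum>j\<le>r. ?\<Phi> x j * x r ^ j) + x r ^ Suc r"
        unfolding poly_altdef by (simp add: root_map_def del: power_Suc)
      finally have top: "x r ^ Suc r = - (\<Sum>j\<le>r. ?\<Phi> x j * x r ^ j)"
        by (simp add: eq_neg_iff_add_eq_0 add.commute)
      have shift: "(\<Sum>j\<le>r. (if j = 0 then 0 else c (j - 1) (?\<Phi> x)) * x r ^ j) + c r (?\<Phi> x) * x r ^ Suc r
          = (\<Sum>j\<le>Suc r. (if j = 0 then 0 else c (j - 1) (?\<Phi> x)) * x r ^ j)" by simp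
      have "x r * f x = (\<Sum>j\<le>r. c j (?\<Phi> x) * x r ^ Suc j)"
        using c(2) by (simp add: sum_distrib_left mult_ac)
      also have "\<dots> = (\<Sum>j\<le>Suc r. (if j = 0 then 0 else c (j - 1) (?\<Phi> x)) * x r ^ j)"
        by (subst sum.atMost_Suc_shift) simp
      also have "\<dots> = (\<Sum>j\<le>r. (if j = 0 then 0 else c (j - 1) (?\<Phi> x)) * x r ^ j) - c r (?\<Phi> x) * (\<Sum>j\<le>r. ?\<Phi> x j * x r ^ j)"
        unfolding shift[symmetric] top by simp
      also have "\<dots> = (\<Sum>j\<le>r. d j (?\<Phi> x) * x r ^ j)"
        by (simp add: d_def sum_distrib_left left_diff_distrib sum_subtractf mult.assoc)
      finally show ?thesis .
    qed
    moreover have "pfun (d j)" for j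
      unfolding d_def by (cases "j = 0") (simp_all add: pfun_intros c(1))
    ultimately show ?thesis unfolding M_def by blast
  qed
  \<comment> \<open>Dividing the full product by T - x_r gives the coefficients of the product of
    the first r factors recursively, downwards from the leading coefficient 1.\<close>
  have M_coeff: "M (\<lambda>x. coeff (roots_poly r x) (r - n) * f x)" if "n \<le> r" "M f" for n f
    using that
  proof (induction n)
    case (Suc n)
    define j where "j = r - Suc n"
    have j: "Suc j = r - n" "Suc j < Suc r" using Suc.prems by (auto simp: j_def)
    have "M (\<lambda>x. ?\<Phi> x (Suc j) * f x + x r * (coeff (roots_poly r x) (Suc j) * f x))"
      by (intro M_add M_mult[of "\<lambda>a. a (Suc j)"] M_last pfun_var) (use Suc j in auto)
    also have "(\<lambda>x. ?\<Phi> x (Suc j) * f x + x r * (coeff (roots_poly r x) (Suc j) * f x))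
        = (\<lambda>x. coeff (roots_poly r x) j * f x)"
      using j(2) by (auto simp: root_map_def coeff_roots_poly_Suc algebra_simps)
    finally show ?case by (simp add: j_def)
  qed simp
  have M_var: "M (\<lambda>x. root_map r x i * f x)" if f: "M f" for f i
  proof (cases i r rule: linorder_cases)
    case less
    then show ?thesis using M_coeff[of "r - i" f] f by (simp add: root_map_def)
  next
    case equal
    then show ?thesis using M_last[OF f] by (simp add: root_map_def)
  next
    case greater
    then show ?thesis using M_mult[OF pfun_var[of i] f] by (simp add: root_map_def)
  qed
  have "M (\<lambda>x. H (root_map r x))" if "pfun H" for H
    using that by induction (auto intro: M_const M_add M_var)
  from this[OF G(1)] have "M F" unfolding G(2)[symmetric] .
  then obtain c where c: "\<And>j. pfun (c j)" "\<And>x. F x = (\<Sum>j\<le>r. c j (?\<Phi> x) * x r ^ j)"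
    by (auto simp: M_def)
  \<comment> \<open>A transposition changes neither F nor the coefficients, so x_r may be exchanged
    for any x_i.\<close>
  have all: "F x = (\<Sum>j\<le>r. c j (?\<Phi> x) * x i ^ j)" if "i \<le> r" for x i
  proof -
    have perm: "transpose i r permutes {..<Suc r}" using that by (intro permutes_swap_id) auto
    show ?thesis
      using c(2)[of "x \<circ> transpose i r"] by (simp add: root_map_permute[OF perm] Suc.prems(2)[OF perm])
  qed
  have inj: "F x = c 0 (?\<Phi> x)" if "inj_on x {..r}" for x
  proof -
    define Q where "Q = (\<Sum>j\<le>r. monom (c j (?\<Phi> x)) j) - [:F x:]"
    have "poly Q (x i) = 0" if "i \<le> r" for i
      using all[OF that, of x] by (simp add: Q_def poly_sum poly_monom)
    then have sub: "x ` {..r} \<subseteq> {t. poly Q t = 0}" by auto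
    have deg: "degree Q \<le> r"
      unfolding Q_def by (intro degree_diff_le degree_sum_le) (auto intro: order.trans[OF degree_monom_le])
    have "Q = 0"
    proof (rule ccontr)
      assume "Q \<noteq> 0"
      then have "card (x ` {..r}) \<le> degree Q"
        using card_mono[OF poly_roots_finite sub] card_poly_roots_bound[of Q] by force
      then show False using deg card_image[OF that] by simp
    qed
    then have "coeff Q 0 = 0" by simp
    then show ?thesis by (simp add: Q_def coeff_sum sum.delta)
  qed
  \<comment> \<open>The Vandermonde product vanishes at the points with coinciding coordinates,
    where the root count fails; multiplying by it extends the identity to these points.\<close>
  let ?\<Delta> = "\<lambda>x :: nat \<Rightarrow> 'a. \<Prod>i\<le>r. \<Prod>j<i. x i - x j"
  have "(\<forall>x. F x - c 0 (?\<Phi> x) = 0) \<or> (\<forall>x. ?\<Delta> x = 0)"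
  proof (rule pfun_prod_zero)
    show "pfun (\<lambda>x. F x - c 0 (?\<Phi> x))"
      by (intro pfun_diff Suc.prems pfun_compose[OF c(1)] pfun_root_map)
    show "pfun ?\<Delta>" by (intro pfun_intros)
    fix x
    show "(F x - c 0 (?\<Phi> x)) * ?\<Delta> x = 0"
    proof (cases "inj_on x {..r}")
      case False
      then obtain i j where ij: "i \<le> r" "j < i" "x i = x j"
        unfolding inj_on_def by (metis atMost_iff linorder_neqE_nat)
      then have "(\<Prod>j<i. x i - x j) = 0" by (intro prod_zero) auto
      then have "?\<Delta> x = 0" using ij(1) by (intro prod_zero) auto
      then show ?thesis by simp
    qed (use inj in auto)
  qed
  moreover have "\<not> (\<forall>x. ?\<Delta> x = 0)"
  proof -
    obtain x :: "nat \<Rightarrow> 'a" where "inj x" using exists_injective_vector by blast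
    then have "?\<Delta> x \<noteq> 0" by (auto simp: inj_def)
    then show ?thesis by blast
  qed
  ultimately have "\<forall>x. F x - c 0 (?\<Phi> x) = 0" by argo
  then have "F x = c 0 (?\<Phi> x)" for x by simp
  then show ?case using c(1) by blast
qed

text \<open>Adding a generic multiple of a function that is nonzero at the new point keeps the
  values at the old points nonzero.\<close>

lemma zclosed_avoid_finite:
  fixes C :: "(nat \<Rightarrow> 'a::alg_closed_field) set"
  assumes "zclosed r C" "finite Y" "Y \<subseteq> aff r" "Y \<inter> C = {}"
  obtains f where "pfun f" "\<And>x. x \<in> C \<Longrightarrow> f x = 0" "\<And>y. y \<in> Y \<Longrightarrow> f y \<noteq> 0"
proof -
  have "\<exists>f. pfun f \<and> (\<forall>x\<in>C. f x = 0) \<and> (\<forall>y\<in>Y. f y \<noteq> 0)"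
    using assms(2,3,4)
  proof (induction Y rule: finite_induct)
    case empty
    show ?case by (intro exI[of _ "\<lambda>x. 0"]) (auto intro: pfun_const)
  next
    case (insert y Y)
    then obtain f where f: "pfun f" "\<forall>x\<in>C. f x = 0" "\<forall>y\<in>Y. f y \<noteq> 0" by auto
    obtain g where g: "pfun g" "\<And>x. x \<in> C \<Longrightarrow> g x = 0" "g y \<noteq> 0"
      using zclosed_separate[OF assms(1), of y] insert.prems by blast
    \<comment> \<open>Each point excludes at most one scalar; points with g z = 0 contribute the
      value 0 of the division by zero, which does no harm.\<close>
    obtain c where c: "c \<notin> (\<lambda>z. - f z / g z) ` insert y Y"
      using ex_new_if_finite[OF infinite_UNIV_alg_closed] insert.hyps(1) by (metis finite.insertI finite_imageI)
    have "f z + c * g z \<noteq> 0" if z: "z \<in> insert y Y" for z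
    proof
      assume eq: "f z + c * g z = 0"
      show False
      proof (cases "g z = 0")
        case True
        then show ?thesis using eq f(3) g(3) z by auto
      next
        case False
        then have "c = - f z / g z" using eq by (simp add: field_simps eq_neg_iff_add_eq_0)
        then show ?thesis using c z by blast
      qed
    qed
    then show ?case
      by (intro exI[of _ "\<lambda>x. f x + c * g x"]) (auto intro!: pfun_intros f(1) g(1) simp: f(2) g(2))
  qed
  then show ?thesis using that by blast
qed

text \<open>If no point of the fibre of \<open>a\<close> lies in \<open>C\<close>, then the norm (the product over the orbit) of a polynomial that
  vanishes on \<open>C\<close> but nowhere on the fibre separates \<open>a\<close> from the image of \<open>C\<close>.\<close>

lemma zclosed_root_map_image:
  fixes C :: "(nat \<Rightarrow> 'a::alg_closed_field) set"
  assumes C: "zclosed r C"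
  shows "zclosed r (root_map r ` C)"
proof -
  let ?F = "{g. pfun g \<and> (\<forall>x\<in>C. g (root_map r x) = 0)}"
  let ?P = "{\<pi>. \<pi> permutes {..<r}}"
  have finP: "finite ?P" by (rule finite_permutations) simp
  have "root_map r ` C = {a\<in>aff r. \<forall>g\<in>?F. g a = 0}"
  proof (intro equalityI subsetI)
    fix a assume "a \<in> root_map r ` C"
    then show "a \<in> {a\<in>aff r. \<forall>g\<in>?F. g a = 0}"
      using zclosed_subset_aff[OF C] root_map_aff[of _ r] by auto
  next
    fix a assume a: "a \<in> {a\<in>aff r. \<forall>g\<in>?F. g a = 0}"
    then obtain y where y: "y \<in> aff r" "root_map r y = a" using root_map_surj by blast
    show "a \<in> root_map r ` C"
    proof (rule ccontr)
      assume notin: "a \<notin> root_map r ` C"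
      let ?Y = "(\<lambda>\<pi>. y \<circ> \<pi>) ` ?P"
      have "y \<circ> \<pi> \<notin> C" if "\<pi> permutes {..<r}" for \<pi>
        using notin root_map_permute[OF that, of y] y(2) by (metis imageI)
      then have "?Y \<inter> C = {}" by blast
      moreover have "?Y \<subseteq> aff r" using aff_permute[OF y(1)] by blast
      ultimately obtain f where f: "pfun f" "\<And>x. x \<in> C \<Longrightarrow> f x = 0" "\<And>z. z \<in> ?Y \<Longrightarrow> f z \<noteq> 0"
        using zclosed_avoid_finite[OF C finite_imageI[OF finP]] by blast
      define N where "N x = (\<Prod>\<pi>\<in>?P. f (x \<circ> \<pi>))" for x
      have "pfun N"
        unfolding N_def by (intro pfun_prod pfun_compose[OF f(1)]) (simp add: pfun_var)
      moreover have "N (x \<circ> \<sigma>) = N x" if "\<sigma> permutes {..<r}" for x \<sigma>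
      proof -
        have inj: "inj_on (\<lambda>\<pi>. \<sigma> \<circ> \<pi>) ?P"
        proof (intro inj_onI ext)
          fix a b i assume "\<sigma> \<circ> a = \<sigma> \<circ> b"
          then have "\<sigma> (a i) = \<sigma> (b i)" by (metis comp_apply)
          then show "a i = b i" by (simp add: permutes_inj[OF that, THEN inj_eq])
        qed
        have "N (x \<circ> \<sigma>) = (\<Prod>\<pi>\<in>?P. f (x \<circ> (\<sigma> \<circ> \<pi>)))" by (simp only: N_def comp_assoc)
        also have "\<dots> = (\<Prod>\<pi>\<in>(\<lambda>\<pi>. \<sigma> \<circ> \<pi>) ` ?P. f (x \<circ> \<pi>))"
          by (simp only: prod.reindex[OF inj] o_def[of "\<lambda>\<pi>. f (x \<circ> \<pi>)"])
        also have "(\<lambda>\<pi>. \<sigma> \<circ> \<pi>) ` ?P = ?P"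
          using image_compose_permutations_left[OF that] by (simp add: setcompr_eq_image)
        finally show ?thesis by (simp only: N_def)
      qed
      ultimately obtain G where G: "pfun G" "\<And>x. N x = G (root_map r x)"
        using symmetric_pfun[of N r] by blast
      have "N x = 0" if "x \<in> C" for x
        unfolding N_def using f(2)[OF that] finP by (intro prod_zero bexI[of _ id]) (auto simp: permutes_id)
      then have "G \<in> ?F" using G by auto
      then have "N y = 0" using a y(2) G(2) by auto
      then show False using f(3) finP by (auto simp: N_def)
    qed
  qed
  moreover have "zclosed r {a\<in>aff r. \<forall>g\<in>?F. g a = 0}" by (rule zclosed_zero_locus) simp
  ultimately show ?thesis by simp
qed

lemma zclosed_root_map_vimage: "zclosed r Z \<Longrightarrow> zclosed r {x\<in>aff r. root_map r x \<in> Z}"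
  by (rule zclosed_vimage) (auto intro: pfun_root_map root_map_aff)

section \<open>Irreducible sets under the root map and under permutations\<close>

lemma zirreducible_root_map_image:
  fixes C :: "(nat \<Rightarrow> 'a::alg_closed_field) set"
  assumes C: "zirreducible r C"
  shows "zirreducible r (root_map r ` C)"
  unfolding zirreducible_def
proof (intro conjI allI impI)
  show "zclosed r (root_map r ` C)" using C by (simp add: zirreducible_def zclosed_root_map_image)
  show "root_map r ` C \<noteq> {}" using C by (simp add: zirreducible_def)
  fix Z1 Z2 assume Z: "zclosed r Z1 \<and> zclosed r Z2 \<and> root_map r ` C = Z1 \<union> Z2"
  have "\<exists>Z\<in>{Z1, Z2}. C \<subseteq> {x\<in>aff r. root_map r x \<in> Z}"
  proof (rule zirreducible_UN[OF _ C])
    show "C \<subseteq> (\<Union>Z\<in>{Z1, Z2}. {x\<in>aff r. root_map r x \<in> Z})"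
      using Z C zclosed_subset_aff[of r C] by (auto simp: zirreducible_def)
  qed (use Z zclosed_root_map_vimage in auto)
  then have "root_map r ` C \<subseteq> Z1 \<or> root_map r ` C \<subseteq> Z2" by blast
  then show "root_map r ` C = Z1 \<or> root_map r ` C = Z2" using Z by blast
qed

lemma zirreducible_Un_eq:
  "zirreducible r C \<Longrightarrow> zclosed r A \<Longrightarrow> zclosed r B \<Longrightarrow> C = A \<union> B \<Longrightarrow> C = A \<or> C = B"
  by (simp add: zirreducible_def)

lemma zclosed_permute:
  assumes C: "zclosed r C" and \<pi>: "\<pi> permutes {..<r}"
  shows "zclosed r ((\<lambda>x. x \<circ> \<pi>) ` C)"
proof -
  have inv: "inv_into UNIV \<pi> permutes {..<r}" by (rule permutes_inv[OF \<pi>])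
  have "(\<lambda>x. x \<circ> \<pi>) ` C = {x\<in>aff r. x \<circ> inv_into UNIV \<pi> \<in> C}"
  proof (intro equalityI subsetI)
    fix x assume "x \<in> (\<lambda>x. x \<circ> \<pi>) ` C"
    then show "x \<in> {x\<in>aff r. x \<circ> inv_into UNIV \<pi> \<in> C}"
      using zclosed_subset_aff[OF C] aff_permute[OF _ \<pi>] by (auto simp: comp_assoc permutes_inv_o[OF \<pi>])
  next
    fix x assume "x \<in> {x\<in>aff r. x \<circ> inv_into UNIV \<pi> \<in> C}"
    then show "x \<in> (\<lambda>x. x \<circ> \<pi>) ` C"
      by (intro image_eqI[of _ _ "x \<circ> inv_into UNIV \<pi>"]) (auto simp: comp_assoc permutes_inv_o[OF \<pi>])
  qed
  also have "zclosed r \<dots>"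
    by (rule zclosed_vimage[OF C]) (simp_all add: pfun_var aff_permute[OF _ inv])
  finally show ?thesis .
qed

lemma zirreducible_permute:
  assumes C: "zirreducible r C" and \<pi>: "\<pi> permutes {..<r}"
  shows "zirreducible r ((\<lambda>x. x \<circ> \<pi>) ` C)"
  unfolding zirreducible_def
proof (intro conjI allI impI)
  have clC: "zclosed r C" using C by (simp add: zirreducible_def)
  show "zclosed r ((\<lambda>x. x \<circ> \<pi>) ` C)" using zclosed_permute[OF clC \<pi>] .
  show "(\<lambda>x. x \<circ> \<pi>) ` C \<noteq> {}" using C by (simp add: zirreducible_def)
  have inv: "inv_into UNIV \<pi> permutes {..<r}" by (rule permutes_inv[OF \<pi>])
  have inv_image: "(\<lambda>x. x \<circ> inv_into UNIV \<pi>) ` (\<lambda>x. x \<circ> \<pi>) ` A = A" "(\<lambda>x. x \<circ> \<pi>) ` (\<lambda>x. x \<circ> inv_into UNIV \<pi>) ` A = A"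
    for A :: "(nat \<Rightarrow> 'a) set"
    by (simp_all only: image_image comp_assoc permutes_inv_o[OF \<pi>] comp_id image_ident)
  fix Z1 Z2 assume Z: "zclosed r Z1 \<and> zclosed r Z2 \<and> (\<lambda>x. x \<circ> \<pi>) ` C = Z1 \<union> Z2"
  then have "C = (\<lambda>x. x \<circ> inv_into UNIV \<pi>) ` Z1 \<union> (\<lambda>x. x \<circ> inv_into UNIV \<pi>) ` Z2"
    using inv_image(1)[of C] by (simp add: image_Un)
  then have "C = (\<lambda>x. x \<circ> inv_into UNIV \<pi>) ` Z1 \<or> C = (\<lambda>x. x \<circ> inv_into UNIV \<pi>) ` Z2"
    by (intro zirreducible_Un_eq[OF C] zclosed_permute[OF _ inv]) (use Z in simp_all)
  then show "(\<lambda>x. x \<circ> \<pi>) ` C = Z1 \<or> (\<lambda>x. x \<circ> \<pi>) ` C = Z2"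
    using inv_image(2)[of Z1] inv_image(2)[of Z2] by auto
qed

text \<open>If the images agreed, permuted copies of C would cover C', so a single one would contain
  it. Iterating this inclusion up to a power of the permutation that is the identity gives C' inside
  C.\<close>

lemma root_map_image_psubset:
  fixes C C' :: "(nat \<Rightarrow> 'a::alg_closed_field) set"
  assumes C': "zirreducible r C'" and C: "zclosed r C" and sub: "C \<subset> C'"
  shows "root_map r ` C \<subset> root_map r ` C'"
proof (rule psubsetI)
  show "root_map r ` C \<noteq> root_map r ` C'"
  proof
    assume eq: "root_map r ` C = root_map r ` C'"
    let ?P = "{\<pi>. \<pi> permutes {..<r}}"
    have "\<exists>\<pi>\<in>?P. C' \<subseteq> (\<lambda>x. x \<circ> \<pi>) ` C"
    proof (rule zirreducible_UN[OF _ C'])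
      show "finite ?P" by (rule finite_permutations) simp
      show "C' \<subseteq> (\<Union>\<pi>\<in>?P. (\<lambda>x. x \<circ> \<pi>) ` C)"
      proof
        fix x assume "x \<in> C'"
        then obtain y where "y \<in> C" "root_map r x = root_map r y" using eq by (metis imageE imageI)
        then show "x \<in> (\<Union>\<pi>\<in>?P. (\<lambda>x. x \<circ> \<pi>) ` C)" using root_map_eq_imp_permute[of r x y] by blast
      qed
    qed (use zclosed_permute[OF C] in auto)
    then obtain \<pi> where \<pi>: "\<pi> permutes {..<r}" "C' \<subseteq> (\<lambda>x. x \<circ> \<pi>) ` C" by blast
    have iter: "C' \<subseteq> (\<lambda>x. x \<circ> (\<pi> ^^ Suc n)) ` C" for n
    proof (induction n)
      case 0
      show ?case using \<pi>(2) by (simp only: funpow.simps comp_id)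
    next
      case (Suc n)
      have "C' \<subseteq> (\<lambda>x. x \<circ> \<pi>) ` C'" using \<pi>(2) sub by blast
      also have "\<dots> \<subseteq> (\<lambda>x. x \<circ> \<pi>) ` (\<lambda>x. x \<circ> (\<pi> ^^ Suc n)) ` C" using Suc by (rule image_mono)
      also have "\<dots> = (\<lambda>x. x \<circ> (\<pi> ^^ Suc (Suc n))) ` C"
        by (simp only: image_image comp_assoc funpow_Suc_right)
      finally show ?case .
    qed
    have "permutation \<pi>" using \<pi>(1) permutation_permutes by blast
    then obtain n where "\<pi> ^^ n = id" "n > 0" by (rule permutation_is_nilpotent)
    then have "C' \<subseteq> C" using iter[of "n - 1"] by simp
    then show False using sub by blast
  qed
qed (use sub in auto)

text \<open>Lying over for a finite map. A decomposition of a minimal C maps to a decomposition of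
  D; one piece already has image D and equals C by minimality.\<close>

lemma zirreducible_lift:
  fixes C' D :: "(nat \<Rightarrow> 'a::alg_closed_field) set"
  assumes C': "zclosed r C'" and D: "zirreducible r D" and sub: "D \<subseteq> root_map r ` C'"
  obtains C where "zirreducible r C" "C \<subseteq> C'" "root_map r ` C = D"
proof -
  have clD: "zclosed r D" using D by (simp add: zirreducible_def)
  let ?A = "{C. zclosed r C \<and> C \<subseteq> C' \<and> root_map r ` C = D}"
  let ?C0 = "C' \<inter> {x\<in>aff r. root_map r x \<in> D}"
  have C0: "?C0 \<in> ?A"
    using zclosed_Int[OF C' zclosed_root_map_vimage[OF clD]] sub zclosed_subset_aff[OF C'] by blast
  \<comment> \<open>The order is reversed, so that Zorn's lemma produces a minimal set.\<close>
  let ?P = "\<lambda>a b :: (nat \<Rightarrow> 'a) set. b \<subseteq> a"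
  have "\<exists>m\<in>?A. \<forall>a\<in>?A. ?P m a \<longrightarrow> a = m"
  proof (rule predicate_Zorn)
    show "partial_order_on ?A (relation_of ?P ?A)"
      by (rule partial_order_on_relation_ofI) auto
    fix K assume K: "K \<in> Chains (relation_of ?P ?A)"
    have "C \<in> ?A" if "C \<in> K" for C
    proof -
      have "(C, C) \<in> relation_of ?P ?A" using K that unfolding Chains_def by blast
      then show ?thesis unfolding relation_of_def by blast
    qed
    then have KA: "K \<subseteq> ?A" by blast
    have lin: "a \<subseteq> b \<or> b \<subseteq> a" if "a \<in> K" "b \<in> K" for a b
      using K that by (auto simp: Chains_def relation_of_def)
    show "\<exists>u\<in>?A. \<forall>a\<in>K. ?P a u"
    proof (cases "K = {}")
      case True
      then show ?thesis using C0 by blast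
    next
      case False
      let ?U = "aff r \<inter> \<Inter>K"
      have "D \<subseteq> root_map r ` ?U"
      proof
        fix d assume d: "d \<in> D"
        let ?fib = "\<lambda>C. {x\<in>C. root_map r x = d}"
        have fin: "finite (?fib C)" for C
        proof (cases "?fib C = {}")
          case nonempty: False
          then obtain y where "root_map r y = d" by blast
          then show ?thesis using finite_root_map_fibre[of r y] by (simp add: finite_subset[rotated] Collect_mono)
        qed (use finite.emptyI in metis)
        \<comment> \<open>Fibres over d are finite, nonempty and nested along the chain; a point of
          the smallest one lies in every member, so the intersection still maps onto D.\<close>
        obtain C0 where "C0 \<in> K" and C0: "\<And>C. C \<in> K \<Longrightarrow> card (?fib C0) \<le> card (?fib C)"
          using False ex_has_least_nat[of "\<lambda>C. C \<in> K" _ "\<lambda>C. card (?fib C)"] by blast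
        then obtain x where x: "x \<in> ?fib C0" using KA d by blast
        have "x \<in> C" if "C \<in> K" for C
        proof (cases "C0 \<subseteq> C")
          case True
          then show ?thesis using x by blast
        next
          case False
          then have "?fib C \<subseteq> ?fib C0" using lin[OF \<open>C0 \<in> K\<close> that] by blast
          then have "?fib C = ?fib C0" using C0[OF that] fin by (simp add: card_seteq)
          then show ?thesis using x by blast
        qed
        moreover have "x \<in> aff r" using x KA \<open>C0 \<in> K\<close> zclosed_subset_aff by blast
        ultimately show "d \<in> root_map r ` ?U" using x by blast
      qed
      moreover have "root_map r ` ?U \<subseteq> D" using False KA by blast
      moreover have "zclosed r ?U" using KA by (intro zclosed_Inter) auto
      moreover have "?U \<subseteq> C'" using False KA by blast
      ultimately have "?U \<in> ?A" by simp
      moreover have "\<forall>a\<in>K. ?U \<subseteq> a" by blast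
      ultimately show ?thesis by (rule bexI[rotated])
    qed
  qed
  then obtain C where C: "C \<in> ?A" and all: "\<forall>a\<in>?A. a \<subseteq> C \<longrightarrow> a = C" by (rule bexE)
  have min: "a = C" if "a \<in> ?A" "a \<subseteq> C" for a
    using that(2) by (rule bspec[OF all that(1), THEN mp])
  have "zirreducible r C"
    unfolding zirreducible_def
  proof (intro conjI allI impI)
    show "zclosed r C" "C \<noteq> {}" using C D by (auto simp: zirreducible_def)
    fix Z1 Z2 assume Z: "zclosed r Z1 \<and> zclosed r Z2 \<and> C = Z1 \<union> Z2"
    then have "D = root_map r ` Z1 \<union> root_map r ` Z2" using C by auto
    then have "D = root_map r ` Z1 \<or> D = root_map r ` Z2"
      by (intro zirreducible_Un_eq[OF D] zclosed_root_map_image) (use Z in simp_all)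
    moreover have "C = Z" if "zclosed r Z" "Z \<subseteq> C" "D = root_map r ` Z" for Z
    proof -
      have "Z \<in> ?A" using that C by auto
      from min[OF this that(2)] show ?thesis by simp
    qed
    ultimately show "C = Z1 \<or> C = Z2" using Z by (elim disjE) simp_all
  qed
  then show ?thesis using that C by blast
qed

section \<open>Chains and dimension under the root map\<close>

definition zchain :: "nat \<Rightarrow> nat \<Rightarrow> (nat \<Rightarrow> (nat \<Rightarrow> 'a::field) set) \<Rightarrow> (nat \<Rightarrow> 'a) set \<Rightarrow> bool" where
  "zchain r n C S \<longleftrightarrow> (\<forall>i\<le>n. zirreducible r (C i) \<and> C i \<subseteq> S) \<and> (\<forall>i<n. C i \<subset> C (Suc i))"

lemma adim_eq: "adim r S = Sup {enat n | n. \<exists>C. zchain r n C (zclosure r S)}"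
  by (simp add: adim_def zchain_def)

lemma adim_leI:
  assumes "\<And>n C. zchain r n C (zclosure r S) \<Longrightarrow> \<exists>C'. zchain r n C' (zclosure r T)"
  shows "adim r S \<le> adim r T"
  unfolding adim_eq by (rule Sup_subset_mono) (use assms in blast)

lemma adim_le_natI:
  assumes "\<And>n C. zchain r n C (zclosure r S) \<Longrightarrow> n \<le> d"
  shows "adim r S \<le> enat d"
  unfolding adim_eq by (rule Sup_least) (use assms in auto)

lemma adim_geI: "zchain r n C (zclosure r S) \<Longrightarrow> enat n \<le> adim r S"
  unfolding adim_eq by (rule Sup_upper) blast

lemma zchain_mono: "zchain r n C S \<Longrightarrow> S \<subseteq> T \<Longrightarrow> zchain r n C T"
  by (auto simp: zchain_def)

lemma zclosure_mono: "S \<subseteq> T \<Longrightarrow> zclosure r S \<subseteq> zclosure r T"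
  by (auto simp: zclosure_def)

lemma adim_mono: "S \<subseteq> T \<Longrightarrow> adim r S \<le> adim r T"
  by (rule adim_leI) (metis zchain_mono zclosure_mono)

text \<open>The largest member is lifted first, the others then inside its lift \<open>E\<close>;
  inclusions stay strict because the images differ.\<close>

lemma zchain_lift:
  fixes D :: "nat \<Rightarrow> (nat \<Rightarrow> 'a::alg_closed_field) set"
  assumes "zclosed r C'" "zchain r n D (root_map r ` C')"
  shows "\<exists>C. zchain r n C C' \<and> (\<forall>i\<le>n. root_map r ` C i = D i)"
  using assms
proof (induction n arbitrary: C')
  case 0
  then have "zirreducible r (D 0)" "D 0 \<subseteq> root_map r ` C'" by (simp_all add: zchain_def)
  then obtain C where "zirreducible r C" "C \<subseteq> C'" "root_map r ` C = D 0"
    using zirreducible_lift[OF 0(1)] by blast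
  then show ?case by (intro exI[of _ "\<lambda>_. C"]) (auto simp: zchain_def)
next
  case (Suc n)
  then have "zirreducible r (D (Suc n))" "D (Suc n) \<subseteq> root_map r ` C'" by (simp_all add: zchain_def)
  then obtain E where E: "zirreducible r E" "E \<subseteq> C'" "root_map r ` E = D (Suc n)"
    using zirreducible_lift[OF Suc.prems(1)] by blast
  have mono: "D i \<subseteq> D j" if "i \<le> j" "j \<le> Suc n" for i j
    using that
  proof (induction rule: dec_induct)
    case (step k)
    then have "D k \<subset> D (Suc k)" using Suc.prems(2) by (simp add: zchain_def)
    then show ?case using step by auto
  qed simp
  have "zchain r n D (root_map r ` E)"
    unfolding E(3) zchain_def using Suc.prems(2) mono[of _ "Suc n"] by (auto simp: zchain_def)
  then obtain C where C: "zchain r n C E" "\<forall>i\<le>n. root_map r ` C i = D i"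
    using Suc.IH[of E] E(1) by (auto simp: zirreducible_def)
  define C'' where "C'' i = (if i \<le> n then C i else E)" for i
  have im: "root_map r ` C'' i = D i" if "i \<le> Suc n" for i
    using that C(2) E(3) by (auto simp: C''_def le_Suc_eq)
  have "C'' i \<subset> C'' (Suc i)" if i: "i < Suc n" for i
  proof (cases "i < n")
    case True
    then show ?thesis using C(1) by (simp add: C''_def zchain_def)
  next
    case False
    then have "i = n" using i by simp
    moreover have "C n \<noteq> E" using C(2) E(3) Suc.prems(2) by (auto simp: zchain_def)
    moreover have "C n \<subseteq> E" using C(1) by (simp add: zchain_def)
    ultimately show ?thesis by (auto simp: C''_def)
  qed
  moreover have "zirreducible r (C'' i) \<and> C'' i \<subseteq> C'" if "i \<le> Suc n" for i
  proof (cases "i \<le> n")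
    case True
    then have "zirreducible r (C i)" "C i \<subseteq> E" using C(1) by (simp_all add: zchain_def)
    then show ?thesis using True E(2) by (simp add: C''_def)
  qed (use E that in \<open>simp add: C''_def\<close>)
  ultimately have "zchain r (Suc n) C'' C'" by (simp add: zchain_def)
  then show ?case using im by blast
qed

lemma adim_root_map_image_le:
  fixes C' :: "(nat \<Rightarrow> 'a::alg_closed_field) set"
  assumes "zclosed r C'"
  shows "adim r (root_map r ` C') \<le> adim r C'"
proof (rule adim_leI)
  fix n D assume "zchain r n D (zclosure r (root_map r ` C'))"
  then have "zchain r n D (root_map r ` C')"
    by (simp add: zclosure_closed zclosed_root_map_image assms)
  from zchain_lift[OF assms this] show "\<exists>C. zchain r n C (zclosure r C')"
    by (auto simp: zclosure_closed assms)
qed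

text \<open>Z is not assumed closed, but the closure of its preimage lies in the preimage of its
  closure, and chains there are pushed forward strictly.\<close>

lemma adim_root_map_vimage_le:
  fixes Z :: "(nat \<Rightarrow> 'a::alg_closed_field) set"
  assumes "Z \<subseteq> aff r"
  shows "adim r {x\<in>aff r. root_map r x \<in> Z} \<le> adim r Z"
proof (rule adim_leI)
  fix n C assume C: "zchain r n C (zclosure r {x\<in>aff r. root_map r x \<in> Z})"
  have "zclosure r {x\<in>aff r. root_map r x \<in> Z} \<subseteq> {x\<in>aff r. root_map r x \<in> zclosure r Z}"
    by (rule zclosure_least) (use subset_zclosure[of Z r] zclosed_root_map_vimage[OF zclosed_zclosure[OF assms]] in auto)
  then have "zchain r n C {x\<in>aff r. root_map r x \<in> zclosure r Z}"
    using C zchain_mono by blast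
  then have C': "\<And>i. i \<le> n \<Longrightarrow> zirreducible r (C i)" "\<And>i. i \<le> n \<Longrightarrow> root_map r ` C i \<subseteq> zclosure r Z"
    "\<And>i. i < n \<Longrightarrow> C i \<subset> C (Suc i)"
    unfolding zchain_def by blast+
  have "root_map r ` C i \<subset> root_map r ` C (Suc i)" if "i < n" for i
  proof (rule root_map_image_psubset)
    show "zirreducible r (C (Suc i))" "C i \<subset> C (Suc i)" using C' that by simp_all
    show "zclosed r (C i)" using C'(1)[of i] that by (simp add: zirreducible_def)
  qed
  then have "zchain r n (\<lambda>i. root_map r ` C i) (zclosure r Z)"
    unfolding zchain_def using C'(2) zirreducible_root_map_image[OF C'(1)] by simp
  then show "\<exists>C'. zchain r n C' (zclosure r Z)" by blast
qed

section \<open>Upper bounds for dimensions\<close>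

text \<open>Gaussian elimination: equation b is solved for one unknown a0, which is then substituted
  into the other equations.\<close>

lemma homogeneous_system_solution:
  fixes M :: "'i \<Rightarrow> 'j \<Rightarrow> 'a::field"
  assumes "finite B" "finite A" "card B < card A"
  shows "\<exists>c. (\<exists>a\<in>A. c a \<noteq> 0) \<and> (\<forall>b\<in>B. (\<Sum>a\<in>A. c a * M a b) = 0)"
  using assms
proof (induction B arbitrary: A M rule: finite_induct)
  case empty
  then have "A \<noteq> {}" by auto
  then show ?case by (intro exI[of _ "\<lambda>_. 1"]) auto
next
  case (insert b B)
  show ?case
  proof (cases "\<forall>a\<in>A. M a b = 0")
    case True
    have "card B < card A" using insert by simp
    then obtain c where "\<exists>a\<in>A. c a \<noteq> 0" "\<forall>b\<in>B. (\<Sum>a\<in>A. c a * M a b) = 0"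
      using insert.IH[of A M] insert.prems by blast
    then show ?thesis using True by (intro exI[of _ c]) auto
  next
    case False
    then obtain a0 where a0: "a0 \<in> A" "M a0 b \<noteq> 0" by blast
    let ?A = "A - {a0}"
    have "card B < card ?A" using insert a0 by simp
    then obtain c where c: "\<exists>a\<in>?A. c a \<noteq> 0"
      "\<forall>b'\<in>B. (\<Sum>a\<in>?A. c a * (M a b' - M a b / M a0 b * M a0 b')) = 0"
      using insert.IH[of ?A "\<lambda>a b'. M a b' - M a b / M a0 b * M a0 b'"] insert.prems by blast
    \<comment> \<open>The value that equation b forces on the eliminated unknown.\<close>
    define s where "s = - (\<Sum>a\<in>?A. c a * M a b) / M a0 b"
    let ?c = "c(a0 := s)"
    have split: "(\<Sum>a\<in>A. ?c a * M a b') = s * M a0 b' + (\<Sum>a\<in>?A. c a * M a b')" for b'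
      using insert.prems a0 by (subst sum.remove[of A a0]) (auto intro!: sum.cong)
    have "(\<Sum>a\<in>A. ?c a * M a b') = 0" if "b' \<in> insert b B" for b'
    proof (cases "b' = b")
      case True
      then show ?thesis unfolding split using a0 by (simp add: s_def)
    next
      case False
      then have "0 = (\<Sum>a\<in>?A. c a * (M a b' - M a b / M a0 b * M a0 b'))" using c(2) that by auto
      also have "\<dots> = (\<Sum>a\<in>?A. c a * M a b' - (c a * M a b) * (M a0 b' / M a0 b))"
        by (intro sum.cong refl) (simp add: algebra_simps)
      also have "\<dots> = (\<Sum>a\<in>A. ?c a * M a b')"
        unfolding split by (simp add: s_def sum_subtractf sum_distrib_right sum_divide_distrib)
      finally show ?thesis by simp
    qed
    moreover have "\<exists>a\<in>A. ?c a \<noteq> 0" using c(1) by auto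
    ultimately show ?thesis by blast
  qed
qed

section \<open>Degree bounds and the counting argument\<close>

definition exponents :: "nat \<Rightarrow> nat \<Rightarrow> (nat \<Rightarrow> nat) set" where
  "exponents r M = PiE {..<r} (\<lambda>_. {..M})"

lemma finite_exponents [simp]: "finite (exponents r M)"
  by (simp add: exponents_def finite_PiE)

lemma card_exponents: "card (exponents r M) = Suc M ^ r"
  by (simp add: exponents_def card_PiE)

text \<open>The degree is bounded in each variable separately, because the number of monomials in a
  box is then simply \<open>Suc M ^ r\<close>.\<close>

definition pdeg_le :: "nat \<Rightarrow> nat \<Rightarrow> ((nat \<Rightarrow> 'a::field) \<Rightarrow> 'a) \<Rightarrow> bool" where
  "pdeg_le r M f \<longleftrightarrow> (\<exists>d. \<forall>x\<in>aff r. f x = (\<Sum>\<beta>\<in>exponents r M. d \<beta> * (\<Prod>i<r. x i ^ \<beta> i)))"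

lemma pdeg_le_cong: "pdeg_le r M f \<Longrightarrow> (\<And>x. x \<in> aff r \<Longrightarrow> g x = f x) \<Longrightarrow> pdeg_le r M g"
  by (simp add: pdeg_le_def)

lemma pdeg_le_monomial:
  assumes "\<And>i. i < r \<Longrightarrow> \<beta> i \<le> M"
  shows "pdeg_le r M (\<lambda>x. \<Prod>i<r. x i ^ \<beta> i)"
  unfolding pdeg_le_def
proof (intro exI ballI)
  fix x :: "nat \<Rightarrow> 'a"
  have "restrict \<beta> {..<r} \<in> exponents r M" using assms by (auto simp: exponents_def)
  then show "(\<Prod>i<r. x i ^ \<beta> i) =
    (\<Sum>\<gamma>\<in>exponents r M. (if \<gamma> = restrict \<beta> {..<r} then 1 else 0) * (\<Prod>i<r. x i ^ \<gamma> i))"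
    by (simp add: if_distrib[of "\<lambda>u. u * _"] sum.delta cong: if_cong)
qed

lemma pdeg_le_add:
  assumes "pdeg_le r M f" "pdeg_le r M g"
  shows "pdeg_le r M (\<lambda>x. f x + g x)"
proof -
  obtain d e where "\<forall>x\<in>aff r. f x = (\<Sum>\<beta>\<in>exponents r M. d \<beta> * (\<Prod>i<r. x i ^ \<beta> i))"
    "\<forall>x\<in>aff r. g x = (\<Sum>\<beta>\<in>exponents r M. e \<beta> * (\<Prod>i<r. x i ^ \<beta> i))"
    using assms by (auto simp: pdeg_le_def)
  then show ?thesis unfolding pdeg_le_def
    by (intro exI[of _ "\<lambda>\<beta>. d \<beta> + e \<beta>"]) (simp add: distrib_right sum.distrib)
qed

lemma pdeg_le_cmult:
  assumes "pdeg_le r M f"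
  shows "pdeg_le r M (\<lambda>x. c * f x)"
proof -
  obtain d where "\<forall>x\<in>aff r. f x = (\<Sum>\<beta>\<in>exponents r M. d \<beta> * (\<Prod>i<r. x i ^ \<beta> i))"
    using assms by (auto simp: pdeg_le_def)
  then show ?thesis unfolding pdeg_le_def
    by (intro exI[of _ "\<lambda>\<beta>. c * d \<beta>"]) (simp add: sum_distrib_left mult.assoc)
qed

lemma pdeg_le_const: "pdeg_le r M (\<lambda>x. c)"
  using pdeg_le_cmult[OF pdeg_le_monomial[of r "\<lambda>_. 0" M], of c] by simp

lemma pdeg_le_sum: "(\<And>i. i \<in> I \<Longrightarrow> pdeg_le r M (f i)) \<Longrightarrow> pdeg_le r M (\<lambda>x. \<Sum>i\<in>I. f i x)"
  by (induction I rule: infinite_finite_induct) (auto intro: pdeg_le_add pdeg_le_const)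

lemma pdeg_le_mult:
  assumes "pdeg_le r M f" "pdeg_le r N g"
  shows "pdeg_le r (M + N) (\<lambda>x. f x * g x)"
proof -
  obtain d e where de: "\<And>x. x \<in> aff r \<Longrightarrow> f x = (\<Sum>\<beta>\<in>exponents r M. d \<beta> * (\<Prod>i<r. x i ^ \<beta> i))"
    "\<And>x. x \<in> aff r \<Longrightarrow> g x = (\<Sum>\<beta>\<in>exponents r N. e \<beta> * (\<Prod>i<r. x i ^ \<beta> i))"
    using assms by (auto simp: pdeg_le_def)
  have "pdeg_le r (M + N) (\<lambda>x. \<Sum>\<beta>\<in>exponents r M. \<Sum>\<gamma>\<in>exponents r N. (d \<beta> * e \<gamma>) * (\<Prod>i<r. x i ^ (\<beta> i + \<gamma> i)))"
    by (intro pdeg_le_sum pdeg_le_cmult pdeg_le_monomial add_mono) (auto simp: exponents_def PiE_def Pi_def)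
  then show ?thesis
    by (rule pdeg_le_cong) (simp add: de sum_product power_add prod.distrib mult_ac)
qed

lemma pdeg_le_mono: "pdeg_le r M f \<Longrightarrow> M \<le> N \<Longrightarrow> pdeg_le r N f"
  using pdeg_le_mult[of r M f "N - M" "\<lambda>x. 1"] pdeg_le_const[of r "N - M" 1] by simp

lemma pdeg_le_power: "pdeg_le r M f \<Longrightarrow> pdeg_le r (k * M) (\<lambda>x. f x ^ k)"
proof (induction k)
  case (Suc k)
  then show ?case using pdeg_le_mult[of r M f "k * M" "\<lambda>x. f x ^ k"] by simp
qed (simp add: pdeg_le_const)

lemma pfun_imp_pdeg_le: "pfun f \<Longrightarrow> \<exists>M. pdeg_le r M f"
proof (induction rule: pfun.induct)
  case (pfun_const c)
  then show ?case using pdeg_le_const by blast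
next
  case (pfun_add f g)
  then obtain M N where "pdeg_le r M f" "pdeg_le r N g" by blast
  then have "pdeg_le r (max M N) f" "pdeg_le r (max M N) g" by (auto intro: pdeg_le_mono)
  then show ?case using pdeg_le_add by blast
next
  case (pfun_var_mult f i)
  then obtain M where M: "pdeg_le r M f" by blast
  have "pdeg_le r 1 (\<lambda>x. x i)"
  proof (cases "i < r")
    case True
    have "pdeg_le r 1 (\<lambda>x. \<Prod>j<r. x j ^ (if j = i then 1 else 0))" by (rule pdeg_le_monomial) simp
    then show ?thesis
      by (rule pdeg_le_cong) (use True in \<open>simp add: if_distrib[of "\<lambda>e. _ ^ e"] prod.delta cong: if_cong\<close>)
  next
    case False
    then show ?thesis by (intro pdeg_le_cong[OF pdeg_le_const[of r 1 0]]) (auto simp: aff_def)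
  qed
  then show ?case using pdeg_le_mult[OF _ M] by blast
qed

text \<open>The monomials in \<open>f\<^sub>0, \<dots>, f\<^bsub>i-1\<^esub>\<close> with all exponents below \<open>N\<close>; the exponents are the base-\<open>N\<close> digits of \<open>k\<close>.\<close>

fun digit_mono :: "(nat \<Rightarrow> 'b \<Rightarrow> 'a::comm_ring_1) \<Rightarrow> nat \<Rightarrow> nat \<Rightarrow> nat \<Rightarrow> 'b \<Rightarrow> 'a" where
  "digit_mono f N 0 k x = 1"
| "digit_mono f N (Suc i) k x = digit_mono f N i (k mod N ^ i) x * f i x ^ (k div N ^ i)"

text \<open>Splitting off the top digit, k = e * N^i + j, exhibits the sum as a polynomial in f_i
  whose coefficients involve only the earlier functions.\<close>

lemma sum_digit_mono_Suc:
  "(\<Sum>k<N ^ Suc i. c k * digit_mono f N (Suc i) k x) =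
   (\<Sum>e<N. (\<Sum>j<N ^ i. c (e * N ^ i + j) * digit_mono f N i j x) * f i x ^ e)"
proof -
  let ?g = "\<lambda>k. c k * digit_mono f N (Suc i) k x"
  have "(\<Sum>k<N ^ Suc i. ?g k) = (\<Sum>e<N. sum ?g {e * N ^ i..<e * N ^ i + N ^ i})"
    by (simp add: sum.nat_group[symmetric] del: digit_mono.simps)
  also have "\<dots> = (\<Sum>e<N. \<Sum>j<N ^ i. ?g (e * N ^ i + j))"
  proof (rule sum.cong[OF refl])
    fix e
    have "sum ?g {e * N ^ i..<e * N ^ i + N ^ i} = sum ?g {0 + e * N ^ i..<N ^ i + e * N ^ i}"
      by (simp add: add.commute)
    also have "\<dots> = (\<Sum>j<N ^ i. ?g (e * N ^ i + j))"
      by (subst sum.shift_bounds_nat_ivl) (simp add: add.commute atLeast0LessThan)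
    finally show "sum ?g {e * N ^ i..<e * N ^ i + N ^ i} = (\<Sum>j<N ^ i. ?g (e * N ^ i + j))" .
  qed
  also have "\<dots> = (\<Sum>e<N. (\<Sum>j<N ^ i. c (e * N ^ i + j) * digit_mono f N i j x) * f i x ^ e)"
    by (intro sum.cong refl) (auto simp: sum_distrib_right intro!: sum.cong)
  finally show ?thesis .
qed

lemma pfun_digit_mono: "(\<And>i. i < n \<Longrightarrow> pfun (f i)) \<Longrightarrow> pfun (digit_mono f N n k)"
proof (induction n arbitrary: k)
  case 0
  have "digit_mono f N 0 k = (\<lambda>x. 1)" by auto
  then show ?case by (simp add: pfun_const)
next
  case (Suc n)
  have "digit_mono f N (Suc n) k = (\<lambda>x. digit_mono f N n (k mod N ^ n) x * f n x ^ (k div N ^ n))" by auto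
  then show ?case using Suc by (simp add: pfun_mult pfun_power)
qed

lemma pdeg_le_digit_mono:
  assumes "\<And>i. i < n \<Longrightarrow> pdeg_le r D (f i)" "k < N ^ n"
  shows "pdeg_le r (n * (N * D)) (digit_mono f N n k)"
  using assms
proof (induction n arbitrary: k)
  case 0
  have "digit_mono f N 0 k = (\<lambda>x. 1)" by auto
  then show ?case by (simp add: pdeg_le_const)
next
  case (Suc n)
  have "k div N ^ n < N" using Suc.prems(2) by (simp add: less_mult_imp_div_less)
  then have "pdeg_le r (N * D) (\<lambda>x. f n x ^ (k div N ^ n))"
    using pdeg_le_mono[OF pdeg_le_power[OF Suc.prems(1)[of n]]] by simp
  moreover have "0 < N ^ n" using Suc.prems(2) by (metis gr0I mult_0_right not_less_zero power_Suc)
  then have "pdeg_le r (n * (N * D)) (digit_mono f N n (k mod N ^ n))"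
    using Suc by simp
  ultimately have "pdeg_le r (n * (N * D) + N * D) (\<lambda>x. digit_mono f N n (k mod N ^ n) x * f n x ^ (k div N ^ n))"
    by (intro pdeg_le_mult)
  then show ?case by (simp add: add.commute)
qed

text \<open>If \<open>f\<^sub>l\<close> vanishes on the \<open>l\<close>-th member of a chain of irreducible sets but not on the next one, then
  \<open>f\<^sub>0, \<dots>, f\<^bsub>i-1\<^esub>\<close> are algebraically independent on the \<open>i\<close>-th member: a relation of minimal order in
  \<open>f\<^bsub>i-1\<^esub>\<close> can be divided by a power of it and then restricted to the previous member.\<close>

lemma digit_mono_independent:
  fixes f :: "nat \<Rightarrow> (nat \<Rightarrow> 'a::field) \<Rightarrow> 'a"
  assumes chain: "zchain r n C S"
    and f: "\<And>l. l < n \<Longrightarrow> pfun (f l)" "\<And>l x. l < n \<Longrightarrow> x \<in> C l \<Longrightarrow> f l x = 0"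
      "\<And>l. l < n \<Longrightarrow> \<exists>x\<in>C (Suc l). f l x \<noteq> 0"
    and i: "i \<le> n"
    and zero: "\<And>x. x \<in> C i \<Longrightarrow> (\<Sum>k<N ^ i. c k * digit_mono f N i k x) = 0"
    and k: "k < N ^ i"
  shows "c k = 0"
  using i zero k
proof (induction i arbitrary: c k)
  case 0
  then have "C 0 \<noteq> {}" using chain by (auto simp: zchain_def zirreducible_def)
  then show ?case using 0 by auto
next
  case (Suc i)
  let ?P = "\<lambda>e x. \<Sum>j<N ^ i. c (e * N ^ i + j) * digit_mono f N i j x"
  have irr: "zirreducible r (C (Suc i))" using chain Suc.prems(1) by (simp add: zchain_def)
  have "C i \<subset> C (Suc i)" using chain Suc.prems(1) by (simp add: zchain_def)
  then have sub: "C i \<subseteq> C (Suc i)" by blast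
  have lt: "i < n" using Suc.prems(1) by simp
  have pP: "pfun (?P e)" for e
    by (intro pfun_sum pfun_mult pfun_const pfun_digit_mono f) (use lt in auto)
  have zero: "(\<Sum>e<N. ?P e x * f i x ^ e) = 0" if "x \<in> C (Suc i)" for x
    using Suc.prems(2)[OF that] unfolding sum_digit_mono_Suc .
  have main: "\<forall>j<N ^ i. c (e * N ^ i + j) = 0" if "e < N" for e
    using that
  proof (induction e rule: less_induct)
    case (less e)
    have low: "?P e' x = 0" if "e' < e" for e' x using less that by simp
    let ?Q = "\<lambda>x. \<Sum>e'\<in>{e..<N}. ?P e' x * f i x ^ (e' - e)"
    have "(\<forall>x\<in>C (Suc i). f i x ^ e = 0) \<or> (\<forall>x\<in>C (Suc i). ?Q x = 0)"
    proof (rule zirreducible_prod_zero[OF irr])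
      show "pfun (\<lambda>x. f i x ^ e)" by (intro pfun_power f lt)
      show "pfun ?Q" by (intro pfun_sum[where A = "{e..<N}"] pfun_mult[OF pP] pfun_power f lt)
      fix x assume x: "x \<in> C (Suc i)"
      have "f i x ^ e * ?Q x = (\<Sum>e'\<in>{e..<N}. ?P e' x * f i x ^ e')"
        unfolding sum_distrib_left
      proof (rule sum.cong[OF refl])
        fix e' assume "e' \<in> {e..<N}"
        then have "f i x ^ e * f i x ^ (e' - e) = f i x ^ e'" by (simp flip: power_add)
        then show "f i x ^ e * (?P e' x * f i x ^ (e' - e)) = ?P e' x * f i x ^ e'"
          by (simp only: mult.left_commute[of "f i x ^ e"])
      qed
      also have "\<dots> = (\<Sum>e'<N. ?P e' x * f i x ^ e')"
        by (rule sum.mono_neutral_left) (auto simp: low)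
      finally show "f i x ^ e * ?Q x = 0" using zero[OF x] by simp
    qed
    moreover have "\<not> (\<forall>x\<in>C (Suc i). f i x ^ e = 0)" using f(3)[OF lt] by auto
    ultimately have Q: "\<forall>x\<in>C (Suc i). ?Q x = 0" by argo
    have "?P e x = 0" if x: "x \<in> C i" for x
    proof -
      \<comment> \<open>On \<open>C i\<close> the function f_i vanishes, so only e' = e survives,
        through 0^0 = 1.\<close>
      have "?Q x = (\<Sum>e'\<in>{e}. ?P e' x * f i x ^ (e' - e))"
        by (rule sum.mono_neutral_right) (use less.prems f(2)[OF lt x] in auto)
      then show ?thesis using Q x sub by auto
    qed
    show ?case
    proof (intro allI impI)
      fix j assume "j < N ^ i"
      with \<open>\<And>x. x \<in> C i \<Longrightarrow> ?P e x = 0\<close> less_imp_le[OF lt]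
      show "c (e * N ^ i + j) = 0" by (intro Suc.IH[of "\<lambda>j. c (e * N ^ i + j)"])
    qed
  qed
  have "0 < N ^ i" using Suc.prems(3) by (metis gr0I mult_0_right not_less_zero power_Suc)
  moreover have "k div N ^ i < N" using Suc.prems(3) by (simp add: less_mult_imp_div_less)
  ultimately have "c (k div N ^ i * N ^ i + k mod N ^ i) = 0" using main by simp
  then show ?case by (simp only: div_mult_mod_eq)
qed

text \<open>With more than r members f_l, the N^n monomials in them outnumber the box monomials that
  express them on \<open>aff r\<close>; the resulting linear relation contradicts their independence
  on \<open>C n\<close>.\<close>

theorem zchain_length_le:
  fixes C :: "nat \<Rightarrow> (nat \<Rightarrow> 'a::field) set"
  assumes chain: "zchain r n C S"
  shows "n \<le> r"
proof (rule ccontr)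
  assume "\<not> n \<le> r"
  then have rn: "Suc r \<le> n" by simp
  have cl: "zclosed r (C i)" if "i \<le> n" for i
    using chain that by (simp add: zchain_def zirreducible_def)
  have "\<exists>g. pfun g \<and> (\<forall>x\<in>C l. g x = 0) \<and> (\<exists>x\<in>C (Suc l). g x \<noteq> 0)" if l: "l < n" for l
  proof -
    have "C l \<subset> C (Suc l)" using chain l by (simp add: zchain_def)
    then obtain x where x: "x \<in> C (Suc l)" "x \<notin> C l" by blast
    then have "x \<in> aff r" using zclosed_subset_aff[OF cl[of "Suc l"]] l by auto
    then obtain g where "pfun g" "\<And>z. z \<in> C l \<Longrightarrow> g z = 0" "g x \<noteq> 0"
      using zclosed_separate[OF cl[OF less_imp_le[OF l]]] x(2) by blast
    then show ?thesis using x by blast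
  qed
  then obtain f where f: "\<And>l. l < n \<Longrightarrow> pfun (f l)" "\<And>l x. l < n \<Longrightarrow> x \<in> C l \<Longrightarrow> f l x = 0"
    "\<And>l. l < n \<Longrightarrow> \<exists>x\<in>C (Suc l). f l x \<noteq> 0" by metis
  have "\<exists>M. pdeg_le r M (f l)" if "l < n" for l using pfun_imp_pdeg_le[OF f(1)[OF that]] .
  then obtain M where M: "\<And>l. l < n \<Longrightarrow> pdeg_le r (M l) (f l)" by metis
  define D where "D = (\<Sum>l<n. M l)"
  have D: "pdeg_le r D (f l)" if "l < n" for l
    using M[OF that] by (rule pdeg_le_mono) (use that in \<open>auto simp: D_def intro: member_le_sum\<close>)
  \<comment> \<open>The bound \<open>?K\<close> is linear in N, so there are at most N^r * (n * D +
    1)^r box monomials; N is taken just above (n * D + 1)^r to make this smaller than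
    N^(r+1).\<close>
  define N where "N = Suc (Suc (n * D) ^ r)"
  let ?K = "n * (N * D)"
  have "Suc ?K \<le> N * Suc (n * D)" by (simp add: N_def algebra_simps)
  then have "Suc ?K ^ r \<le> N ^ r * Suc (n * D) ^ r" by (metis power_mono power_mult_distrib zero_le)
  also have "\<dots> < N ^ r * N" by (simp add: N_def)
  also have "\<dots> = N ^ Suc r" by (simp add: mult.commute)
  also have "\<dots> \<le> N ^ n" using rn by (intro power_increasing) (simp_all add: N_def)
  finally have count: "card (exponents r ?K) < card {..<N ^ n}" by (simp add: card_exponents)
  have "\<forall>k\<in>{..<N ^ n}. \<exists>d. \<forall>x\<in>aff r.
      digit_mono f N n k x = (\<Sum>\<beta>\<in>exponents r ?K. d \<beta> * (\<Prod>i<r. x i ^ \<beta> i))"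
    using pdeg_le_digit_mono[of n r D f _ N] D by (simp add: pdeg_le_def)
  from bchoice[OF this] obtain d where d: "\<And>k x. k < N ^ n \<Longrightarrow> x \<in> aff r \<Longrightarrow>
      digit_mono f N n k x = (\<Sum>\<beta>\<in>exponents r ?K. d k \<beta> * (\<Prod>i<r. x i ^ \<beta> i))" by auto
  obtain c where c: "\<exists>k\<in>{..<N ^ n}. c k \<noteq> 0" "\<forall>\<beta>\<in>exponents r ?K. (\<Sum>k<N ^ n. c k * d k \<beta>) = 0"
    using homogeneous_system_solution[OF finite_exponents finite_lessThan count, of d] by blast
  have "(\<Sum>k<N ^ n. c k * digit_mono f N n k x) = 0" if "x \<in> C n" for x
  proof -
    have x: "x \<in> aff r" using zclosed_subset_aff[OF cl[of n]] that by auto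
    have "(\<Sum>k<N ^ n. c k * digit_mono f N n k x)
        = (\<Sum>k<N ^ n. \<Sum>\<beta>\<in>exponents r ?K. c k * d k \<beta> * (\<Prod>i<r. x i ^ \<beta> i))"
      using d x by (simp add: sum_distrib_left mult.assoc)
    also have "\<dots> = (\<Sum>\<beta>\<in>exponents r ?K. (\<Sum>k<N ^ n. c k * d k \<beta>) * (\<Prod>i<r. x i ^ \<beta> i))"
      by (subst sum.swap) (simp add: sum_distrib_right)
    also have "\<dots> = 0" using c(2) by simp
    finally show ?thesis .
  qed
  then have "c k = 0" if "k < N ^ n" for k
    using digit_mono_independent[OF chain f order.refl _ that] by blast
  then show False using c(1) by auto
qed

text \<open>A chain in the kernel of a surjective \<open>m \<times> r\<close> matrix \<open>A\<close> is prolonged by the \<open>m\<close> linear spaces obtained by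
  dropping one equation after the other.\<close>

lemma zchain_kernel_length_le:
  fixes A :: "nat \<Rightarrow> nat \<Rightarrow> 'a::alg_closed_field"
  assumes surj: "\<And>l. l < m \<Longrightarrow> \<exists>b. \<forall>i<m. (\<Sum>j<r. A i j * b j) = (if i = l then 1 else 0)"
    and chain: "zchain r n C {v\<in>aff r. \<forall>i<m. (\<Sum>j<r. A i j * v j) = 0}"
  shows "n + m \<le> r"
proof -
  obtain b where b: "\<And>i l. i < m \<Longrightarrow> l < m \<Longrightarrow> (\<Sum>j<r. A i j * b l j) = (if i = l then 1 else 0)"
    using surj by metis
  let ?A = "\<lambda>i v. \<Sum>j<r. A i j * v j"
  define E where "E l = {v\<in>aff r. \<forall>i\<in>{l..<m}. ?A i v = 0}" for l
  have E_irr: "zirreducible r (E l)" for l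
  proof -
    \<comment> \<open>Linear projection onto \<open>E l\<close>: the dual vectors b_i remove the
      values of the equations from l on.\<close>
    define \<phi> where "\<phi> x j = (if j < r then x j - (\<Sum>i\<in>{l..<m}. ?A i x * b i j) else 0)" for x :: "nat \<Rightarrow> 'a" and j
    have "pfun (\<lambda>x. \<phi> x j)" for j
      by (cases "j < r") (auto simp: \<phi>_def intro!: pfun_intros)
    moreover have "?A k (\<phi> x) = 0" if "k \<in> {l..<m}" for x k
    proof -
      have "?A k (\<phi> x) = ?A k x - (\<Sum>j<r. \<Sum>i\<in>{l..<m}. ?A i x * (A k j * b i j))"
        by (simp add: \<phi>_def right_diff_distrib sum_subtractf sum_distrib_left mult.left_commute)
      also have "(\<Sum>j<r. \<Sum>i\<in>{l..<m}. ?A i x * (A k j * b i j)) = (\<Sum>i\<in>{l..<m}. ?A i x * ?A k (b i))"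
        by (subst sum.swap) (simp add: sum_distrib_left)
      also have "\<dots> = (\<Sum>i\<in>{l..<m}. if i = k then ?A i x else 0)"
        by (rule sum.cong) (use that b in auto)
      also have "\<dots> = ?A k x" using that by (simp add: sum.delta)
      finally show ?thesis by simp
    qed
    then have "range \<phi> \<subseteq> E l" by (auto simp: E_def aff_def \<phi>_def)
    moreover have "v = \<phi> v" if "v \<in> E l" for v
      using that by (auto simp: E_def \<phi>_def aff_def fun_eq_iff)
    then have "E l \<subseteq> range \<phi>" by auto
    moreover have "zclosed r (E l)"
    proof -
      have "E l = {v\<in>aff r. \<forall>f\<in>?A ` {l..<m}. f v = 0}" by (auto simp: E_def)
      also have "zclosed r \<dots>" by (rule zclosed_zero_locus) (auto intro!: pfun_intros)
      finally show ?thesis .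
    qed
    ultimately show ?thesis using zirreducible_range[of \<phi> r] by (metis subset_antisym)
  qed
  have E_less: "E l \<subset> E (Suc l)" if "l < m" for l
  proof -
    let ?b = "\<lambda>j. if j < r then b l j else 0"
    have "?A i ?b = ?A i (b l)" for i by (rule sum.cong) auto
    then have "?b \<in> E (Suc l)" "?b \<notin> E l"
      using that by (auto simp: E_def aff_def b)
    moreover have "E l \<subseteq> E (Suc l)" by (auto simp: E_def)
    ultimately show ?thesis by blast
  qed
  have E0: "{v\<in>aff r. \<forall>i<m. ?A i v = 0} = E 0" by (auto simp: E_def)
  \<comment> \<open>After \<open>C n\<close> the chain continues with \<open>E 1\<close>;
    \<open>E 0\<close> is skipped because \<open>C n\<close> may be equal to it.\<close>
  define C' where "C' i = (if i \<le> n then C i else E (i - n))" for i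
  have "C' i \<subset> C' (Suc i)" if i: "i < n + m" for i
  proof (cases "i < n")
    case True
    then show ?thesis using chain by (simp add: C'_def zchain_def)
  next
    case False
    show ?thesis
    proof (cases "i = n")
      case True
      have "C n \<subseteq> E 0" using chain unfolding zchain_def E0 by simp
      also have "E 0 \<subset> E 1" using E_less[of 0] i True by simp
      finally show ?thesis using True by (simp add: C'_def)
    next
      case neq: False
      then have "Suc i - n = Suc (i - n)" using False by simp
      then show ?thesis using False neq E_less[of "i - n"] i by (simp add: C'_def)
    qed
  qed
  moreover have "zirreducible r (C' i)" if "i \<le> n + m" for i
    using chain E_irr by (simp add: C'_def zchain_def)
  ultimately have "zchain r (n + m) C' UNIV" by (simp add: zchain_def)
  then show ?thesis by (rule zchain_length_le)
qed

section \<open>Jacobians, discriminants and subdiscriminants\<close>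

context vec_space
begin

lemma rank_eq_card_obtain:
  assumes "A \<in> carrier_mat n nc"
  obtains S where "rank A = card S" "finite S" "S \<subseteq> set (cols A)" "lin_indpt S"
proof -
  let ?P = "\<lambda>T. T \<subseteq> set (cols A) \<and> lin_indpt T"
  have "lin_indpt {}" by (rule finite_lin_indpt2) auto
  then obtain S where S: "finite S" "maximal S ?P"
    using maximal_exists_superset[of "set (cols A)" ?P "{}"] by auto
  then show ?thesis
    using that rank_card_indpt[OF assms S(2)] by (auto simp: maximal_def)
qed

lemma rank_le_nr:
  assumes A: "A \<in> carrier_mat n nc"
  shows "rank A \<le> n"
proof -
  obtain S where "rank A = card S" "S \<subseteq> set (cols A)" "lin_indpt S"
    using rank_eq_card_obtain[OF A] .
  moreover have "set (cols A) \<subseteq> carrier_vec n" using cols_dim A by blast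
  ultimately show ?thesis using li_le_dim(2)[OF fin_dim, of S] dim_is_n by auto
qed

lemma rank_eq_nr_iff:
  assumes A: "A \<in> carrier_mat n nc"
  shows "rank A = n \<longleftrightarrow> (\<forall>y\<in>carrier_vec n. \<exists>x\<in>carrier_vec nc. A *\<^sub>v x = y)"
proof -
  have cols: "set (cols A) \<subseteq> carrier_vec n" using cols_dim A by blast
  have sub: "span (set (cols A)) \<subseteq> carrier_vec n"
    using span_closed cols by auto
  have "rank A = n \<longleftrightarrow> span (set (cols A)) = carrier_vec n"
  proof
    assume r: "rank A = n"
    obtain S where S: "rank A = card S" "finite S" "S \<subseteq> set (cols A)" "lin_indpt S"
      using rank_eq_card_obtain[OF A] .
    have "basis S"
      by (rule dim_li_is_basis) (use S r cols dim_is_n fin_dim in auto)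
    then have "span S = carrier_vec n" by (simp add: basis_def)
    then show "span (set (cols A)) = carrier_vec n"
      using span_is_monotone[OF S(3)] sub by auto
  next
    assume "span (set (cols A)) = carrier_vec n"
    then have "span_vs (set (cols A)) = V" by (simp add: module_vec_def)
    then show "rank A = n" by (simp add: rank_def dim_is_n)
  qed
  then show ?thesis
    using col_space_eq[OF A] A sub unfolding col_space_def by auto
qed

end

text \<open>In this form matrices disappear from later arguments: full rank is used and proved by
  exhibiting preimages.\<close>

lemma mrank_eq_iff_surjective:
  fixes a :: "nat \<Rightarrow> nat \<Rightarrow> 'a::field"
  shows "mrank m (mat m r (\<lambda>(i, j). a i j)) = m \<longleftrightarrow> (\<forall>u. \<exists>v. \<forall>i<m. (\<Sum>j<r. a i j * v j) = u i)"
proof -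
  let ?A = "mat m r (\<lambda>(i, j). a i j)"
  have mult: "?A *\<^sub>v x = vec m (\<lambda>i. \<Sum>j<r. a i j * x $ j)" if "x \<in> carrier_vec r" for x
    using that by (intro eq_vecI) (auto simp: scalar_prod_def atLeast0LessThan intro!: sum.cong)
  have "mrank m ?A = m \<longleftrightarrow> (\<forall>y\<in>carrier_vec m. \<exists>x\<in>carrier_vec r. ?A *\<^sub>v x = y)"
    by (rule vec_space.rank_eq_nr_iff) simp
  also have "\<dots> \<longleftrightarrow> (\<forall>u. \<exists>v. \<forall>i<m. (\<Sum>j<r. a i j * v j) = u i)"
  proof (intro iffI allI ballI)
    fix u assume "\<forall>y\<in>carrier_vec m. \<exists>x\<in>carrier_vec r. ?A *\<^sub>v x = y"
    then obtain x where x: "x \<in> carrier_vec r" "?A *\<^sub>v x = vec m u"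
      by (metis vec_carrier)
    have "(\<Sum>j<r. a i j * x $ j) = u i" if "i < m" for i
      using arg_cong[OF x(2), of "\<lambda>w. w $ i"] that mult[OF x(1)] by simp
    then show "\<exists>v. \<forall>i<m. (\<Sum>j<r. a i j * v j) = u i" by blast
  next
    fix y :: "'a vec" assume *: "\<forall>u. \<exists>v. \<forall>i<m. (\<Sum>j<r. a i j * v j) = u i" and y: "y \<in> carrier_vec m"
    then obtain v where v: "\<forall>i<m. (\<Sum>j<r. a i j * v j) = y $ i"
      using spec[OF *, of "\<lambda>i. y $ i"] by blast
    have "?A *\<^sub>v vec r v = y"
      using v y by (subst mult) (auto intro!: eq_vecI)
    then show "\<exists>x\<in>carrier_vec r. ?A *\<^sub>v x = y" by (intro bexI[of _ "vec r v"]) auto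
  qed
  finally show ?thesis .
qed

section \<open>Formal derivatives and the differential of the root map\<close>

lemma meval_mpderiv:
  "meval x (mpderiv i p) = (\<Sum>t\<in>Poly_Mapping.keys p.
     of_nat (Poly_Mapping.lookup t i) * Poly_Mapping.lookup p t * mono_eval x (t - Poly_Mapping.single i 1))"
  by (simp add: mpderiv_def mmonom_def meval_single)

text \<open>The coefficient of T is the derivative at 0, and the product rule applies. Where the
  subtraction of exponents is truncated, the factor \<open>of_nat (Poly_Mapping.lookup t i)\<close>
  is 0.\<close>

lemma coeff_1_mono_eval:
  fixes s :: "nat \<Rightarrow> 'a::field poly"
  assumes A: "finite A" "Poly_Mapping.keys t \<subseteq> A"
  shows "coeff (mono_eval s t) 1 = (\<Sum>i\<in>A. coeff (s i) 1 *
    (of_nat (Poly_Mapping.lookup t i) * mono_eval (\<lambda>j. coeff (s j) 0) (t - Poly_Mapping.single i 1)))"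
proof -
  let ?t = "Poly_Mapping.lookup t"
  have "coeff (mono_eval s t) 1 = poly (pderiv (\<Prod>i\<in>A. s i ^ ?t i)) 0"
    by (simp add: mono_eval_superset[OF A] poly_0_coeff_0 coeff_pderiv)
  also have "\<dots> = (\<Sum>i\<in>A. poly (\<Prod>j\<in>A - {i}. s j ^ ?t j) 0 * poly (pderiv (s i ^ ?t i)) 0)"
    by (simp add: pderiv_prod poly_sum)
  also have "\<dots> = (\<Sum>i\<in>A. coeff (s i) 1 *
    (of_nat (?t i) * mono_eval (\<lambda>j. coeff (s j) 0) (t - Poly_Mapping.single i 1)))"
  proof (rule sum.cong[OF refl])
    fix i assume i: "i \<in> A"
    have "Poly_Mapping.keys (t - Poly_Mapping.single i 1) \<subseteq> A"
      using A(2) i keys_diff[of t "Poly_Mapping.single i 1"] by (auto simp: in_keys_iff lookup_minus)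
    then have "mono_eval (\<lambda>j. coeff (s j) 0) (t - Poly_Mapping.single i 1)
        = (\<Prod>j\<in>A. coeff (s j) 0 ^ Poly_Mapping.lookup (t - Poly_Mapping.single i 1) j)"
      by (rule mono_eval_superset[OF A(1)])
    also have "\<dots> = coeff (s i) 0 ^ (?t i - 1) * (\<Prod>j\<in>A - {i}. coeff (s j) 0 ^ ?t j)"
      using A(1) i by (subst prod.remove[of A i])
        (auto simp: lookup_minus lookup_single when_def intro!: prod.cong)
    finally have mono: "mono_eval (\<lambda>j. coeff (s j) 0) (t - Poly_Mapping.single i 1)
        = coeff (s i) 0 ^ (?t i - 1) * (\<Prod>j\<in>A - {i}. coeff (s j) 0 ^ ?t j)" .
    have "coeff (s i) 1 = poly (pderiv (s i)) 0" by (simp add: poly_0_coeff_0 coeff_pderiv)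
    then have "poly (pderiv (s i ^ ?t i)) 0 = of_nat (?t i) * (coeff (s i) 0 ^ (?t i - 1) * coeff (s i) 1)"
      by (simp only: pderiv_power poly_smult poly_mult poly_power poly_0_coeff_0[symmetric])
    then show "poly (\<Prod>j\<in>A - {i}. s j ^ ?t j) 0 * poly (pderiv (s i ^ ?t i)) 0 = coeff (s i) 1 *
      (of_nat (?t i) * mono_eval (\<lambda>j. coeff (s j) 0) (t - Poly_Mapping.single i 1))"
      unfolding mono unfolding poly_prod poly_power poly_0_coeff_0[symmetric] by (simp only: mult_ac)
  qed
  finally show ?thesis .
qed

text \<open>Evaluation at \<open>x + t v\<close> modulo \<open>t\<^sup>2\<close> encodes the directional derivative; composing evaluations is the chain rule.\<close>

lemma coeff_1_meval_hom:
  fixes s :: "nat \<Rightarrow> 'a::field poly"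
  assumes A: "finite A" "mvars p \<subseteq> A"
  shows "coeff (meval_hom (\<lambda>c. [:c:]) s p) 1 = (\<Sum>i\<in>A. coeff (s i) 1 * meval (\<lambda>j. coeff (s j) 0) (mpderiv i p))"
proof -
  let ?K = "Poly_Mapping.keys p"
  have "coeff (meval_hom (\<lambda>c. [:c:]) s p) 1 = (\<Sum>t\<in>?K. Poly_Mapping.lookup p t * coeff (mono_eval s t) 1)"
    by (simp add: meval_hom_def mono_eval_def[symmetric] coeff_sum)
  also have "\<dots> = (\<Sum>t\<in>?K. \<Sum>i\<in>A. coeff (s i) 1 * (of_nat (Poly_Mapping.lookup t i) * Poly_Mapping.lookup p t *
      mono_eval (\<lambda>j. coeff (s j) 0) (t - Poly_Mapping.single i 1)))"
  proof (rule sum.cong[OF refl])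
    fix t assume "t \<in> ?K"
    then have "Poly_Mapping.keys t \<subseteq> A" using A(2) by (auto simp: mvars_def)
    from coeff_1_mono_eval[OF A(1) this, of s]
    show "Poly_Mapping.lookup p t * coeff (mono_eval s t) 1 = (\<Sum>i\<in>A. coeff (s i) 1 * (of_nat (Poly_Mapping.lookup t i) *
      Poly_Mapping.lookup p t * mono_eval (\<lambda>j. coeff (s j) 0) (t - Poly_Mapping.single i 1)))"
      by (simp add: sum_distrib_left mult_ac)
  qed
  also have "\<dots> = (\<Sum>i\<in>A. coeff (s i) 1 * meval (\<lambda>j. coeff (s j) 0) (mpderiv i p))"
    by (subst sum.swap) (simp add: meval_mpderiv sum_distrib_left)
  finally show ?thesis .
qed

text \<open>Vieta's formula over any commutative ring, because \<open>s\<close> will consist of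
  field elements or of the polynomials x_i + v_i t.\<close>

lemma coeff_prod_linear_factors:
  fixes s :: "nat \<Rightarrow> 'b::comm_ring_1"
  assumes "l \<le> r"
  shows "coeff (\<Prod>i<r. [:- s i, 1:]) l = (-1) ^ (r - l) * (\<Sum>S\<in>{S. S \<subseteq> {..<r} \<and> card S = r - l}. \<Prod>i\<in>S. s i)"
proof -
  have "(\<Prod>i<r. [:- s i, 1:]) = (\<Prod>i<r. [:- s i:] + monom 1 1)"
    by (simp add: monom_altdef)
  also have "\<dots> = (\<Sum>S\<in>Pow {..<r}. (\<Prod>i\<in>S. [:- s i:]) * (\<Prod>i\<in>{..<r} - S. monom 1 1))"
    by (rule prod_add) simp
  also have "\<dots> = (\<Sum>S\<in>Pow {..<r}. monom ((-1) ^ card S * (\<Prod>i\<in>S. s i)) (r - card S))"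
  proof (rule sum.cong[OF refl])
    fix S assume "S \<in> Pow {..<r}"
    then have "finite S" and S: "card ({..<r} - S) = r - card S"
      by (auto simp: card_Diff_subset finite_subset[of S "{..<r}"])
    have "(\<Prod>i\<in>S. [:- s i:]) = [:\<Prod>i\<in>S. - s i:]" using \<open>finite S\<close>
      by (induction S rule: finite_induct) auto
    also have "(\<Prod>i\<in>S. - s i) = (-1) ^ card S * (\<Prod>i\<in>S. s i)"
      by (simp add: prod_uminus)
    finally show "(\<Prod>i\<in>S. [:- s i:]) * (\<Prod>i\<in>{..<r} - S. monom 1 1) = monom ((-1) ^ card S * (\<Prod>i\<in>S. s i)) (r - card S)"
      by (simp add: S monom_power smult_monom)
  qed
  finally have "coeff (\<Prod>i<r. [:- s i, 1:]) l
      = (\<Sum>S\<in>Pow {..<r}. if r - card S = l then (-1) ^ card S * (\<Prod>i\<in>S. s i) else 0)"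
    by (simp add: coeff_sum)
  also have "\<dots> = (\<Sum>S\<in>{S. S \<subseteq> {..<r} \<and> card S = r - l}. (-1) ^ card S * (\<Prod>i\<in>S. s i))"
  proof (rule sum.mono_neutral_cong_right)
    show "\<forall>S\<in>Pow {..<r} - {S. S \<subseteq> {..<r} \<and> card S = r - l}.
        (if r - card S = l then (-1) ^ card S * (\<Prod>i\<in>S. s i) else 0) = 0"
    proof
      fix S assume S: "S \<in> Pow {..<r} - {S. S \<subseteq> {..<r} \<and> card S = r - l}"
      then have "card S \<le> r" using card_mono[of "{..<r}" S] by auto
      then show "(if r - card S = l then (-1) ^ card S * (\<Prod>i\<in>S. s i) else 0) = 0" using S by auto
    qed
  qed (use assms in auto)
  finally show ?thesis by (simp add: sum_distrib_left)
qed

lemma (in comm_ring_hom) meval_hom_signed_esym: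
  assumes "l \<le> r"
  shows "meval_hom hom s (mconst ((-1) ^ (r - l)) * esym r (r - l)) = coeff (\<Prod>i<r. [:- s i, 1:]) l"
  unfolding coeff_prod_linear_factors[OF assms] esym_def
  by (simp add: meval_hom_mult meval_hom_sum meval_hom_prod hom_distribs)

lemma mvars_sym_lift: "mvars (sym_lift r (G :: 'a::field mpoly)) \<subseteq> {..<r}"
proof -
  have "mvars (mconst ((-1) ^ (r - j)) * esym r (r - j) :: 'a mpoly) \<subseteq> {..<r}" for j
  proof -
    have "mvars (\<Prod>i\<in>S. mvar i :: 'a mpoly) \<subseteq> {..<r}" if "S \<subseteq> {..<r}" for S
    proof -
      have "(\<Union>i\<in>S. mvars (mvar i :: 'a mpoly)) \<subseteq> S" using mvars_mvar by blast
      then show ?thesis using mvars_prod[of mvar S] that by blast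
    qed
    then have "(\<Union>S\<in>{S. S \<subseteq> {..<r} \<and> card S = r - j}. mvars (\<Prod>i\<in>S. mvar i :: 'a mpoly)) \<subseteq> {..<r}" by blast
    from order.trans[OF mvars_sum this] have "mvars (esym r (r - j) :: 'a mpoly) \<subseteq> {..<r}"
      unfolding esym_def .
    then show ?thesis
      using mvars_mult[of "mconst ((-1) ^ (r - j)) :: 'a mpoly" "esym r (r - j)"] by simp
  qed
  then show ?thesis using mvars_msubst unfolding sym_lift_def by blast
qed

lemma meval_sym_lift:
  assumes "mvars G \<subseteq> {..<r}"
  shows "meval x (sym_lift r G) = meval (root_map r x) G"
proof -
  have "meval x (sym_lift r G) = meval (\<lambda>l. meval x (mconst ((-1) ^ (r - l)) * esym r (r - l))) G"
    unfolding sym_lift_def by (rule meval_msubst)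
  also have "\<dots> = meval (root_map r x) G"
    by (rule meval_cong)
      (use assms in \<open>auto simp: root_map_def roots_poly_def meval_def comm_ring_hom.meval_hom_signed_esym[OF comm_ring_hom_id]
         simp del: meval_mult\<close>)
  finally show ?thesis .
qed

text \<open>The derivative of the coefficients of \<open>\<Prod>i\<in>I. (T - x\<^sub>i)\<close> in direction \<open>v\<close>.\<close>

definition roots_poly_deriv :: "nat set \<Rightarrow> (nat \<Rightarrow> 'a::field) \<Rightarrow> (nat \<Rightarrow> 'a) \<Rightarrow> 'a poly" where
  "roots_poly_deriv I x v = - (\<Sum>i\<in>I. smult (v i) (\<Prod>j\<in>I - {i}. [:- x j, 1:]))"

text \<open>Leibniz rule for one more factor T - x_a. If v_a = 0, the derivative is a multiple of
  that factor.\<close>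

lemma roots_poly_deriv_insert:
  assumes "finite I" "a \<notin> I"
  shows "roots_poly_deriv (insert a I) x v =
    [:- x a, 1:] * roots_poly_deriv I x v - smult (v a) (\<Prod>j\<in>I. [:- x j, 1:])"
proof -
  have "(\<Prod>j\<in>insert a I - {i}. [:- x j, 1:]) = [:- x a, 1:] * (\<Prod>j\<in>I - {i}. [:- x j, 1:])" if "i \<in> I" for i
  proof -
    have "insert a I - {i} = insert a (I - {i})" using that assms(2) by auto
    then show ?thesis using assms by (simp del: mult_pCons_left)
  qed
  moreover have "insert a I - {a} = I" using assms(2) by auto
  ultimately show ?thesis
    using assms unfolding roots_poly_deriv_def
    by (simp add: sum_distrib_left del: mult_pCons_left cong: sum.cong)
qed

text \<open>The outer polynomial variable is T, the inner one the parameter t of the line x + t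
  v.\<close>

lemma coeff_first_order_roots_poly:
  fixes x v :: "nat \<Rightarrow> 'a::field"
  assumes "finite I"
  shows "coeff (coeff (\<Prod>i\<in>I. [:- [:x i, v i:], 1:]) l) 0 = coeff (\<Prod>i\<in>I. [:- x i, 1:]) l \<and>
    coeff (coeff (\<Prod>i\<in>I. [:- [:x i, v i:], 1:]) l) 1 = coeff (roots_poly_deriv I x v) l"
  using assms
proof (induction I arbitrary: l rule: finite_induct)
  case empty
  show ?case by (simp add: roots_poly_deriv_def coeff_1)
next
  case (insert a I)
  have *: "coeff ([:- c, 1:] * P) l = (case l of 0 \<Rightarrow> 0 | Suc k \<Rightarrow> coeff P k) - c * coeff P l"
    for c :: "'b::comm_ring_1" and P by (cases l) simp_all
  have 1: "coeff ([:x a, v a:] * q) 1 = x a * coeff q 1 + v a * coeff q 0" for q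
    by (simp add: coeff_mult)
  have 0: "coeff ([:x a, v a:] * q) 0 = x a * coeff q 0" for q
    by (simp add: coeff_mult)
  show ?case
    unfolding prod.insert[OF insert.hyps] roots_poly_deriv_insert[OF insert.hyps] * coeff_diff coeff_smult
      0 1 using insert.IH by (cases l) (simp_all add: algebra_simps)
qed

lemma meval_mpderiv_cong:
  assumes "\<And>i. i \<in> mvars p \<Longrightarrow> x i = y i"
  shows "meval x (mpderiv j p) = meval y (mpderiv j p)"
  unfolding meval_mpderiv
proof (rule sum.cong[OF refl], rule arg_cong2[of _ _ _ _ times, OF refl], rule mono_eval_cong)
  fix t i assume "t \<in> Poly_Mapping.keys p" "i \<in> Poly_Mapping.keys (t - Poly_Mapping.single j 1)"
  then have "i \<in> mvars p"
    by (auto simp: mvars_def in_keys_iff lookup_minus intro!: bexI[of _ t])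
  then show "x i = y i" by (rule assms)
qed

text \<open>Chain rule: both sides are the coefficient of t after evaluation along x + t v, once
  directly and once through the coefficients of the product.\<close>

lemma sym_lift_directional_derivative:
  fixes x v :: "nat \<Rightarrow> 'a::field"
  assumes G: "mvars G \<subseteq> {..<r}"
  shows "(\<Sum>j<r. meval x (mpderiv j (sym_lift r G)) * v j) =
    (\<Sum>l<r. meval (root_map r x) (mpderiv l G) * coeff (roots_poly_deriv {..<r} x v) l)"
proof -
  let ?s = "\<lambda>j. [:x j, v j:]"
  let ?\<sigma> = "\<lambda>l. mconst ((-1) ^ (r - l)) * esym r (r - l) :: 'a mpoly"
  let ?h = "\<lambda>c :: 'a. [:c:]"
  have hom: "comm_ring_hom ?h" by (rule comm_ring_hom_const_poly)
  have \<sigma>: "meval_hom ?h ?s (?\<sigma> l) = coeff (\<Prod>i<r. [:- ?s i, 1:]) l" if "l < r" for l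
    using comm_ring_hom.meval_hom_signed_esym[OF hom, of l r ?s] that by simp
  have "(\<Sum>j<r. meval x (mpderiv j (sym_lift r G)) * v j) = coeff (meval_hom ?h ?s (sym_lift r G)) 1"
    by (subst coeff_1_meval_hom[OF finite_lessThan mvars_sym_lift]) (simp add: mult.commute)
  also have "\<dots> = coeff (meval_hom ?h (\<lambda>l. meval_hom ?h ?s (?\<sigma> l)) G) 1"
    unfolding sym_lift_def by (simp only: comm_ring_hom.meval_hom_msubst[OF hom])
  also have "\<dots> = (\<Sum>l<r. coeff (meval_hom ?h ?s (?\<sigma> l)) 1 *
      meval (\<lambda>l. coeff (meval_hom ?h ?s (?\<sigma> l)) 0) (mpderiv l G))"
    by (rule coeff_1_meval_hom[OF finite_lessThan G])
  also have "\<dots> = (\<Sum>l<r. meval (root_map r x) (mpderiv l G) * coeff (roots_poly_deriv {..<r} x v) l)"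
  proof (rule sum.cong[OF refl])
    fix l assume l: "l \<in> {..<r}"
    have "meval (\<lambda>l. coeff (meval_hom ?h ?s (?\<sigma> l)) 0) (mpderiv l G) = meval (root_map r x) (mpderiv l G)"
    proof (rule meval_mpderiv_cong)
      fix i assume "i \<in> mvars G"
      then have "i < r" using G by auto
      then show "coeff (meval_hom ?h ?s (?\<sigma> i)) 0 = root_map r x i"
        using coeff_first_order_roots_poly[of "{..<r}" x v i]
        by (simp only: \<sigma> root_map_def roots_poly_def if_True finite_lessThan)
    qed
    moreover have "coeff (meval_hom ?h ?s (?\<sigma> l)) 1 = coeff (roots_poly_deriv {..<r} x v) l"
      unfolding \<sigma>[OF l[unfolded lessThan_iff]]
      by (rule conjunct2[OF coeff_first_order_roots_poly[OF finite_lessThan]])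
    ultimately show "coeff (meval_hom ?h ?s (?\<sigma> l)) 1 * meval (\<lambda>l. coeff (meval_hom ?h ?s (?\<sigma> l)) 0) (mpderiv l G) =
        meval (root_map r x) (mpderiv l G) * coeff (roots_poly_deriv {..<r} x v) l"
      by (simp only: mult.commute)
  qed
  finally show ?thesis .
qed

text \<open>Lagrange interpolation: v_i is chosen to match w at x_i, and both sides have degree
  below the number of nodes.\<close>

lemma roots_poly_deriv_surj:
  fixes w :: "'a::field poly"
  assumes "finite I" "inj_on x I" "degree w < card I"
  shows "\<exists>v. roots_poly_deriv I x v = w"
proof -
  define v where "v i = - poly w (x i) / (\<Prod>j\<in>I - {i}. x i - x j)" for i
  have deg: "degree (roots_poly_deriv I x v) \<le> card I - 1"
    unfolding roots_poly_deriv_def degree_minus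
  proof (rule degree_sum_le[OF assms(1)])
    fix i assume "i \<in> I"
    have "degree (\<Prod>j\<in>I - {i}. [:- x j, 1:]) = card I - 1"
      using assms(1) \<open>i \<in> I\<close> by (subst degree_prod_sum_eq) auto
    then show "degree (smult (v i) (\<Prod>j\<in>I - {i}. [:- x j, 1:])) \<le> card I - 1"
      using degree_smult_le by metis
  qed
  have eval: "poly (roots_poly_deriv I x v) (x i) = poly w (x i)" if i: "i \<in> I" for i
  proof -
    have nz: "(\<Prod>j\<in>I - {i}. x i - x j) \<noteq> 0"
      using assms(1,2) i by (auto simp: inj_on_def)
    have "poly (roots_poly_deriv I x v) (x i) = - (\<Sum>k\<in>I. v k * (\<Prod>j\<in>I - {k}. x i - x j))"
      by (simp add: roots_poly_deriv_def poly_sum poly_prod)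
    also have "(\<Sum>k\<in>I. v k * (\<Prod>j\<in>I - {k}. x i - x j)) = (\<Sum>k\<in>{i}. v k * (\<Prod>j\<in>I - {k}. x i - x j))"
    proof (rule sum.mono_neutral_right[OF assms(1)])
      show "\<forall>k\<in>I - {i}. v k * (\<Prod>j\<in>I - {k}. x i - x j) = 0"
        using assms(1) i by (auto intro!: bexI[of _ i])
    qed (use i in auto)
    moreover have "v i * (\<Prod>j\<in>I - {i}. x i - x j) = - poly w (x i)" using nz by (simp add: v_def)
    ultimately show ?thesis by simp
  qed
  have "roots_poly_deriv I x v = w"
  proof (rule poly_eqI_degree)
    show "poly (roots_poly_deriv I x v) t = poly w t" if "t \<in> x ` I" for t using that eval by auto
    show "card (x ` I) > degree (roots_poly_deriv I x v)" "card (x ` I) > degree w"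
      using deg assms(3) card_image[OF assms(2)] by auto
  qed
  then show ?thesis by blast
qed

text \<open>At a double root only multiples of T - x_\<beta> are reached; the free k-th coefficient
  serves to make the target such a multiple. For k = 0 the condition on x_\<beta> always holds, as
  0^0 = 1.\<close>

lemma roots_poly_deriv_prescribe:
  fixes x u :: "nat \<Rightarrow> 'a::field"
  assumes "k < r"
    and cases: "inj_on x {..<r} \<or>
      (\<exists>\<alpha>\<in>{..<r}. \<exists>\<beta>\<in>{..<r}. \<alpha> \<noteq> \<beta> \<and> x \<alpha> = x \<beta> \<and> inj_on x ({..<r} - {\<beta>}) \<and> x \<beta> ^ k \<noteq> 0)"
  shows "\<exists>v. \<forall>l<r. l \<noteq> k \<longrightarrow> coeff (roots_poly_deriv {..<r} x v) l = u l"
proof -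
  define w where "w c = (\<Sum>l<r. monom (if l = k then c else u l) l)" for c
  have coeff_w: "coeff (w c) l = (if l = k then c else u l)" if "l < r" for c l
    using that by (simp add: w_def coeff_sum sum.delta)
  have coeff_w_ge: "coeff (w c) l = 0" if "\<not> l < r" for c l
    using that unfolding w_def coeff_sum by (intro sum.neutral) auto
  then have deg_w: "degree (w c) < r" for c
    using assms(1) by (intro degree_lessI) auto
  from cases show ?thesis
  proof
    assume "inj_on x {..<r}"
    then obtain v where "roots_poly_deriv {..<r} x v = w 0"
      using roots_poly_deriv_surj[of "{..<r}" x "w 0"] deg_w by auto
    then show ?thesis using coeff_w by (intro exI[of _ v]) simp
  next
    assume "\<exists>\<alpha>\<in>{..<r}. \<exists>\<beta>\<in>{..<r}. \<alpha> \<noteq> \<beta> \<and> x \<alpha> = x \<beta> \<and> inj_on x ({..<r} - {\<beta>}) \<and> x \<beta> ^ k \<noteq> 0"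
    then obtain \<alpha> \<beta> where ab: "\<alpha> < r" "\<beta> < r" "\<alpha> \<noteq> \<beta>" "x \<alpha> = x \<beta>" "inj_on x ({..<r} - {\<beta>})" "x \<beta> ^ k \<noteq> 0"
      by auto
    let ?I = "{..<r} - {\<beta>}"
    \<comment> \<open>The k-th coefficient for which the target vanishes at x_\<beta>.\<close>
    define c where "c = - poly (w 0) (x \<beta>) / x \<beta> ^ k"
    have "w c = w 0 + monom c k"
    proof (rule poly_eqI)
      fix n
      show "coeff (w c) n = coeff (w 0 + monom c k) n"
        using coeff_w[of n] coeff_w_ge[of n] \<open>k < r\<close> by (cases "n < r") auto
    qed
    then have "poly (w c) (x \<beta>) = 0" using ab(6) by (simp add: c_def poly_monom)
    then obtain w' where w': "w c = [:- x \<beta>, 1:] * w'" using poly_eq_0_iff_dvd by (metis dvdE)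
    have card: "card ?I = r - 1" "r - 1 > 0" using ab by auto
    have "degree w' < card ?I"
    proof (cases "w' = 0")
      case False
      then have "degree (w c) = Suc (degree w')" unfolding w' by (subst degree_mult_eq) auto
      then show ?thesis using deg_w[of c] card by simp
    qed (use card in simp)
    then obtain v where v: "roots_poly_deriv ?I x v = w'"
      using roots_poly_deriv_surj[of ?I x w'] ab(5) by auto
    \<comment> \<open>Keeping x_\<beta> fixed leaves T - x_\<beta> as a factor; the quotient
      \<open>w'\<close> is interpolated at the other, distinct roots.\<close>
    let ?v = "v(\<beta> := 0)"
    have ins: "insert \<beta> ?I = {..<r}" using ab(2) by auto
    have "roots_poly_deriv ?I x ?v = roots_poly_deriv ?I x v"
      unfolding roots_poly_deriv_def by (intro arg_cong[of _ _ uminus] sum.cong) auto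
    then have "roots_poly_deriv {..<r} x ?v = w c"
      using roots_poly_deriv_insert[of ?I \<beta> x ?v] v unfolding ins w' by simp
    then show ?thesis using coeff_w by (intro exI[of _ ?v]) auto
  qed
qed

section \<open>Vanishing of the discriminant and the subdiscriminant at repeated roots\<close>

text \<open>A common linear relation between the coefficients of all multiples of \<open>f\<close> and of \<open>g\<close> that only involves
  degrees \<open>\<ge> J\<close> is a left null vector of the matrix of the principal \<open>J\<close>-th subresultant coefficient.\<close>

lemma subresultant_coeff_eq_0:
  fixes f g :: "'a::field poly"
  assumes J: "J < degree f" and g: "g = 0 \<or> J \<le> degree g"
    and low: "\<And>s. s < J \<Longrightarrow> c s = 0" and top: "c J \<noteq> 0"
    and f0: "\<And>k N. k + degree f \<le> N \<Longrightarrow> (\<Sum>s\<le>N. c s * coeff (monom 1 k * f) s) = 0"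
    and g0: "\<And>k N. k + degree g \<le> N \<Longrightarrow> (\<Sum>s\<le>N. c s * coeff (monom 1 k * g) s) = 0"
  shows "coeff (subresultant J f g) J = 0"
proof -
  let ?\<phi> = "degree f" and ?\<gamma> = "degree g"
  define n where "n = (?\<phi> - J) + (?\<gamma> - J)"
  have n: "n > 0" using J by (simp add: n_def)
  let ?M = "subresultant'_mat J J f g"
  have carr: "?M \<in> carrier_mat n n" unfolding subresultant'_mat_def Let_def n_def by simp
  \<comment> \<open>Row i of the matrix belongs to T^(n + J - 1 - i), so the null vector lists c
    downwards and ends with \<open>c J\<close>, which is nonzero.\<close>
  define v where "v = vec n (\<lambda>i. c (n + J - 1 - i))"
  have zero: "(\<Sum>i<n. ?M $$ (i, j) * c (n + J - 1 - i)) = 0" if j: "j < n" for j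
  proof -
    have flip: "(\<Sum>i<n. coeff_int h (int (n + J - 1) - int i - int k) * c (n + J - 1 - i))
        = (\<Sum>s\<le>n + J - 1. c s * coeff (monom 1 k * h) s)" for h k
    proof -
      have "(\<Sum>i<n. coeff_int h (int (n + J - 1) - int i - int k) * c (n + J - 1 - i))
        = (\<Sum>s\<in>{J..n + J - 1}. coeff_int h (int s - int k) * c s)"
        by (rule sum.reindex_bij_witness[of _ "\<lambda>s. n + J - 1 - s" "\<lambda>i. n + J - 1 - i"])
          (use n in \<open>auto simp: of_nat_diff algebra_simps\<close>)
      also have "\<dots> = (\<Sum>s\<le>n + J - 1. coeff_int h (int s - int k) * c s)"
        by (rule sum.mono_neutral_left) (auto intro!: low)
      also have "\<dots> = (\<Sum>s\<le>n + J - 1. c s * coeff (monom 1 k * h) s)"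
      proof (rule sum.cong[OF refl])
        fix s
        have "coeff (monom 1 k * h) s = coeff_int h (int s - int k)"
          using coeff_int_monom_mult[of 1 k h "int s"] by simp
        then show "coeff_int h (int s - int k) * c s = c s * coeff (monom 1 k * h) s" by simp
      qed
      finally show ?thesis .
    qed
    show ?thesis
    proof (cases "j < ?\<gamma> - J")
      case True
      let ?k = "?\<gamma> - J - 1 - j"
      have "?M $$ (i, j) = coeff_int f (int (n + J - 1) - int i - int ?k)" if "i < n" for i
        using that j True J unfolding subresultant'_mat_def Let_def n_def
        by (auto simp: of_nat_diff intro!: arg_cong[of _ _ "coeff_int f"])
      then have "(\<Sum>i<n. ?M $$ (i, j) * c (n + J - 1 - i)) = (\<Sum>s\<le>n + J - 1. c s * coeff (monom 1 ?k * f) s)"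
        by (subst flip[symmetric]) simp
      also have "\<dots> = 0" by (rule f0) (use True J in \<open>auto simp: n_def\<close>)
      finally show ?thesis .
    next
      case False
      \<comment> \<open>The case g = 0 occurs for g = f' when f is a polynomial in T^p; the columns
        of the second block are then zero.\<close>
      show ?thesis
      proof (cases "g = 0")
        case True
        have "?M $$ (i, j) = 0" if "i < n" for i
          using that j False True unfolding subresultant'_mat_def Let_def n_def by (simp add: coeff_int_def)
        then show ?thesis by simp
      next
        case nz: False
        then have gJ: "J \<le> ?\<gamma>" using g by simp
        let ?k = "?\<phi> - J - 1 - (j - (?\<gamma> - J))"
        have "?M $$ (i, j) = coeff_int g (int (n + J - 1) - int i - int ?k)" if "i < n" for i
          using that j False J gJ unfolding subresultant'_mat_def Let_def n_def
          by (auto simp: of_nat_diff intro!: arg_cong[of _ _ "coeff_int g"])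
        then have "(\<Sum>i<n. ?M $$ (i, j) * c (n + J - 1 - i)) = (\<Sum>s\<le>n + J - 1. c s * coeff (monom 1 ?k * g) s)"
          by (subst flip[symmetric]) simp
        also have "\<dots> = 0" by (rule g0) (use False J gJ j in \<open>auto simp: n_def\<close>)
        finally show ?thesis .
      qed
    qed
  qed
  have "(\<Sum>i<n. ?M $$ (i, j) * v $ i) = 0" if "j < n" for j
    using zero[OF that] by (simp add: v_def)
  moreover have "dim_vec v = n" by (simp add: v_def)
  ultimately have "transpose_mat ?M *\<^sub>v v = 0\<^sub>v n"
    using carr by (intro eq_vecI) (auto simp: scalar_prod_def atLeast0LessThan)
  moreover have "v \<in> carrier_vec n" by (simp add: v_def)
  moreover have "v \<noteq> 0\<^sub>v n"
  proof
    assume "v = 0\<^sub>v n"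
    then have "v $ (n - 1) = 0" using n by simp
    then show False using n top by (simp add: v_def)
  qed
  ultimately have "det (transpose_mat ?M) = 0"
    using carr det_0_iff_vec_prod_zero_field[of "transpose_mat ?M" n, THEN iffD2] by auto
  then have "det ?M = 0" using det_transpose[OF carr] by simp
  then show ?thesis using n unfolding coeff_subresultant n_def by simp
qed

lemma degree_monom_mult_le: "degree (monom 1 k * f) \<le> k + degree (f :: 'a::comm_ring_1 poly)"
  using degree_mult_le[of "monom 1 k" f] degree_monom_le[of "1::'a" k] by linarith

lemma poly_eq_sum_le: "degree (p :: 'a::field poly) \<le> N \<Longrightarrow> poly p x = (\<Sum>s\<le>N. coeff p s * x ^ s)"
  unfolding poly_altdef by (rule sum.mono_neutral_left) (auto simp: coeff_eq_0)

text \<open>Evaluation at the common root: the relation with coefficients \<rho>^s kills all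
  multiples of f and f', and its entry of index 0 is 1 even for \<rho> = 0.\<close>

lemma Disc_eq_0:
  assumes f: "degree f > 0" "poly f \<rho> = 0" "poly (pderiv f) \<rho> = 0"
  shows "Disc f = 0"
proof -
  have "(\<Sum>s\<le>N. \<rho> ^ s * coeff (monom 1 k * h) s) = 0" if "poly h \<rho> = 0" "k + degree h \<le> N" for h k N
  proof -
    have "degree (monom 1 k * h) \<le> N" using degree_monom_mult_le[of k h] that(2) by linarith
    then have "(\<Sum>s\<le>N. \<rho> ^ s * coeff (monom 1 k * h) s) = poly (monom 1 k * h) \<rho>"
      by (subst poly_eq_sum_le) (auto simp: mult.commute)
    then show ?thesis using that(1) by simp
  qed
  then have "coeff (subresultant 0 f (pderiv f)) 0 = 0"
    using f by (intro subresultant_coeff_eq_0[where c = "\<lambda>s. \<rho> ^ s"]) auto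
  then show ?thesis by (simp add: Disc_def coeff_subresultant_0_0_resultant)
qed

fun divided_power :: "'a::field \<Rightarrow> 'a \<Rightarrow> nat \<Rightarrow> 'a" where
  "divided_power a b 0 = 0"
| "divided_power a b (Suc s) = a * divided_power a b s + b ^ s"

text \<open>\<open>divided_power a b s\<close> is the divided difference of \<open>T\<^sup>s\<close> at \<open>a\<close>, \<open>b\<close>, and divided differences at the two roots
  annihilate all multiples of \<open>(T - a) (T - b)\<close>.\<close>

lemma sum_divided_power:
  fixes w :: "'a::field poly"
  assumes "Suc (degree w) \<le> N"
  shows "(\<Sum>s\<le>N. divided_power a b s * coeff ([:- a, 1:] * w) s) = poly w b"
proof -
  obtain M where N: "N = Suc M" "degree w \<le> M" using assms by (cases N) auto
  have c: "coeff ([:- a, 1:] * w) s = coeff (pCons 0 w) s - a * coeff w s" for s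
    by (simp add: mult_pCons_left)
  have "(\<Sum>s\<le>N. divided_power a b s * coeff ([:- a, 1:] * w) s)
      = (\<Sum>s\<le>Suc M. divided_power a b s * coeff (pCons 0 w) s) - (\<Sum>s\<le>Suc M. divided_power a b s * (a * coeff w s))"
    unfolding c N(1) by (simp only: right_diff_distrib sum_subtractf)
  also have "(\<Sum>s\<le>Suc M. divided_power a b s * coeff (pCons 0 w) s) = (\<Sum>s\<le>M. divided_power a b (Suc s) * coeff w s)"
    by (subst sum.atMost_Suc_shift) simp
  also have "(\<Sum>s\<le>Suc M. divided_power a b s * (a * coeff w s)) = (\<Sum>s\<le>M. divided_power a b s * (a * coeff w s))"
    using N(2) by (simp add: coeff_eq_0)
  also have "(\<Sum>s\<le>M. divided_power a b (Suc s) * coeff w s) - (\<Sum>s\<le>M. divided_power a b s * (a * coeff w s))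
      = (\<Sum>s\<le>M. coeff w s * b ^ s)"
    by (simp add: sum_subtractf[symmetric] algebra_simps)
  also have "\<dots> = poly w b" using N(2) by (simp add: poly_eq_sum_le)
  finally show ?thesis .
qed

text \<open>Divided differences have entries 0 and 1 in degrees 0 and 1, as a relation for J = 1
  must. For a = b they become derivatives at a, so this case is included.\<close>

lemma Subdisc_eq_0:
  assumes f: "degree f > 0" "[:- a, 1:] * [:- b, 1:] dvd f" "[:- a, 1:] * [:- b, 1:] dvd pderiv f"
  shows "Subdisc f = 0"
proof -
  have deg: "degree ([:- a, 1:] * [:- b, 1:]) = 2" by (subst degree_mult_eq) auto
  have ann: "(\<Sum>s\<le>N. divided_power a b s * coeff (monom 1 k * h) s) = 0"
    if "[:- a, 1:] * [:- b, 1:] dvd h" "k + degree h \<le> N" for h k N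
  proof (cases "h = 0")
    case False
    from that(1) obtain w where w: "h = [:- a, 1:] * [:- b, 1:] * w" by (rule dvdE)
    let ?w = "[:- b, 1:] * (monom 1 k * w)"
    have eq: "monom 1 k * h = [:- a, 1:] * ?w" unfolding w by (simp only: mult_ac)
    have "monom 1 k * h \<noteq> 0" using False by simp
    then have "?w \<noteq> 0" unfolding eq by auto
    then have "degree (monom 1 k * h) = Suc (degree ?w)" unfolding eq by (subst degree_mult_eq) auto
    then have "Suc (degree ?w) \<le> N" using degree_monom_mult_le[of k h] that(2) by linarith
    then show ?thesis unfolding eq by (subst sum_divided_power) auto
  qed simp
  have "f \<noteq> 0" using f(1) by auto
  then have "degree f \<ge> 2" using dvd_imp_degree_le[OF f(2)] deg by simp
  moreover have "pderiv f = 0 \<or> 1 \<le> degree (pderiv f)"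
    using dvd_imp_degree_le[OF f(3)] deg by fastforce
  ultimately have "coeff (subresultant 1 f (pderiv f)) 1 = 0"
    using ann[OF f(2)] ann[OF f(3)]
    by (intro subresultant_coeff_eq_0[where c = "divided_power a b"]) auto
  then show ?thesis by (simp add: Subdisc_def)
qed

lemma linear_factors_dvd_prod:
  assumes "finite I" "i \<in> I" "j \<in> I" "i \<noteq> j"
  shows "[:- x i, 1:] * [:- x j, 1:] dvd (\<Prod>l\<in>I. [:- x l, 1:])"
proof -
  have "(\<Prod>l\<in>{i, j}. [:- x l, 1:]) dvd (\<Prod>l\<in>I. [:- x l, 1:])"
    by (rule prod_dvd_prod_subset) (use assms in auto)
  then show ?thesis using assms(4) by (simp del: mult_pCons_left)
qed

lemma pderiv_roots_poly: "pderiv (roots_poly r x) = (\<Sum>i<r. \<Prod>j\<in>{..<r} - {i}. [:- x j, 1:])"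
  unfolding roots_poly_def pderiv_prod by (simp add: pderiv_pCons)

lemma Disc_roots_poly_eq_0:
  assumes "\<alpha> < r" "\<beta> < r" "\<alpha> \<noteq> \<beta>" "x \<alpha> = x \<beta>"
  shows "Disc (roots_poly r x) = 0"
proof (rule Disc_eq_0)
  show "poly (roots_poly r x) (x \<alpha>) = 0" using assms(1) by (auto simp: poly_roots_poly intro!: bexI[of _ \<alpha>])
  have "(\<Prod>j\<in>{..<r} - {i}. x \<alpha> - x j) = 0" for i
    by (rule prod_zero) (use assms in \<open>auto intro!: bexI[of _ "if i = \<alpha> then \<beta> else \<alpha>"] split: if_splits\<close>)
  then show "poly (pderiv (roots_poly r x)) (x \<alpha>) = 0"
    by (simp add: pderiv_roots_poly poly_sum poly_prod)
qed (use assms in simp)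

text \<open>Two coincidences, the second avoiding \<beta>: this covers two double roots as well as a
  triple root, since \<gamma> or \<delta> may be \<alpha>.\<close>

lemma Subdisc_roots_poly_eq_0:
  assumes ab: "\<alpha> < r" "\<beta> < r" "\<alpha> \<noteq> \<beta>" "x \<alpha> = x \<beta>"
    and cd: "\<gamma> < r" "\<delta> < r" "\<gamma> \<noteq> \<delta>" "x \<gamma> = x \<delta>" "\<gamma> \<noteq> \<beta>" "\<delta> \<noteq> \<beta>"
  shows "Subdisc (roots_poly r x) = 0"
proof (rule Subdisc_eq_0[of _ "x \<alpha>" "x \<gamma>"])
  let ?h = "[:- x \<alpha>, 1:] * [:- x \<gamma>, 1:]"
  have dvd: "?h dvd (\<Prod>j\<in>I. [:- x j, 1:])"
    if "finite I" "i \<in> I" "j \<in> I" "i \<noteq> j" "x i = x \<alpha>" "x j = x \<gamma>" for I i j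
    using linear_factors_dvd_prod[OF that(1-4), of x] unfolding that(5,6) .
  show "?h dvd roots_poly r x"
    unfolding roots_poly_def by (rule dvd[of _ \<beta> \<gamma>]) (use ab cd in auto)
  show "?h dvd pderiv (roots_poly r x)"
    unfolding pderiv_roots_poly
  proof (rule dvd_sum)
    fix i assume "i \<in> {..<r}"
    \<comment> \<open>When the factor i is omitted, one of \<alpha>, \<beta> still supplies the
      first root; among \<gamma>, \<delta> an index different from i and \<open>?i\<close> supplies
      the second.\<close>
    let ?i = "if i = \<beta> then \<alpha> else \<beta>"
    let ?j = "if \<gamma> = i \<or> \<gamma> = ?i then \<delta> else \<gamma>"
    show "?h dvd (\<Prod>j\<in>{..<r} - {i}. [:- x j, 1:])"
      by (rule dvd[of _ ?i ?j]) (use ab cd in auto)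
  qed
qed (use ab in simp)

section \<open>Triangular systems and the singular locus\<close>

lemma mconst_mult_mmonom: "mconst c * mmonom t = Poly_Mapping.single t c"
  by (simp add: mconst_def mmonom_def mult_single)

lemma lookup_wt_part:
  "Poly_Mapping.lookup (wt_part r p) t = (if mono_wt r t = poly_wt r p then Poly_Mapping.lookup p t else 0)"
proof -
  let ?K = "{t \<in> Poly_Mapping.keys p. mono_wt r t = poly_wt r p}"
  have "Poly_Mapping.lookup (wt_part r p) t = (\<Sum>u\<in>?K. if u = t then Poly_Mapping.lookup p u else 0)"
    by (simp add: wt_part_def mconst_mult_mmonom lookup_sum lookup_single when_def)
  also have "\<dots> = (if t \<in> ?K then Poly_Mapping.lookup p t else 0)"
    by (simp add: sum.delta')
  finally show ?thesis by (auto simp: in_keys_iff)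
qed

lemma mono_wt_le_poly_wt: "t \<in> Poly_Mapping.keys p \<Longrightarrow> mono_wt r t \<le> poly_wt r p"
  unfolding poly_wt_def by (rule Max_ge) auto

lemma mono_wt_single [simp]: "mono_wt r (Poly_Mapping.single j 1) = r - j"
  by (simp add: mono_wt_def)

lemma mono_wt_ge:
  assumes "l \<in> Poly_Mapping.keys t"
  shows "r - l \<le> mono_wt r t"
proof -
  have "r - l \<le> (r - l) * Poly_Mapping.lookup t l" using assms by (simp add: in_keys_iff)
  also have "\<dots> \<le> mono_wt r t"
    unfolding mono_wt_def by (rule member_le_sum[OF assms]) auto
  finally show ?thesis .
qed

text \<open>The variable l alone uses up the weight r - l, and every other variable has positive
  weight.\<close>

lemma mono_wt_le_imp_single:
  assumes l: "l \<in> Poly_Mapping.keys t" and sub: "Poly_Mapping.keys t \<subseteq> {..<r}" and le: "mono_wt r t \<le> r - l"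
  shows "t = Poly_Mapping.single l 1"
proof -
  let ?K = "Poly_Mapping.keys t"
  have "mono_wt r t = (r - l) * Poly_Mapping.lookup t l + (\<Sum>j\<in>?K - {l}. (r - j) * Poly_Mapping.lookup t j)"
    unfolding mono_wt_def by (rule sum.remove) (use l in auto)
  moreover have "r - l \<le> (r - l) * Poly_Mapping.lookup t l" using l by (simp add: in_keys_iff)
  moreover have "r - l > 0" using l sub by auto
  ultimately have 1: "(r - l) * Poly_Mapping.lookup t l = r - l"
    and 2: "(\<Sum>j\<in>?K - {l}. (r - j) * Poly_Mapping.lookup t j) = 0" using le by linarith+
  have one: "Poly_Mapping.lookup t l = 1" using 1 \<open>r - l > 0\<close> by simp
  have "?K - {l} = {}"
  proof (rule ccontr)
    assume "?K - {l} \<noteq> {}"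
    then obtain j where j: "j \<in> ?K - {l}" by blast
    then have "(r - j) * Poly_Mapping.lookup t j = 0" using 2 by simp
    moreover have "j < r" using j sub by blast
    ultimately show False using j by (simp add: in_keys_iff)
  qed
  then have "Poly_Mapping.lookup t j = 0" if "j \<noteq> l" for j
    using that by (auto simp: in_keys_iff)
  then show ?thesis using one by (intro poly_mapping_eqI) (auto simp: lookup_single when_def)
qed

lemma mono_eval_0: "mono_eval (\<lambda>_. 0) t = (if t = 0 then 1 else 0 :: 'a::field)"
proof (cases "t = 0")
  case False
  then obtain i where "i \<in> Poly_Mapping.keys t" by fastforce
  then have "mono_eval (\<lambda>_. 0 :: 'a) t = 0"
    unfolding mono_eval_def by (intro prod_zero) (auto simp: in_keys_iff intro!: bexI[of _ i])
  then show ?thesis using False by simp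
qed simp

lemma meval_at_0: "meval (\<lambda>_. 0) p = Poly_Mapping.lookup p 0"
  for p :: "'a::field mpoly"
  unfolding meval_eq mono_eval_0
  by (simp add: if_distrib[of "\<lambda>u. _ * u"] sum.delta' in_keys_iff cong: if_cong)

lemma meval_mpderiv_at_0: "meval (\<lambda>_. 0) (mpderiv l p) = Poly_Mapping.lookup p (Poly_Mapping.single l 1)"
  for p :: "'a::field mpoly"
proof -
  have "of_nat (Poly_Mapping.lookup t l) * Poly_Mapping.lookup p t * mono_eval (\<lambda>_. 0) (t - Poly_Mapping.single l 1)
      = (if t = Poly_Mapping.single l 1 then Poly_Mapping.lookup p t else 0)" for t
  proof (cases "Poly_Mapping.lookup t l = 0 \<or> t - Poly_Mapping.single l 1 \<noteq> 0")
    case True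
    then show ?thesis by (auto simp: mono_eval_0)
  next
    case False
    have "Poly_Mapping.lookup t j = Poly_Mapping.lookup (Poly_Mapping.single l 1) j" for j
    proof -
      have "Poly_Mapping.lookup (t - Poly_Mapping.single l 1) j = 0" using False by simp
      then show ?thesis using False by (cases "j = l") (auto simp: lookup_minus lookup_single when_def)
    qed
    then have "t = Poly_Mapping.single l 1" by (rule poly_mapping_eqI)
    then show ?thesis by simp
  qed
  then have "meval (\<lambda>_. 0) (mpderiv l p)
      = (\<Sum>t\<in>Poly_Mapping.keys p. if t = Poly_Mapping.single l 1 then Poly_Mapping.lookup p t else 0)"
    unfolding meval_mpderiv by simp
  then show ?thesis by (simp add: sum.delta' in_keys_iff)
qed

lemma mconst_mem_ring_Ak: "in_Fq q c \<Longrightarrow> mconst c \<in> ring_Ak q r k"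
  by (auto simp: ring_Ak_def mconst_def mvars_def)

text \<open>A nonzero constant is a unit of the ring, its inverse being in F_q again, so the ideal
  would contain 1.\<close>

lemma regular_seq_not_const:
  assumes reg: "regular_seq_in (ring_Ak q r k) g m" and i: "i < m"
    and g: "g i = mconst c" "c \<noteq> 0"
  shows False
proof -
  have "g i \<in> ring_Ak q r k" using reg i by (simp add: regular_seq_in_def)
  then have "in_Fq q c" using g by (simp add: ring_Ak_def mconst_def)
  then have "mconst (1 / c) \<in> ring_Ak q r k"
    by (intro mconst_mem_ring_Ak) (simp add: in_Fq_def power_one_over)
  moreover have "0 \<in> ring_Ak q r k" by (simp add: ring_Ak_def)
  moreover have "mconst (1 / c) * mconst c = 1"
    using g(2) by (simp add: mconst_def mult_single)
  then have "1 = (\<Sum>j<m. (if j = i then mconst (1 / c) else 0) * g j)"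
    using i g(1) by (simp add: if_distrib[of "\<lambda>u. u * _"] sum.delta' cong: if_cong)
  ultimately have "1 \<in> ideal_in (ring_Ak q r k) g m"
    unfolding ideal_in_def by (intro CollectI exI[of _ "\<lambda>j. if j = i then mconst (1 / c) else 0"]) auto
  then show False using reg by (simp add: regular_seq_in_def)
qed

text \<open>\<open>J i\<close> is the leading variable of \<open>G i\<close>. Larger index means
  smaller weight; the constant monomial, with no keys, is allowed.\<close>

definition triangular_system :: "nat \<Rightarrow> nat \<Rightarrow> (nat \<Rightarrow> 'a::field mpoly) \<Rightarrow> (nat \<Rightarrow> nat) \<Rightarrow> bool" where
  "triangular_system r m G J \<longleftrightarrow> inj_on J {..<m} \<and>
     (\<forall>i<m. J i < r \<and> Poly_Mapping.lookup (G i) (Poly_Mapping.single (J i) 1) \<noteq> 0 \<and>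
       (\<forall>t\<in>Poly_Mapping.keys (G i). t \<noteq> Poly_Mapping.single (J i) 1 \<longrightarrow> Poly_Mapping.keys t \<subseteq> {J i<..}))"

text \<open>The weighted-homogeneous system vanishes at the origin, and by (H2) its differentials there are independent.
  So the leading form of \<open>G\<^sub>i\<close> contains a variable linearly; by weights all other monomials of \<open>G\<^sub>i\<close> involve
  only variables of larger index, i.e. the system \<open>G = 0\<close> can be solved successively.\<close>

lemma leading_variables:
  fixes G :: "nat \<Rightarrow> 'a::field mpoly"
  assumes H: "H1H2 q r k m (\<lambda>i. wt_part r (G i))"
    and G: "\<And>i. i < m \<Longrightarrow> mvars (G i) \<subseteq> {..<r} - {k}"
    and k: "k < r"
  shows "\<exists>J. triangular_system r m G J"
proof -
  let ?g = "\<lambda>i. wt_part r (G i)"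
  have reg: "regular_seq_in (ring_Ak q r k) ?g m" using H by (simp add: H1H2_def)
  have keys: "Poly_Mapping.keys t \<subseteq> {..<r}" if "i < m" "t \<in> Poly_Mapping.keys (G i)" for i t
    using G[OF that(1)] that(2) by (auto simp: mvars_def)
  \<comment> \<open>A constant term in the leading form would force weight 0, making the form
    constant against regularity.\<close>
  have "Poly_Mapping.lookup (?g i) 0 = 0" if i: "i < m" for i
  proof (rule ccontr)
    assume nz: "Poly_Mapping.lookup (?g i) 0 \<noteq> 0"
    then have wt: "poly_wt r (G i) = 0" by (auto simp: lookup_wt_part mono_wt_def split: if_splits)
    have "Poly_Mapping.lookup (?g i) t = 0" if t0: "t \<noteq> 0" for t
    proof (rule ccontr)
      assume "Poly_Mapping.lookup (?g i) t \<noteq> 0"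
      then have t: "mono_wt r t = 0" "t \<in> Poly_Mapping.keys (G i)"
        using wt by (auto simp: lookup_wt_part in_keys_iff split: if_splits)
      obtain l where "l \<in> Poly_Mapping.keys t" using t0 by fastforce
      then show False using mono_wt_ge[of l t r] t keys[OF i t(2)] by auto
    qed
    then have "?g i = mconst (Poly_Mapping.lookup (?g i) 0)"
      by (intro poly_mapping_eqI) (auto simp: mconst_def lookup_single when_def)
    then show False using regular_seq_not_const[OF reg i _ nz] by blast
  qed
  then have "(\<lambda>_. 0) \<in> zero_set r (?g ` {..<m})"
    by (auto simp: zero_set_def aff_def meval_at_0)
  then have rank: "mrank m (jac_Ak r k m ?g (\<lambda>_. 0)) = m" using H by (auto simp: H1H2_def)
  let ?c = "\<lambda>j. if j < k then j else Suc j"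
  let ?L = "\<lambda>i l. Poly_Mapping.lookup (?g i) (Poly_Mapping.single l 1)"
  have surj: "\<exists>v. \<forall>i<m. (\<Sum>j<r - 1. ?L i (?c j) * v j) = u i" for u
    using rank unfolding jac_Ak_def mrank_eq_iff_surjective meval_mpderiv_at_0 by blast
  have c: "?c j < r" if "j < r - 1" for j using that by auto
  have "\<exists>j<r - 1. ?L i (?c j) \<noteq> 0" if "i < m" for i
  proof (rule ccontr)
    assume "\<not> ?thesis"
    then have "(\<Sum>j<r - 1. ?L i (?c j) * v j) = 0" for v by (intro sum.neutral) auto
    then show False using surj[of "\<lambda>_. 1"] that by auto
  qed
  then obtain j where j: "\<And>i. i < m \<Longrightarrow> j i < r - 1" "\<And>i. i < m \<Longrightarrow> ?L i (?c (j i)) \<noteq> 0" by metis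
  let ?J = "\<lambda>i. ?c (j i)"
  have J: "?J i < r" if "i < m" for i using c[OF j(1)[OF that]] .
  have L: "mono_wt r (Poly_Mapping.single l 1) = poly_wt r (G i)"
    "Poly_Mapping.lookup (G i) (Poly_Mapping.single l 1) \<noteq> 0" if "?L i l \<noteq> 0" for i l
    using that unfolding lookup_wt_part by (auto split: if_splits)
  have wt: "poly_wt r (G i) = r - ?J i" if "i < m" for i
    using L(1)[OF j(2)[OF that]] by (simp only: mono_wt_single)
  \<comment> \<open>Equations sharing a leading variable have equal weight, so the linear parts of
    both leading forms are multiples of that variable: two proportional rows, against full
    rank.\<close>
  have inj: "inj_on ?J {..<m}"
  proof (rule inj_onI, rule ccontr)
    fix i i' assume ii': "i \<in> {..<m}" "i' \<in> {..<m}" "?J i = ?J i'" "i \<noteq> i'"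
    have "j i = j i'" using ii'(3) by (auto split: if_splits)
    have only: "?L h (?c l) = 0" if "h = i \<or> h = i'" "l < r - 1" "l \<noteq> j i" for h l
    proof (rule ccontr)
      assume "?L h (?c l) \<noteq> 0"
      then have "r - ?c l = poly_wt r (G h)" using L(1) mono_wt_single by metis
      also have "\<dots> = r - ?J i" using wt that(1) ii' by auto
      finally have "?c l = ?J i" using c[OF that(2)] J[of i] ii'(1) by auto
      then show False using that(3) by (auto split: if_splits)
    qed
    obtain v where v: "\<forall>h<m. (\<Sum>l<r - 1. ?L h (?c l) * v l) = (if h = i then 1 else 0)"
      using surj[of "\<lambda>h. if h = i then 1 else 0"] by blast
    have val: "(\<Sum>l<r - 1. ?L h (?c l) * v l) = ?L h (?J i) * v (j i)" if "h = i \<or> h = i'" for h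
    proof -
      have "(\<Sum>l<r - 1. ?L h (?c l) * v l) = (\<Sum>l\<in>{j i}. ?L h (?c l) * v l)"
        by (rule sum.mono_neutral_right) (use only[OF that] j(1)[of i] ii'(1) in auto)
      then show ?thesis by simp
    qed
    have "?L i (?J i) * v (j i) = 1"
      using v[rule_format, of i] ii'(1) unfolding val[OF disjI1[OF refl]] by simp
    moreover have "?L i' (?J i) * v (j i) = 0"
      using v[rule_format, of i'] ii'(2,4) unfolding val[OF disjI2[OF refl]] by simp
    moreover have "?L i' (?J i) \<noteq> 0" using j(2)[of i'] ii' by simp
    ultimately show False by simp
  qed
  show ?thesis
    unfolding triangular_system_def
  proof (intro exI[of _ ?J] conjI allI impI ballI)
    show "inj_on ?J {..<m}" by (rule inj)
    show "?J i < r" if "i < m" for i using J[OF that] .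
    show "Poly_Mapping.lookup (G i) (Poly_Mapping.single (?J i) 1) \<noteq> 0" if "i < m" for i
      using L(2)[OF j(2)[OF that]] .
    fix i t assume i: "i < m" and t: "t \<in> Poly_Mapping.keys (G i)" "t \<noteq> Poly_Mapping.single (?J i) 1"
    show "Poly_Mapping.keys t \<subseteq> {?J i<..}"
    proof
      fix l assume l: "l \<in> Poly_Mapping.keys t"
      have le: "mono_wt r t \<le> r - ?J i" using mono_wt_le_poly_wt[OF t(1), of r] wt[OF i] by simp
      have "l < r" using keys[OF i t(1)] l by auto
      moreover have "r - l \<le> r - ?J i" using mono_wt_ge[OF l, of r] le by linarith
      ultimately have "?J i \<le> l" using J[OF i] by linarith
      moreover have "l \<noteq> ?J i"
        using mono_wt_le_imp_single[OF l keys[OF i t(1)]] le t(2) by metis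
      ultimately show "l \<in> {?J i<..}" by simp
    qed
  qed
qed

text \<open>S is a polynomial retraction onto the zero set: it overwrites the leading coordinates
  from the largest index down. A correction at j leaves equations with larger leading index
  untouched.\<close>

lemma triangular_system_solution:
  fixes G :: "nat \<Rightarrow> 'a::field mpoly"
  assumes tri: "triangular_system r m G J"
  shows "\<exists>S. (\<forall>j. pfun (\<lambda>b. S b j)) \<and> (\<forall>b j. j \<notin> J ` {..<m} \<longrightarrow> S b j = b j) \<and>
    (\<forall>b i. i < m \<longrightarrow> meval (S b) (G i) = 0) \<and> (\<forall>b. (\<forall>i<m. meval b (G i) = 0) \<longrightarrow> S b = b)"
proof -
  have inj: "inj_on J {..<m}" and Jr: "\<And>i. i < m \<Longrightarrow> J i < r"
    and lead: "\<And>i. i < m \<Longrightarrow> Poly_Mapping.lookup (G i) (Poly_Mapping.single (J i) 1) \<noteq> 0"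
    and rest: "\<And>i t. i < m \<Longrightarrow> t \<in> Poly_Mapping.keys (G i) \<Longrightarrow> t \<noteq> Poly_Mapping.single (J i) 1
      \<Longrightarrow> Poly_Mapping.keys t \<subseteq> {J i<..}"
    using tri by (simp_all add: triangular_system_def)
  define c where "c i = Poly_Mapping.lookup (G i) (Poly_Mapping.single (J i) 1)" for i
  define h where "h i x = (\<Sum>t\<in>Poly_Mapping.keys (G i) - {Poly_Mapping.single (J i) 1}.
    Poly_Mapping.lookup (G i) t * mono_eval x t)" for i x
  have cnz: "c i \<noteq> 0" if "i < m" for i using lead[OF that] by (simp add: c_def)
  have split: "meval x (G i) = c i * x (J i) + h i x" if "i < m" for i x
    unfolding meval_eq h_def c_def using lead[OF that]
    by (subst sum.remove[of _ "Poly_Mapping.single (J i) 1"]) (auto simp: in_keys_iff)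
  have h_cong: "h i x = h i y" if "i < m" "\<And>l. J i < l \<Longrightarrow> x l = y l" for i x y
    unfolding h_def
    by (intro sum.cong refl arg_cong2[of _ _ _ _ times] mono_eval_cong) (use rest[OF that(1)] that(2) in blast)
  have h_pfun: "pfun (h i)" for i
    unfolding h_def mono_eval_def by (intro pfun_intros)
  \<comment> \<open>After n steps the indices from r - n on are treated and the smaller coordinates
    are still unchanged.\<close>
  have "\<exists>S. (\<forall>j. pfun (\<lambda>b. S b j)) \<and> (\<forall>b j. j \<notin> J ` {..<m} \<longrightarrow> S b j = b j) \<and> (\<forall>b j. j < r - n \<longrightarrow> S b j = b j)
      \<and> (\<forall>b i. i < m \<longrightarrow> r - n \<le> J i \<longrightarrow> meval (S b) (G i) = 0)
      \<and> (\<forall>b. (\<forall>i<m. meval b (G i) = 0) \<longrightarrow> S b = b)" if "n \<le> r" for n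
    using that
  proof (induction n)
    case 0
    have "\<not> r - 0 \<le> J i" if "i < m" for i using Jr[OF that] by simp
    then show ?case by (intro exI[of _ "\<lambda>b. b"]) (auto simp: pfun_var)
  next
    case (Suc n)
    then obtain S where S: "\<And>j. pfun (\<lambda>b. S b j)" "\<And>b j. j \<notin> J ` {..<m} \<Longrightarrow> S b j = b j"
      "\<And>b j. j < r - n \<Longrightarrow> S b j = b j" "\<And>b i. i < m \<Longrightarrow> r - n \<le> J i \<Longrightarrow> meval (S b) (G i) = 0"
      "\<And>b. (\<forall>i<m. meval b (G i) = 0) \<Longrightarrow> S b = b" by auto
    define j where "j = r - Suc n"
    have j: "r - n = Suc j" using Suc.prems by (simp add: j_def)
    show ?case
    proof (cases "j \<in> J ` {..<m}")
      case False
      then have "r - n \<le> J i" if "i < m" "j \<le> J i" for i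
        using that j by (metis image_eqI lessThan_iff le_neq_implies_less Suc_leI)
      then show ?thesis
        by (intro exI[of _ S]) (use S j in \<open>auto simp: j_def[symmetric]\<close>)
    next
      case True
      then obtain i0 where i0: "i0 < m" "j = J i0" by auto
      define S' where "S' b = (S b)(j := - h i0 (S b) / c i0)" for b
      have agree: "S' b l = S b l" if "j < l" for b l using that by (simp add: S'_def)
      have p: "pfun (\<lambda>b. S' b l)" for l
      proof (cases "l = j")
        case True
        have "pfun (\<lambda>b. (- 1 / c i0) * h i0 (S b))"
          by (intro pfun_cmult pfun_compose[OF h_pfun] S(1))
        then show ?thesis using True by (simp add: S'_def)
      qed (simp add: S'_def S(1))
      have z: "meval (S' b) (G i) = 0" if i: "i < m" "j \<le> J i" for b i
      proof (cases "i = i0")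
        case True
        have "h i0 (S' b) = h i0 (S b)" by (rule h_cong[OF i0(1)]) (use i0(2) agree in auto)
        then show ?thesis unfolding True split[OF i0(1)] using cnz[OF i0(1)] i0(2) by (simp add: S'_def)
      next
        case False
        then have "J i \<noteq> J i0" using inj i(1) i0(1) by (auto dest: inj_onD)
        then have lt: "j < J i" using i(2) i0(2) by simp
        have "h i (S' b) = h i (S b)" by (rule h_cong[OF i(1)]) (use lt agree in auto)
        then have "meval (S' b) (G i) = meval (S b) (G i)"
          unfolding split[OF i(1)] using agree[OF lt] by simp
        then show ?thesis using S(4)[OF i(1)] lt j by simp
      qed
      have f: "S' b = b" if "\<forall>i<m. meval b (G i) = 0" for b
      proof -
        have Sb: "S b = b" using S(5)[OF that] .
        have "c i0 * b j + h i0 b = 0" using that i0 split[OF i0(1), of b] by simp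
        then have "b j = - h i0 b / c i0" using cnz[OF i0(1)] by (simp add: field_simps eq_neg_iff_add_eq_0)
        then show ?thesis by (simp add: S'_def Sb fun_upd_idem)
      qed
      have "S' b l = b l" if "l \<notin> J ` {..<m} \<or> l < j" for b l
        using that S(2,3) True j by (auto simp: S'_def)
      then show ?thesis
        by (intro exI[of _ S']) (use p z f in \<open>auto simp: j_def[symmetric]\<close>)
    qed
  qed
  from this[OF order.refl] obtain S where S: "\<forall>j. pfun (\<lambda>b. S b j)"
    "\<forall>b j. j \<notin> J ` {..<m} \<longrightarrow> S b j = b j"
    "\<forall>b i. i < m \<longrightarrow> r - r \<le> J i \<longrightarrow> meval (S b) (G i) = 0"
    "\<forall>b. (\<forall>i<m. meval b (G i) = 0) \<longrightarrow> S b = b" by (elim exE conjE)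
  then show ?thesis by (intro exI[of _ S] conjI) simp_all
qed

text \<open>Hence the zero set of the \<open>G\<^sub>i\<close> is the graph of a polynomial map on affine \<open>(r - m)\<close>-space.\<close>

lemma triangular_zero_set:
  fixes G :: "nat \<Rightarrow> 'a::alg_closed_field mpoly"
  assumes tri: "triangular_system r m G J"
  shows "zirreducible r (zero_set r (G ` {..<m}))" "enat (r - m) \<le> adim r (zero_set r (G ` {..<m}))"
proof -
  let ?W = "zero_set r (G ` {..<m})"
  have inj: "inj_on J {..<m}" and Jr: "\<And>i. i < m \<Longrightarrow> J i < r"
    using tri by (simp_all add: triangular_system_def)
  obtain S where S: "\<forall>j. pfun (\<lambda>b. S b j)" "\<forall>b j. j \<notin> J ` {..<m} \<longrightarrow> S b j = b j"
    "\<forall>b i. i < m \<longrightarrow> meval (S b) (G i) = 0" "\<forall>b. (\<forall>i<m. meval b (G i) = 0) \<longrightarrow> S b = b"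
    using triangular_system_solution[OF tri] by (elim exE conjE)
  note S = S[rule_format]
  define d where "d = r - m"
  let ?F = "{..<r} - J ` {..<m}"
  have "J ` {..<m} \<subseteq> {..<r}" using Jr by auto
  then have "card ?F = d" using card_image[OF inj] by (simp add: card_Diff_subset d_def)
  then obtain e where e: "bij_betw e {0..<d} ?F" using ex_bij_betw_nat_finite[of ?F] by auto
  have eF: "e i < r" "e i \<notin> J ` {..<m}" if "i < d" for i
    using bij_betw_apply[OF e, of i] that by auto
  have e_inj: "e i = e i' \<longleftrightarrow> i = i'" if "i < d" "i' < d" for i i'
    using bij_betw_imp_inj_on[OF e] that by (auto simp: inj_on_def)
  \<comment> \<open>The chain is obtained by setting the free coordinates \<open>e i\<close> with i
    \<ge> l to zero; \<open>P l\<close> below does this to the parameters, so S after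
    \<open>P l\<close> parametrises \<open>D l\<close>.\<close>
  define D where "D l = {x\<in>?W. \<forall>i\<in>{l..<d}. x (e i) = 0}" for l
  define P where "P l b j = (if j < r \<and> j \<notin> e ` {l..<d} then b j else 0)" for l and b :: "nat \<Rightarrow> 'a" and j
  have P_pfun: "pfun (\<lambda>b. P l b j)" for l j
    by (cases "j < r \<and> j \<notin> e ` {l..<d}") (auto simp: P_def pfun_var pfun_const)
  have SP_aff: "S (P l b) \<in> aff r" for l b
  proof -
    have "S (P l b) i = 0" if "r \<le> i" for i
      using S(2)[of i "P l b"] that \<open>J ` {..<m} \<subseteq> {..<r}\<close> by (force simp: P_def)
    then show ?thesis by (simp add: aff_def)
  qed
  have SP_e: "S (P l b) (e i) = (if l \<le> i then 0 else b (e i))" if "i < d" for l b i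
  proof -
    have "e i \<in> e ` {l..<d} \<longleftrightarrow> l \<le> i" using that e_inj by auto
    then show ?thesis using S(2)[OF eF(2)[OF that]] eF(1)[OF that] by (simp add: P_def)
  qed
  have range: "range (\<lambda>b. S (P l b)) = D l" for l
  proof (intro equalityI subsetI)
    fix x assume "x \<in> range (\<lambda>b. S (P l b))"
    then show "x \<in> D l" using SP_aff S(3) SP_e by (auto simp: D_def zero_set_def)
  next
    fix x assume x: "x \<in> D l"
    then have "P l x = x" by (auto simp: D_def P_def zero_set_def aff_def fun_eq_iff)
    moreover have "S x = x" using x by (intro S(4)) (auto simp: D_def zero_set_def)
    ultimately have "x = S (P l x)" by simp
    then show "x \<in> range (\<lambda>b. S (P l b))" by blast
  qed
  have closed: "zclosed r (D l)" for l
  proof -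
    have "D l = ?W \<inter> {x\<in>aff r. \<forall>f\<in>(\<lambda>i x. x (e i)) ` {l..<d}. f x = 0}"
      by (auto simp: D_def zero_set_def)
    also have "zclosed r \<dots>"
      by (intro zclosed_Int zclosed_zero_set zclosed_zero_locus) (auto simp: pfun_var)
    finally show ?thesis .
  qed
  have irr: "zirreducible r (D l)" for l
  proof -
    have "pfun (\<lambda>b. S (P l b) j)" for j by (rule pfun_compose[OF S(1)]) (rule P_pfun)
    then show ?thesis
      using zirreducible_range[of "\<lambda>b. S (P l b)" r] closed[of l] unfolding range by blast
  qed
  have "D d = ?W" by (auto simp: D_def)
  then show "zirreducible r ?W" using irr[of d] by simp
  have "D l \<subset> D (Suc l)" if l: "l < d" for l
  proof -
    have "S (P (Suc l) (\<lambda>_. 1)) \<in> D (Suc l)" using range by blast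
    moreover have "S (P (Suc l) (\<lambda>_. 1)) \<notin> D l"
      using SP_e[OF l, of "Suc l" "\<lambda>_. 1"] l by (auto simp: D_def intro!: bexI[of _ l])
    moreover have "D l \<subseteq> D (Suc l)" by (auto simp: D_def)
    ultimately show ?thesis by blast
  qed
  moreover have "D l \<subseteq> ?W" for l by (auto simp: D_def)
  ultimately have "zchain r d D ?W" using irr by (simp add: zchain_def)
  then show "enat (r - m) \<le> adim r ?W"
    unfolding d_def by (intro adim_geI) (simp add: zclosure_closed zclosed_zero_set)
qed

section \<open>The Jacobian of the lift and the singular locus\<close>

lemma mpderiv_eq_0:
  assumes "k \<notin> mvars p"
  shows "mpderiv k p = 0"
proof -
  have "Poly_Mapping.lookup t k = 0" if "t \<in> Poly_Mapping.keys p" for t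
    using assms that by (auto simp: mvars_def in_keys_iff)
  then show ?thesis by (simp add: mpderiv_def mconst_def)
qed

lemma zero_set_sym_lift:
  fixes G :: "nat \<Rightarrow> 'a::field mpoly"
  assumes "\<And>i. i < m \<Longrightarrow> mvars (G i) \<subseteq> {..<r}"
  shows "zero_set r ((\<lambda>i. sym_lift r (G i)) ` {..<m}) = {x\<in>aff r. root_map r x \<in> zero_set r (G ` {..<m})}"
  using assms by (auto simp: zero_set_def meval_sym_lift root_map_aff)

text \<open>The k-th coefficient of the direction cannot be controlled, but the partial derivative
  by A_k is zero, so it does not enter the sum.\<close>

lemma jac_sym_lift_full_rank:
  fixes G :: "nat \<Rightarrow> 'a::field mpoly"
  assumes k: "k < r" and G: "\<And>i. i < m \<Longrightarrow> mvars (G i) \<subseteq> {..<r} - {k}"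
    and rank: "mrank m (jac_Ak r k m G (root_map r x)) = m"
    and cases: "inj_on x {..<r} \<or>
      (\<exists>\<alpha>\<in>{..<r}. \<exists>\<beta>\<in>{..<r}. \<alpha> \<noteq> \<beta> \<and> x \<alpha> = x \<beta> \<and> inj_on x ({..<r} - {\<beta>}) \<and> x \<beta> ^ k \<noteq> 0)"
  shows "mrank m (jac r m (\<lambda>i. sym_lift r (G i)) x) = m"
  unfolding jac_def mrank_eq_iff_surjective
proof
  fix y :: "nat \<Rightarrow> 'a"
  let ?a = "root_map r x"
  let ?c = "\<lambda>j. if j < k then j else Suc j"
  let ?D = "\<lambda>i l. meval ?a (mpderiv l (G i))"
  obtain u where u: "\<forall>i<m. (\<Sum>j<r - 1. ?D i (?c j) * u j) = y i"
    using rank unfolding jac_Ak_def mrank_eq_iff_surjective by blast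
  obtain v where v: "\<forall>l<r. l \<noteq> k \<longrightarrow> coeff (roots_poly_deriv {..<r} x v) l = (if l < k then u l else u (l - 1))"
    using roots_poly_deriv_prescribe[OF k cases, of "\<lambda>l. if l < k then u l else u (l - 1)"] by blast
  have "(\<Sum>j<r. meval x (mpderiv j (sym_lift r (G i))) * v j) = y i" if i: "i < m" for i
  proof -
    have "(\<Sum>j<r. meval x (mpderiv j (sym_lift r (G i))) * v j)
        = (\<Sum>l<r. ?D i l * coeff (roots_poly_deriv {..<r} x v) l)"
      using G[OF i] by (intro sym_lift_directional_derivative) auto
    also have "\<dots> = (\<Sum>l\<in>{..<r} - {k}. ?D i l * coeff (roots_poly_deriv {..<r} x v) l)"
    proof (intro sum.mono_neutral_right)
      have "mpderiv k (G i) = 0" using G[OF i] by (intro mpderiv_eq_0) blast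
      then show "\<forall>l\<in>{..<r} - ({..<r} - {k}). ?D i l * coeff (roots_poly_deriv {..<r} x v) l = 0" by auto
    qed auto
    also have "\<dots> = (\<Sum>l\<in>{..<r} - {k}. ?D i l * (if l < k then u l else u (l - 1)))"
      by (intro sum.cong refl) (use v in auto)
    also have "\<dots> = (\<Sum>j<r - 1. ?D i (?c j) * u j)"
      by (rule sum.reindex_bij_witness[of _ ?c "\<lambda>l. if l < k then l else l - 1"]) (use k in auto)
    finally show ?thesis using u i by simp
  qed
  then show "\<exists>v. \<forall>i<m. (\<Sum>j<r. meval x (mpderiv j (sym_lift r (G i))) * v j) = y i" by blast
qed

text \<open>Some coincidence must exist. If a_0 is nonzero, the repeated root is nonzero, so the
  two-coincidence case fails only through a further coincidence away from \<beta>.\<close>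

lemma jac_sym_lift_rank_deficient:
  fixes G :: "nat \<Rightarrow> 'a::field mpoly"
  assumes k: "k < r" and G: "\<And>i. i < m \<Longrightarrow> mvars (G i) \<subseteq> {..<r} - {k}"
    and rank: "mrank m (jac_Ak r k m G (root_map r x)) = m"
    and deficient: "mrank m (jac r m (\<lambda>i. sym_lift r (G i)) x) < m"
  shows "Disc (fpoly r (root_map r x)) = 0 \<and> (root_map r x 0 = 0 \<or> Subdisc (fpoly r (root_map r x)) = 0)"
proof -
  have no: "\<not> (inj_on x {..<r} \<or>
      (\<exists>\<alpha>\<in>{..<r}. \<exists>\<beta>\<in>{..<r}. \<alpha> \<noteq> \<beta> \<and> x \<alpha> = x \<beta> \<and> inj_on x ({..<r} - {\<beta>}) \<and> x \<beta> ^ k \<noteq> 0))"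
    using jac_sym_lift_full_rank[OF k G rank] deficient by (metis less_irrefl)
  then obtain \<alpha> \<beta> where ab: "\<alpha> < r" "\<beta> < r" "\<alpha> \<noteq> \<beta>" "x \<alpha> = x \<beta>" by (auto simp: inj_on_def)
  have "Disc (fpoly r (root_map r x)) = 0"
    unfolding fpoly_root_map by (rule Disc_roots_poly_eq_0[OF ab])
  moreover have "Subdisc (fpoly r (root_map r x)) = 0" if "root_map r x 0 \<noteq> 0"
  proof -
    have "root_map r x 0 = poly (roots_poly r x) 0" using k by (simp add: root_map_def poly_0_coeff_0)
    then have "x \<beta> \<noteq> 0" using that ab(2) by (auto simp: poly_roots_poly)
    then have "\<not> inj_on x ({..<r} - {\<beta>})" using no ab by auto
    then obtain \<gamma> \<delta> where cd: "\<gamma> < r" "\<delta> < r" "\<gamma> \<noteq> \<delta>" "x \<gamma> = x \<delta>" "\<gamma> \<noteq> \<beta>" "\<delta> \<noteq> \<beta>"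
      by (auto simp: inj_on_def)
    show ?thesis unfolding fpoly_root_map by (rule Subdisc_roots_poly_eq_0[OF ab cd])
  qed
  ultimately show ?thesis by blast
qed

text \<open>The R_i belong to the vanishing ideal, whether or not they generate it; this puts the
  tangent space inside the kernel of the Jacobian.\<close>

lemma adim_tangent_space_le:
  fixes R :: "nat \<Rightarrow> 'a::alg_closed_field mpoly"
  assumes R: "\<And>i. i < m \<Longrightarrow> mvars (R i) \<subseteq> {..<r}"
    and rank: "mrank m (jac r m R x) = m"
  shows "adim r (tangent_space r (zero_set r (R ` {..<m})) x) \<le> enat (r - m)"
proof (rule adim_le_natI)
  let ?A = "\<lambda>i j. meval x (mpderiv j (R i))"
  let ?K = "{v\<in>aff r. \<forall>i<m. (\<Sum>j<r. ?A i j * v j) = 0}"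
  let ?T = "tangent_space r (zero_set r (R ` {..<m})) x"
  have "R i \<in> vanishing_ideal r (zero_set r (R ` {..<m}))" if "i < m" for i
    using R[OF that] that by (auto simp: vanishing_ideal_def zero_set_def)
  then have sub: "?T \<subseteq> ?K" by (auto simp: tangent_space_def)
  have "?K = {v\<in>aff r. \<forall>f\<in>(\<lambda>i v. \<Sum>j<r. ?A i j * v j) ` {..<m}. f v = 0}" by auto
  also have "zclosed r \<dots>" by (rule zclosed_zero_locus) (auto intro!: pfun_intros)
  finally have cl: "zclosed r ?K" .
  have surj: "\<exists>v. \<forall>i<m. (\<Sum>j<r. ?A i j * v j) = u i" for u
    using rank unfolding jac_def mrank_eq_iff_surjective by blast
  fix n C assume "zchain r n C (zclosure r ?T)"
  then have "zchain r n C ?K" by (rule zchain_mono[OF _ zclosure_least[OF sub cl]])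
  then have "n + m \<le> r" by (rule zchain_kernel_length_le[rotated]) (rule surj)
  then show "n \<le> r - m" by simp
qed

text \<open>A component of \<open>V\<close> lying over the irreducible set \<open>W\<close> is moved through any given point of \<open>V\<close> by a permutation.\<close>

lemma local_dim_root_map_vimage_ge:
  fixes W :: "(nat \<Rightarrow> 'a::alg_closed_field) set"
  assumes W: "zirreducible r W" and x: "x \<in> aff r" "root_map r x \<in> W"
  shows "adim r W \<le> local_dim r {x\<in>aff r. root_map r x \<in> W} x"
proof -
  let ?V = "{x\<in>aff r. root_map r x \<in> W}"
  have clW: "zclosed r W" using W by (simp add: zirreducible_def)
  have clV: "zclosed r ?V" by (rule zclosed_root_map_vimage[OF clW])
  have "W \<subseteq> root_map r ` ?V"
    using root_map_surj zclosed_subset_aff[OF clW] by fastforce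
  then obtain C where C: "zirreducible r C" "C \<subseteq> ?V" "root_map r ` C = W"
    using zirreducible_lift[OF clV W] by blast
  from x(2) have "root_map r x \<in> root_map r ` C" unfolding C(3) .
  then obtain y where y: "y \<in> C" "root_map r x = root_map r y" by (elim imageE)
  then obtain \<pi> where \<pi>: "\<pi> permutes {..<r}" "x = y \<circ> \<pi>" using root_map_eq_imp_permute by blast
  let ?C = "(\<lambda>z. z \<circ> \<pi>) ` C"
  have irr: "zirreducible r ?C" by (rule zirreducible_permute[OF C(1) \<pi>(1)])
  have "root_map r (z \<circ> \<pi>) = root_map r z" for z :: "nat \<Rightarrow> 'a" by (rule root_map_permute[OF \<pi>(1)])
  then have im: "root_map r ` ?C = W" using C(3) by (simp only: image_image)
  have "?C \<subseteq> ?V"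
    using im zclosed_subset_aff[of r ?C] irr by (auto simp: zirreducible_def simp del: o_apply)
  moreover have "x \<in> ?C" using y(1) \<pi>(2) by blast
  ultimately have "adim r ?C \<le> local_dim r ?V x"
    unfolding local_dim_def using irr by (intro Sup_upper) blast
  moreover have "adim r W \<le> adim r ?C"
    using adim_root_map_image_le[of r ?C] irr im by (simp add: zirreducible_def)
  ultimately show ?thesis by (rule order.trans[rotated])
qed

theorem mainTheorem7:
  fixes p e q r m k :: nat and G :: "nat \<Rightarrow> 'a::alg_closed_field mpoly"
  assumes p_prime: "prime p" and charp: "CHAR('a) = p" and e_pos: "e > 0" and q_def: "q = p ^ e"
    and algebraic: "\<forall>x::'a. \<exists>P::'a poly. P \<noteq> 0 \<and> (\<forall>i. in_Fq q (coeff P i)) \<and> poly P x = 0"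
    and m_pos: "0 < m" and m_lt_r: "m < r" and k_lt_r: "k < r"
    and H1_H2: "H1H2 q r k m G"
    and H3: "H1H2 q r k m (\<lambda>i. wt_part r (G i))"
    and H4: "codim_ge r 1 (disc_locus r (zero_set r (G ` {..<m}))) (zero_set r (G ` {..<m}))"
    and H5: "codim_ge r 1
               ({a\<in>disc_locus r (zero_set r (G ` {..<m})). a 0 = 0}
                  \<union> subdisc_locus r (zero_set r (G ` {..<m})))
               (disc_locus r (zero_set r (G ` {..<m})))"
    and H6: "codim_ge r 1 (disc_locus r (zero_set r ((\<lambda>i. wt_part r (G i)) ` {..<m})))
               (zero_set r ((\<lambda>i. wt_part r (G i)) ` {..<m}))"
  shows "codim_ge r 2
           {x\<in>zero_set r ((\<lambda>i. sym_lift r (G i)) ` {..<m}).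
              mrank m (jac r m (\<lambda>i. sym_lift r (G i)) x) < m}
           (zero_set r ((\<lambda>i. sym_lift r (G i)) ` {..<m}))
       \<and> codim_ge r 2 (sing_locus r (zero_set r ((\<lambda>i. sym_lift r (G i)) ` {..<m})))
           (zero_set r ((\<lambda>i. sym_lift r (G i)) ` {..<m}))"
proof -
  let ?W = "zero_set r (G ` {..<m})"
  let ?R = "\<lambda>i. sym_lift r (G i)"
  let ?V = "zero_set r (?R ` {..<m})"
  let ?Z = "{a\<in>disc_locus r ?W. a 0 = 0} \<union> subdisc_locus r ?W"
  let ?B = "{x\<in>?V. mrank m (jac r m ?R x) < m}"
  have G: "mvars (G i) \<subseteq> {..<r} - {k}" if "i < m" for i
    using H1_H2 that by (auto simp: H1H2_def regular_seq_in_def ring_Ak_def)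
  have V: "?V = {x\<in>aff r. root_map r x \<in> ?W}"
    using G by (intro zero_set_sym_lift) blast
  obtain J where "triangular_system r m G J"
    using leading_variables[OF H3 G k_lt_r] by blast
  note W = triangular_zero_set[OF this]
  have irr: "zirreducible r ?W" and dim: "enat (r - m) \<le> adim r ?W"
    using W by blast+
  have Z: "?Z \<subseteq> disc_locus r ?W" "disc_locus r ?W \<subseteq> ?W" "?W \<subseteq> aff r"
    by (auto simp: subdisc_locus_def disc_locus_def zero_set_def)
  have B: "?B \<subseteq> {x\<in>aff r. root_map r x \<in> ?Z}"
  proof
    fix x assume x: "x \<in> ?B"
    then have xW: "x \<in> aff r" "root_map r x \<in> ?W" unfolding V by auto
    have rank: "mrank m (jac_Ak r k m G (root_map r x)) = m" using H1_H2 xW(2) by (simp add: H1H2_def)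
    have "Disc (fpoly r (root_map r x)) = 0 \<and> (root_map r x 0 = 0 \<or> Subdisc (fpoly r (root_map r x)) = 0)"
    proof (rule jac_sym_lift_rank_deficient[OF k_lt_r _ rank])
      show "mrank m (jac r m ?R x) < m" using x by simp
    qed (rule G)
    then show "x \<in> {x\<in>aff r. root_map r x \<in> ?Z}"
      using xW by (auto simp: disc_locus_def subdisc_locus_def)
  qed
  \<comment> \<open>At a point of full rank the tangent space has dimension at most r - m, and the
    local dimension is at least that.\<close>
  have sing: "sing_locus r ?V \<subseteq> ?B"
  proof
    fix x assume x: "x \<in> sing_locus r ?V"
    then have xV: "x \<in> ?V" and gt: "local_dim r ?V x < adim r (tangent_space r ?V x)"
      by (auto simp: sing_locus_def)
    have "mrank m (jac r m ?R x) \<noteq> m"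
    proof
      assume "mrank m (jac r m ?R x) = m"
      then have "adim r (tangent_space r ?V x) \<le> enat (r - m)"
        by (intro adim_tangent_space_le mvars_sym_lift)
      also have "\<dots> \<le> adim r ?W" by (rule dim)
      also have "\<dots> \<le> local_dim r ?V x"
        using local_dim_root_map_vimage_ge[OF irr, of x] xV unfolding V by blast
      finally show False using gt by simp
    qed
    moreover have "mrank m (jac r m ?R x) \<le> m"
      unfolding jac_def by (rule vec_space.rank_le_nr[OF mat_carrier])
    ultimately show "x \<in> ?B" using xV by simp
  qed
  \<comment> \<open>Stated for all subsets of \<open>?B\<close>, to serve both claims: S lies over
    \<open>?Z\<close>, which is two dimensions below \<open>?W\<close>, and \<open>?W\<close> is the
    image of \<open>?V\<close>.\<close>
  have codim: "codim_ge r 2 S ?V" if S: "S \<subseteq> ?B" for S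
  proof (cases "S = {}")
    case False
    \<comment> \<open>Nonemptiness is tracked because \<open>codim_ge\<close> gives no inequality of
      dimensions when the smaller set is empty.\<close>
    then have "?Z \<noteq> {}" using S B by blast
    then have "disc_locus r ?W \<noteq> {}" using Z(1) by blast
    have "adim r S \<le> adim r {x\<in>aff r. root_map r x \<in> ?Z}"
      using S B by (intro adim_mono) blast
    also have "\<dots> \<le> adim r ?Z" using Z by (intro adim_root_map_vimage_le) blast
    finally have "adim r S + enat 2 \<le> adim r ?Z + enat 2" by (rule add_right_mono)
    also have "\<dots> = adim r ?Z + enat 1 + enat 1" by (simp add: add.assoc)
    also have "\<dots> \<le> adim r (disc_locus r ?W) + enat 1"
      using H5 \<open>?Z \<noteq> {}\<close> unfolding codim_ge_def by (intro add_right_mono) argo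
    also have "\<dots> \<le> adim r ?W"
      using H4 \<open>disc_locus r ?W \<noteq> {}\<close> by (simp add: codim_ge_def)
    also have "?W = root_map r ` ?V"
      unfolding V using root_map_surj Z(3) by fastforce
    also have "adim r \<dots> \<le> adim r ?V"
      by (rule adim_root_map_image_le) (rule zclosed_zero_set)
    finally show ?thesis using S by (auto simp: codim_ge_def)
  qed (simp add: codim_ge_def)
  from codim[OF order.refl] codim[OF sing] show ?thesis by (rule conjI)
qed

end
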